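(* Let there be a family of Riemann--Hilbert problems, indexed by $b\in(0,i\infty)$, with cuts $\Gamma_j(b)$, coefficients $H_j(k)$ ($j=1,\dots,p$) and solutions $U(b,k)$, as described in the context, obeying all the restrictions listed there, including the commutativity restriction on the $H_j$. Let the ordinary differential equation in $b$ for this family (ODE1) be written as $$\frac{\partial}{\partial b}U(b,k)=\Big(\sum_{j=1}^p\frac{s_j(b)}{k-(k_j+b)}\Big)U(b,k),$$ with $N\times N$ matrices $s_j(b)$ analytic in $\Omega$. Let $\rho_1,\dots,\rho_d$ be the poles of the rational matrix $B(k)$ described in the context. Then there exist matrices $r_l(b)$, $l=1,\dots,d$, and a choice of the function ${\cal F}$ such that the matrices $s_j(b)$, $r_l(b)$ obey the system $$\frac{d r_l(b)}{db}=\sum_{j=1}^p\frac{[s_j(b),r_l(b)]}{\rho_l-(k_j+b)},\qquad l=1,\dots,d,$$ $$s_j(b)={\cal F}\big(\tilde F_j(b),\,R(b,k_j+b)\big),\qquad j=1,\dots,p,$$ where $$R(b,k_j+b)=\sum_{l=1}^d\frac{r_l(b)}{(k_j+b)-\rho_l},\qquad \tilde F_j(b)=-\frac{1}{2\pi i}\log\big(F_j(k_j+b)\big),\qquad [X,Y]=XY-YX.$$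
   Context: Original data. $G(k)$ is an algebraic $N\times N$ matrix function with no singularities and no zeros of the determinant on the real axis, tending to the identity $I$ as $|k|\to\infty$. The points $k_1,\dots,k_p$ are the branch points of $G$ in the upper half-plane, and $\Gamma_j=(k_j,k_j+i\infty)$ are cuts parallel to the imaginary axis, which do not pass through other branch points, poles or zeros of the determinant of $G$. For $k$ on a cut, $k^+$ and $k^-$ denote the right and left shores. Put $H_j(k)=G(k^-)G^{-1}(k^+)$ for $k\in\Gamma_j$. Restrictions on $H_j$. Each $H_j$ is an algebraic function, can be continued analytically into the half-strip $\Omega+k_j$, where $\Omega=\{|\mathrm{Re}\,k|<\epsilon,\ \mathrm{Im}\,k>0\}$ for some $\epsilon>0$, tends to $I$ as $\mathrm{Im}\,k\to\infty$, and has distinct eigenvalues almost everywhere. Commutativity restriction: for each $k$ and all $j_1,j_2$, $H_{j_1}(k)H_{j_2}(k)=H_{j_2}(k)H_{j_1}(k)$, where $H_{j_1}(k)$, $H_{j_2}(k)$ are any possible analytic continuations of $H_{j_1}$, $H_{j_2}$ to $k$. Common eigenvectors. Consequently $H_j(k)=P(k)F_j(k)P^{-1}(k)$ for all $j$, where $P(k)$ is an algebraic matrix composed of common eigenvectors (normalized, say, so that the first component of each is $1$) and $F_j(k)$ is the diagonal matrix of eigenvalues of $H_j(k)$. As $b\to i\infty$, $F_j(k_j+b)\to I$ and the branch of $\log F_j(k_j+b)$ close to the zero matrix is chosen; for other $b$ the branch is chosen by continuity. Family of Riemann--Hilbert problems. For imaginary $b\in(0,i\infty)$ let $\Gamma_j(b)=(k_j+b,k_j+i\infty)$.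 The $N\times N$ matrix function $U(b,k)$ satisfies $$U(b,k^+)=U(b,k^-)H_j(k),\qquad k\in\Gamma_j(b),\ j=1,\dots,p.$$ For each $b$ it is single-valued, continuous, and without singularities or zeros of the determinant on the $k$-plane cut along the $\Gamma_j(b)$, and it tends to $I$ as $|k|\to\infty$. Its leading term near $k=k_j+b$ is $$U(b,k)\approx K_j(k_j+b)\,\big(k-(k_j+b)\big)^{\log(F_j(k_j+b))/(2\pi i)}\,K_j^{-1}(k_j+b)$$ with some non-singular matrices $K_j$; the behaviour at these points is specified so that the problem has a unique solution. Moreover $U(i\infty,k)=I$. The matrix $B$. $B(k)$ is a rational $N\times N$ matrix commuting with all $H_j(k)$ on all their sheets, of the form $B=PDP^{-1}$ with $D$ diagonal, tending to $I$ as $|k|\to\infty$ and having only simple poles, located at $k=\rho_l$, $l=1,\dots,d$. The function ${\cal F}$. ${\cal F}(X,Y)$ produces a matrix whose eigenvalues coincide with the eigenvalues of $X$ and whose eigenvectors coincide with the eigenvectors of $Y$ (provided all eigenvalues of $Y$ are distinct). It is defined only up to a permutation of order $N$, namely the correspondence between the eigenvalues of $X$ and the eigenvectors of $Y$; a choice of ${\cal F}$ is a choice of this correspondence. *)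

theory Defs
  imports "HOL-Complex_Analysis.Complex_Analysis"
begin

unbundle no fps_syntax

section \<open>Matrices and matrix functions\<close>

type_synonym 'n cmat = "complex^'n^'n"

definition diag_mat :: "complex^'n::finite \<Rightarrow> 'n cmat" where
  "diag_mat v = (\<chi> i j. if i = j then v $ i else 0)"

definition commutator :: "'n::finite cmat \<Rightarrow> 'n cmat \<Rightarrow> 'n cmat" where
  "commutator X Y = X ** Y - Y ** X"

definition eigenvector :: "'n::finite cmat \<Rightarrow> complex^'n \<Rightarrow> bool" where
  "eigenvector A v \<longleftrightarrow> v \<noteq> 0 \<and> (\<exists>c. A *v v = c *s v)"

definition eigenvalues :: "'n::finite cmat \<Rightarrow> complex set" where
  "eigenvalues A = {c. \<exists>v. v \<noteq> 0 \<and> A *v v = c *s v}"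

definition distinct_eigenvalues :: "'n::finite cmat \<Rightarrow> bool" where
  "distinct_eigenvalues A \<longleftrightarrow> card (eigenvalues A) = CARD('n)"

text \<open>Equality of the eigenvalues counted with multiplicity, i.e. of the characteristic polynomials
  (\<open>mat z\<close> is the scalar matrix).\<close>

definition same_eigenvalues :: "'n::finite cmat \<Rightarrow> 'n cmat \<Rightarrow> bool" where
  "same_eigenvalues A B \<longleftrightarrow> (\<forall>z. det (mat z - A) = det (mat z - B))"

definition mat_holomorphic_on :: "(complex \<Rightarrow> 'n::finite cmat) \<Rightarrow> complex set \<Rightarrow> bool" where
  "mat_holomorphic_on M S \<longleftrightarrow> (\<forall>i j. (\<lambda>k. M k $ i $ j) holomorphic_on S)"

definition mat_analytic_on :: "(complex \<Rightarrow> 'n::finite cmat) \<Rightarrow> complex set \<Rightarrow> bool" where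
  "mat_analytic_on M S \<longleftrightarrow> (\<forall>i j. (\<lambda>k. M k $ i $ j) analytic_on S)"

definition mat_meromorphic_on :: "(complex \<Rightarrow> 'n::finite cmat) \<Rightarrow> complex set \<Rightarrow> bool" where
  "mat_meromorphic_on M S \<longleftrightarrow> (\<forall>i j. (\<lambda>k. M k $ i $ j) meromorphic_on S)"

text \<open>A function is algebraic on \<open>S\<close> if it satisfies a polynomial equation \<open>q(k, f(k)) = 0\<close> with
  \<open>q \<noteq> 0\<close>.  The outer variable of \<open>q\<close> is the value of \<open>f\<close>, its coefficients are polynomials in
  \<open>k\<close>.  Points where \<open>f\<close> is not analytic (poles, where the value of \<open>f\<close> is arbitrary) are exempt.\<close>

definition algebraic_on :: "(complex \<Rightarrow> complex) \<Rightarrow> complex set \<Rightarrow> bool" where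
  "algebraic_on f S \<longleftrightarrow>
     (\<exists>q :: complex poly poly. q \<noteq> 0 \<and>
        (\<forall>k\<in>S. f analytic_on {k} \<longrightarrow> poly (poly q [:f k:]) k = 0))"

definition mat_algebraic_on :: "(complex \<Rightarrow> 'n::finite cmat) \<Rightarrow> complex set \<Rightarrow> bool" where
  "mat_algebraic_on M S \<longleftrightarrow> (\<forall>i j. algebraic_on (\<lambda>k. M k $ i $ j) S)"

text \<open>\<open>continuation f S g A\<close>: the function element \<open>(g, A)\<close> is obtained from \<open>(f, S)\<close> by analytic
  continuation along a finite chain of convex open sets; \<open>S\<close> itself will be convex, so that all
  overlaps are connected.  The values \<open>g k\<close>, \<open>k \<in> A\<close>, are the values at \<open>k\<close> of the possible analytic
  continuations (on all sheets) of \<open>f\<close>.\<close>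

inductive continuation ::
    "(complex \<Rightarrow> 'n::finite cmat) \<Rightarrow> complex set \<Rightarrow> (complex \<Rightarrow> 'n cmat) \<Rightarrow> complex set \<Rightarrow> bool"
  for f S where
  base: "continuation f S f S"
| step: "continuation f S g A \<Longrightarrow> open C \<Longrightarrow> convex C \<Longrightarrow> A \<inter> C \<noteq> {} \<Longrightarrow>
         mat_holomorphic_on h C \<Longrightarrow> (\<forall>k\<in>A \<inter> C. h k = g k) \<Longrightarrow> continuation f S h C"


section \<open>Cuts and shores\<close>

text \<open>The open ray from \<open>0\<close> to \<open>\<i>\<infinity>\<close>, and the open cut from \<open>a\<close> to \<open>a + \<i>\<infinity>\<close>.\<close>

definition imag_ray :: "complex set" where
  "imag_ray = {b. Re b = 0 \<and> Im b > 0}"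

definition cut :: "complex \<Rightarrow> complex set" where
  "cut a = {k. Re k = Re a \<and> Im k > Im a}"

definition half_strip :: "real \<Rightarrow> complex set" where
  "half_strip \<epsilon> = {z. \<bar>Re z\<bar> < \<epsilon> \<and> Im z > 0}"

definition strip_at :: "real \<Rightarrow> complex \<Rightarrow> complex set" where
  "strip_at \<epsilon> a = (\<lambda>z. z + a) ` half_strip \<epsilon>"

definition cut_union :: "nat \<Rightarrow> (nat \<Rightarrow> complex) \<Rightarrow> complex \<Rightarrow> complex set" where
  "cut_union p \<kappa> b = (\<Union>j\<in>{1..p}. insert (\<kappa> j + b) (cut (\<kappa> j + b)))"

definition right_side :: "complex \<Rightarrow> complex set" where
  "right_side k = {z. Re z > Re k}"

definition left_side :: "complex \<Rightarrow> complex set" where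
  "left_side k = {z. Re z < Re k}"

text \<open>On the given side of \<open>k\<close>, \<open>M\<close> continues analytically through the shore point \<open>k\<close>, which is
  neither a branch point nor a pole nor a zero of the determinant.\<close>

definition regular_shore :: "(complex \<Rightarrow> 'n::finite cmat) \<Rightarrow> complex set \<Rightarrow> complex \<Rightarrow> bool" where
  "regular_shore M side k \<longleftrightarrow>
     (\<exists>r>0. \<exists>g. mat_holomorphic_on g (ball k r) \<and> (\<forall>z\<in>ball k r \<inter> side. M z = g z) \<and>
        invertible (g k))"


section \<open>The original data\<close>

text \<open>\<open>G\<close> is the branch, single-valued on the closed upper half-plane cut along the \<open>cut (\<kappa> j)\<close>, that is
  regular on the real axis.\<close>

definition original_data :: "(complex \<Rightarrow> 'n::finite cmat) \<Rightarrow> nat \<Rightarrow> (nat \<Rightarrow> complex) \<Rightarrow> bool" where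
  "original_data G p \<kappa> \<longleftrightarrow>
     (\<forall>j\<in>{1..p}. Im (\<kappa> j) > 0) \<and> inj_on \<kappa> {1..p} \<and>
     mat_meromorphic_on G ({k. Im k > 0} - cut_union p \<kappa> 0) \<and>
     mat_algebraic_on G ({k. Im k \<ge> 0} - cut_union p \<kappa> 0) \<and>
     mat_analytic_on G {k. Im k = 0} \<and>
     (\<forall>k. Im k = 0 \<longrightarrow> invertible (G k)) \<and>
     (G \<longlongrightarrow> mat 1) (inf at_infinity (principal ({k. Im k \<ge> 0} - cut_union p \<kappa> 0))) \<and>
     (\<forall>j\<in>{1..p}. \<not> (\<exists>r>0. \<exists>g. mat_meromorphic_on g (ball (\<kappa> j) r) \<and>
        (\<forall>k\<in>ball (\<kappa> j) r - cut_union p \<kappa> 0. G k = g k))) \<and>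
     (\<forall>i\<in>{1..p}. \<forall>j\<in>{1..p}. \<kappa> i \<notin> cut (\<kappa> j)) \<and>
     (\<forall>j\<in>{1..p}. \<forall>k\<in>cut (\<kappa> j).
        regular_shore G (right_side k) k \<and> regular_shore G (left_side k) k)"


section \<open>The coefficients and their common eigenvectors\<close>

definition coefficients ::
    "(complex \<Rightarrow> 'n::finite cmat) \<Rightarrow> nat \<Rightarrow> (nat \<Rightarrow> complex) \<Rightarrow> real \<Rightarrow> (nat \<Rightarrow> complex \<Rightarrow> 'n cmat) \<Rightarrow> bool"
  where
  "coefficients G p \<kappa> \<epsilon> H \<longleftrightarrow>
     (\<forall>j\<in>{1..p}.
        (\<forall>k\<in>cut (\<kappa> j). \<exists>Gplus Gminus.
           (G \<longlongrightarrow> Gplus) (at k within right_side k) \<and>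
           (G \<longlongrightarrow> Gminus) (at k within left_side k) \<and>
           H j k = Gminus ** matrix_inv Gplus) \<and>
        mat_holomorphic_on (H j) (strip_at \<epsilon> (\<kappa> j)) \<and>
        mat_algebraic_on (H j) (strip_at \<epsilon> (\<kappa> j)) \<and>
        (H j \<longlongrightarrow> mat 1) (inf at_infinity (principal (strip_at \<epsilon> (\<kappa> j)))) \<and>
        negligible {k \<in> strip_at \<epsilon> (\<kappa> j). \<not> distinct_eigenvalues (H j k)})"

definition commutativity_restriction ::
    "nat \<Rightarrow> (nat \<Rightarrow> complex) \<Rightarrow> real \<Rightarrow> (nat \<Rightarrow> complex \<Rightarrow> 'n::finite cmat) \<Rightarrow> bool" where
  "commutativity_restriction p \<kappa> \<epsilon> H \<longleftrightarrow>
     (\<forall>i\<in>{1..p}. \<forall>j\<in>{1..p}. \<forall>g A h C.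
        continuation (H i) (strip_at \<epsilon> (\<kappa> i)) g A \<longrightarrow>
        continuation (H j) (strip_at \<epsilon> (\<kappa> j)) h C \<longrightarrow>
        (\<forall>k\<in>A \<inter> C. g k ** h k = h k ** g k))"

text \<open>\<open>P\<close> is a branch, in a neighbourhood \<open>W\<close> of the cuts, of the algebraic matrix of common
  eigenvectors.  An algebraic matrix has only finitely many branch points, poles and zeros of the
  determinant; those lying on the cuts form the set \<open>Z\<close>.  The vector \<open>f j k\<close> lists the eigenvalues
  of \<open>H j k\<close> and is continuous along the whole cut.\<close>

definition common_eigenvectors ::
    "nat \<Rightarrow> (nat \<Rightarrow> complex) \<Rightarrow> real \<Rightarrow> (nat \<Rightarrow> complex \<Rightarrow> 'n::finite cmat) \<Rightarrow>
     complex set \<Rightarrow> complex set \<Rightarrow> (complex \<Rightarrow> 'n cmat) \<Rightarrow> (nat \<Rightarrow> complex \<Rightarrow> complex^'n) \<Rightarrow> bool" where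
  "common_eigenvectors p \<kappa> \<epsilon> H Z W P f \<longleftrightarrow>
     finite Z \<and> open W \<and> (\<Union>j\<in>{1..p}. cut (\<kappa> j)) - Z \<subseteq> W \<and>
     mat_holomorphic_on P W \<and> mat_algebraic_on P W \<and> (\<forall>k\<in>W. invertible (P k)) \<and>
     (\<forall>j\<in>{1..p}. \<forall>g A. continuation (H j) (strip_at \<epsilon> (\<kappa> j)) g A \<longrightarrow>
        (\<forall>k\<in>A \<inter> W. \<exists>v. g k = P k ** diag_mat v ** matrix_inv (P k))) \<and>
     (\<forall>j\<in>{1..p}. continuous_on (cut (\<kappa> j)) (f j) \<and>
        (\<forall>k\<in>cut (\<kappa> j) - Z. H j k = P k ** diag_mat (f j k) ** matrix_inv (P k)))"

text \<open>\<open>lf j k\<close> lists the logarithms of the eigenvalues \<open>f j k\<close>: the branch that tends to zero as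
  \<open>k \<rightarrow> \<kappa> j + \<i>\<infinity>\<close>, extended to the whole cut by continuity.\<close>

definition log_branch ::
    "nat \<Rightarrow> (nat \<Rightarrow> complex) \<Rightarrow> (nat \<Rightarrow> complex \<Rightarrow> complex^'n) \<Rightarrow> (nat \<Rightarrow> complex \<Rightarrow> complex^'n) \<Rightarrow> bool"
  where
  "log_branch p \<kappa> f lf \<longleftrightarrow>
     (\<forall>j\<in>{1..p}. continuous_on (cut (\<kappa> j)) (lf j) \<and>
        (\<forall>k\<in>cut (\<kappa> j). \<forall>i. exp (lf j k $ i) = f j k $ i) \<and>
        (lf j \<longlongrightarrow> 0) (inf at_infinity (principal (cut (\<kappa> j)))))"


section \<open>The family of Riemann--Hilbert problems\<close>

text \<open>The branch of the logarithm with the cut going upwards from \<open>0\<close>, as the cuts of the problems do.\<close>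

definition Ln_up :: "complex \<Rightarrow> complex" where
  "Ln_up z = Ln (\<i> * z) - \<i> * of_real pi / 2"

definition diag_power :: "complex \<Rightarrow> complex^'n::finite \<Rightarrow> 'n cmat" where
  "diag_power z e = diag_mat (\<chi> i. exp (e $ i * Ln_up z))"

text \<open>The leading term at the tip \<open>a\<close> of a cut is \<open>K (k - a)\<^sup>e K\<^sup>-\<^sup>1\<close>, up to a right factor that is
  regular and non-singular at \<open>a\<close>.  The jump condition determines this factor up to normalization:
  \<open>(k - a)\<^sup>e\<close> must be followed by the inverse eigenvector matrix, so the factor is \<open>K P(k)\<^sup>-\<^sup>1\<close>.  Thus
  \<open>U(k) = (I + o(1)) \<cdot> K (k - a)\<^sup>e K\<^sup>-\<^sup>1 \<cdot> K P(k)\<^sup>-\<^sup>1\<close>, which makes the solution unique.\<close>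

definition leading_term_at ::
    "complex \<Rightarrow> complex set \<Rightarrow> complex^'n \<Rightarrow> (complex \<Rightarrow> 'n::finite cmat) \<Rightarrow> (complex \<Rightarrow> 'n cmat) \<Rightarrow> bool"
  where
  "leading_term_at a S e P U \<longleftrightarrow>
     (\<exists>K. invertible K \<and>
        ((\<lambda>k. U k ** matrix_inv ((K ** diag_power (k - a) e ** matrix_inv K) ** (K ** matrix_inv (P k))))
           \<longlongrightarrow> mat 1) (at a within - S))"

text \<open>The one-sided limits are taken over full half-neighbourhoods, which includes continuity of \<open>U\<close>
  up to both shores.  \<open>U(\<i>\<infinity>, k) = I\<close> is understood as a limit.  The leading term is required at
  the tips where the branch \<open>P\<close> is regular.\<close>

definition RH_family ::
    "nat \<Rightarrow> (nat \<Rightarrow> complex) \<Rightarrow> (nat \<Rightarrow> complex \<Rightarrow> 'n::finite cmat) \<Rightarrow> complex set \<Rightarrow>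
     (complex \<Rightarrow> 'n cmat) \<Rightarrow> (nat \<Rightarrow> complex \<Rightarrow> complex^'n) \<Rightarrow> (complex \<Rightarrow> complex \<Rightarrow> 'n cmat) \<Rightarrow> bool" where
  "RH_family p \<kappa> H Z P lf U \<longleftrightarrow>
     (\<forall>b\<in>imag_ray.
        mat_holomorphic_on (U b) (- cut_union p \<kappa> b) \<and>
        (\<forall>k\<in>- cut_union p \<kappa> b. invertible (U b k)) \<and>
        (\<forall>j\<in>{1..p}. \<forall>k\<in>cut (\<kappa> j + b). \<exists>Uplus Uminus.
           (U b \<longlongrightarrow> Uplus) (at k within right_side k) \<and>
           (U b \<longlongrightarrow> Uminus) (at k within left_side k) \<and>
           invertible Uplus \<and> invertible Uminus \<and> Uplus = Uminus ** H j k) \<and>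
        (U b \<longlongrightarrow> mat 1) (inf at_infinity (principal (- cut_union p \<kappa> b))) \<and>
        (\<forall>j\<in>{1..p}. \<kappa> j + b \<notin> Z \<longrightarrow>
           leading_term_at (\<kappa> j + b) (cut_union p \<kappa> b)
             (\<chi> i. lf j (\<kappa> j + b) $ i / (2 * of_real pi * \<i>)) P (U b))) \<and>
     (\<forall>k. ((\<lambda>t. U (\<i> * of_real t) k) \<longlongrightarrow> mat 1) at_top)"

definition ODE1 ::
    "nat \<Rightarrow> (nat \<Rightarrow> complex) \<Rightarrow> (complex \<Rightarrow> complex \<Rightarrow> 'n::finite cmat) \<Rightarrow> (nat \<Rightarrow> complex \<Rightarrow> 'n cmat) \<Rightarrow> bool"
  where
  "ODE1 p \<kappa> U s \<longleftrightarrow>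
     (\<forall>b\<in>imag_ray. \<forall>k\<in>- cut_union p \<kappa> b. \<forall>m n.
        ((\<lambda>b. U b k $ m $ n) has_field_derivative
           ((\<Sum>j=1..p. mat (1 / (k - (\<kappa> j + b))) ** s j b) ** U b k) $ m $ n) (at b within imag_ray))"


section \<open>The rational matrix \<open>B\<close> and the function \<open>\<F>\<close>\<close>

definition rational_function_off :: "complex set \<Rightarrow> (complex \<Rightarrow> complex) \<Rightarrow> bool" where
  "rational_function_off S f \<longleftrightarrow>
     (\<exists>u v :: complex poly. v \<noteq> 0 \<and> (\<forall>k\<in>- S. poly v k \<noteq> 0 \<longrightarrow> f k = poly u k / poly v k))"

definition matrix_B ::
    "nat \<Rightarrow> (nat \<Rightarrow> complex) \<Rightarrow> real \<Rightarrow> (nat \<Rightarrow> complex \<Rightarrow> 'n::finite cmat) \<Rightarrow> complex set \<Rightarrow>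
     (complex \<Rightarrow> 'n cmat) \<Rightarrow> nat \<Rightarrow> (nat \<Rightarrow> complex) \<Rightarrow> (complex \<Rightarrow> 'n cmat) \<Rightarrow> bool" where
  "matrix_B p \<kappa> \<epsilon> H W P d \<rho> B \<longleftrightarrow>
     inj_on \<rho> {1..d} \<and>
     (\<forall>m n. rational_function_off (\<rho> ` {1..d}) (\<lambda>k. B k $ m $ n)) \<and>
     mat_holomorphic_on B (- \<rho> ` {1..d}) \<and>
     (\<forall>l\<in>{1..d}. \<exists>C. C \<noteq> 0 \<and> ((\<lambda>k. mat (k - \<rho> l) ** B k) \<longlongrightarrow> C) (at (\<rho> l))) \<and>
     (B \<longlongrightarrow> mat 1) at_infinity \<and>
     (\<forall>j\<in>{1..p}. \<forall>g A. continuation (H j) (strip_at \<epsilon> (\<kappa> j)) g A \<longrightarrow>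
        (\<forall>k\<in>A - \<rho> ` {1..d}. B k ** g k = g k ** B k)) \<and>
     (\<forall>k\<in>W - \<rho> ` {1..d}. \<exists>v. B k = P k ** diag_mat v ** matrix_inv (P k))"

text \<open>\<open>\<Phi>\<close> is a choice of the function \<open>\<F>\<close>.  If \<open>Y\<close> has distinct eigenvalues, then \<open>\<Phi> X Y\<close> is
  determined by \<open>X\<close> and \<open>Y\<close> up to the correspondence between the eigenvalues of \<open>X\<close> and the
  eigenvectors of \<open>Y\<close>.  If \<open>X\<close> has a multiple eigenvalue, then \<open>\<Phi> X Y\<close> has more eigenvectors than
  \<open>Y\<close>, so only one inclusion can be demanded.\<close>

definition F_choice :: "('n::finite cmat \<Rightarrow> 'n cmat \<Rightarrow> 'n cmat) \<Rightarrow> bool" where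
  "F_choice \<Phi> \<longleftrightarrow>
     (\<forall>X Y. same_eigenvalues (\<Phi> X Y) X \<and>
        (distinct_eigenvalues Y \<longrightarrow> (\<forall>v. eigenvector Y v \<longrightarrow> eigenvector (\<Phi> X Y) v)))"

definition F_tilde ::
    "(nat \<Rightarrow> complex) \<Rightarrow> (nat \<Rightarrow> complex \<Rightarrow> complex^'n::finite) \<Rightarrow> nat \<Rightarrow> complex \<Rightarrow> 'n cmat" where
  "F_tilde \<kappa> lf j b = diag_mat (\<chi> i. - (1 / (2 * of_real pi * \<i>)) * lf j (\<kappa> j + b) $ i)"

definition R_matrix ::
    "nat \<Rightarrow> (nat \<Rightarrow> complex) \<Rightarrow> (nat \<Rightarrow> complex \<Rightarrow> 'n::finite cmat) \<Rightarrow> complex \<Rightarrow> complex \<Rightarrow> 'n cmat" where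
  "R_matrix d \<rho> r b k = (\<Sum>l=1..d. mat (1 / (k - \<rho> l)) ** r l b)"

end

theory Submission
  imports Defs "HOL-Computational_Algebra.Fundamental_Theorem_Algebra"
begin

text \<open>
  For fixed \<open>b\<close> the jumps of \<open>U\<close> commute with \<open>B\<close>, so \<open>M = U B U\<^sup>-\<^sup>1\<close> has no jump on the cuts; it is
  bounded at their tips by the leading term condition and tends to the identity at infinity.
  By Liouville's theorem \<open>M(b,k) = 1 + \<Sum>\<^sub>l r\<^sub>l(b) / (k - \<rho>\<^sub>l)\<close>.
  The equation for \<open>U\<close> turns into a Lax equation for \<open>M\<close> in \<open>b\<close>: its residues at \<open>\<rho>\<^sub>l\<close> are the equations
  for \<open>r\<^sub>l\<close>, and its residues at the tips say that \<open>s\<^sub>j\<close> commutes with \<open>R\<close>.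

  The eigenvalues of \<open>s\<^sub>j\<close> come from the local behaviour at a tip \<open>a\<close>. Let \<open>\<Lambda>(k)\<close> be the diagonal matrix of
  the logarithms of the eigenvalues of \<open>H\<^sub>j\<close>, divided by \<open>2\<pi>i\<close>. Then \<open>T = U P (k - a)\<^sup>-\<^sup>\<Lambda>\<close> extends
  holomorphically to a neighbourhood of \<open>a\<close>, with an invertible value \<open>K\<close> there. Its \<open>b\<close>-derivative
  \<open>A T + T \<Lambda> / (k - a)\<close>, where \<open>A\<close> is the coefficient of the equation for \<open>U\<close>, is bounded near \<open>a\<close>,
  whence \<open>s\<^sub>j K + K \<Lambda>(a) = 0\<close>.

  The finitely many \<open>b\<close> for which a tip lies in \<open>Z\<close> are reached by continuity in \<open>b\<close>.
\<close>

text \<open>The cuts move with \<open>b\<close>, but only along vertical lines. Global limits in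
  \<open>k\<close> are therefore taken from the complement of the finitely many lines through the
  \<open>\<kappa> j\<close> and \<open>\<rho> l\<close>: one open dense set that avoids cuts and
  poles for every \<open>b\<close>, so that the value at a fixed point can be followed in
  \<open>b\<close>.

  Two steps cannot be done for a fixed \<open>b\<close>. Liouville's theorem gives the residues
  separately for each \<open>b\<close> and says nothing on their dependence on \<open>b\<close>;
  they are recovered as fixed linear combinations of values of \<open>M\<close> at finitely many
  fixed points and so inherit its derivative. And the leading term at a tip is an asymptotic
  statement in \<open>k\<close> alone, which may not be differentiated in \<open>b\<close> while the
  tip moves. The derivative of \<open>T\<close> is bounded instead through a Lipschitz estimate,
  obtained where the equation has bounded coefficients, at a distance from all tips.

  Commutation with \<open>R\<close> and the right characteristic polynomial are all that a choice of
  the function F demands at one pair of arguments, so \<open>s j b\<close> itself can be declared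
  its value there.\<close>

unbundle no Formal_Power_Series.fps_syntax

section \<open>Entrywise matrix algebra and inverses\<close>

lemma matrix_eqI: "(\<And>i j. A $ i $ j = B $ i $ j) \<Longrightarrow> A = B" for A B :: "'n::finite cmat"
  by (simp add: vec_eq_iff)

lemma matrix_mult_entry: "(A ** B) $ i $ j = (\<Sum>k\<in>UNIV. A $ i $ k * B $ k $ j)"
  by (simp add: matrix_matrix_mult_def)

lemma mat_entry: "mat c $ i $ j = (if i = j then c else 0)"
  by (simp add: mat_def)

lemma mat_mult_entry [simp]: "(mat c ** A) $ i $ j = c * A $ i $ j"
  for A :: "'n::finite cmat"
  by (simp add: matrix_mult_entry mat_entry if_distrib if_distribR sum.delta cong: if_cong)

lemma mult_mat_entry [simp]: "(A ** mat c) $ i $ j = A $ i $ j * c"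
  for A :: "'n::finite cmat"
  by (simp add: matrix_mult_entry mat_entry if_distrib if_distribR sum.delta' cong: if_cong)

lemma mat_commute: "A ** mat c = mat c ** A" for A :: "'n::finite cmat"
  by (rule matrix_eqI) simp

lemma diag_mat_entry: "diag_mat v $ i $ j = (if i = j then v $ i else 0)"
  by (simp add: diag_mat_def)

lemma diag_mult_entry [simp]: "(diag_mat v ** A) $ i $ j = v $ i * A $ i $ j"
  by (simp add: matrix_mult_entry diag_mat_entry if_distrib if_distribR sum.delta cong: if_cong)

lemma mult_diag_entry [simp]: "(A ** diag_mat v) $ i $ j = A $ i $ j * v $ j"
  by (simp add: matrix_mult_entry diag_mat_entry if_distrib if_distribR sum.delta' cong: if_cong)

lemma diag_mat_mult: "diag_mat u ** diag_mat v = diag_mat (\<chi> i. u $ i * v $ i)"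
  by (rule matrix_eqI) (simp add: diag_mat_entry)

lemma diag_mat_vec [simp]: "(diag_mat v *v u) $ i = v $ i * u $ i"
  by (simp add: matrix_vector_mult_def diag_mat_entry if_distrib if_distribR sum.delta
      cong: if_cong)

lemma diag_mat_1: "diag_mat (\<chi> i. 1) = mat 1"
  by (rule matrix_eqI) (simp add: diag_mat_entry mat_entry)

lemma matrix_diff_ldistrib: "A ** (B - C) = A ** B - A ** C" for A B C :: "'n::finite cmat"
  by (rule matrix_eqI) (simp add: matrix_mult_entry algebra_simps sum_subtractf)

lemma matrix_diff_rdistrib: "(B - C) ** A = B ** A - C ** A" for A B C :: "'n::finite cmat"
  by (rule matrix_eqI) (simp add: matrix_mult_entry algebra_simps sum_subtractf)

lemma matrix_inv_both:
  assumes "invertible A"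
  shows matrix_inv_right: "A ** matrix_inv A = mat 1"
    and matrix_inv_left: "matrix_inv A ** A = mat 1"
  using someI_ex[of "\<lambda>B. A ** B = mat 1 \<and> B ** A = mat 1"] assms
  unfolding invertible_def matrix_inv_def by blast+

lemma matrix_inv_eqI: "A ** B = mat 1 \<Longrightarrow> matrix_inv A = B" for A B :: "'n::finite cmat"
  by (metis invertible_def matrix_left_right_inverse matrix_inv_left matrix_mul_assoc
      matrix_mul_lid matrix_mul_rid)

lemma invertibleI: "A ** B = mat 1 \<Longrightarrow> invertible A" for A B :: "'n::finite cmat"
  using invertible_def matrix_left_right_inverse by blast

lemma invertible_mult: "invertible A \<Longrightarrow> invertible B \<Longrightarrow> invertible (A ** B)"
  for A B :: "'n::finite cmat"
  by (simp add: invertible_det_nz det_mul)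

lemma invertible_matrix_inv: "invertible A \<Longrightarrow> invertible (matrix_inv A)" for A :: "'n::finite cmat"
  using invertibleI matrix_inv_left by blast

lemma matrix_inv_inv: "invertible A \<Longrightarrow> matrix_inv (matrix_inv A) = A" for A :: "'n::finite cmat"
  using matrix_inv_eqI matrix_inv_left by blast

lemma matrix_inv_mult:
  fixes A B :: "'n::finite cmat"
  assumes "invertible A" "invertible B"
  shows "matrix_inv (A ** B) = matrix_inv B ** matrix_inv A"
proof (rule matrix_inv_eqI)
  have "A ** B ** (matrix_inv B ** matrix_inv A) = A ** (B ** matrix_inv B) ** matrix_inv A"
    by (simp add: matrix_mul_assoc)
  then show "A ** B ** (matrix_inv B ** matrix_inv A) = mat 1"
    using assms by (simp add: matrix_inv_right)
qed

lemma mult_inv_cancel [simp]: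
  assumes "invertible A"
  shows "X ** A ** matrix_inv A = X" "X ** matrix_inv A ** A = X"
  by (metis assms matrix_inv_right matrix_inv_left matrix_mul_assoc matrix_mul_rid)+

text \<open>Cramer's rule for the columns of the inverse. Quotients of determinants reduce limits
  and holomorphy of inverses (\<open>tendsto_matrix_inv\<close>, \<open>mat_holomorphic_inv\<close>)
  to those of the entries.\<close>

lemma matrix_inv_entry:
  fixes A :: "'n::finite cmat"
  assumes "invertible A"
  shows "matrix_inv A $ i $ j = det (\<chi> a b. if b = i then mat 1 $ a $ j else A $ a $ b) / det A"
proof -
  have "A *v (column j (matrix_inv A)) = (\<chi> a. mat 1 $ a $ j)"
  proof -
    have "A *v (column j (matrix_inv A)) = column j (A ** matrix_inv A)"
      by (simp add: vec_eq_iff column_def matrix_mult_entry matrix_vector_mult_def)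
    then show ?thesis
      using assms by (simp add: matrix_inv_right column_def)
  qed
  then have "column j (matrix_inv A) =
      (\<chi> k. det (\<chi> a b. if b = k then (\<chi> a. mat 1 $ a $ j) $ a else A $ a $ b) / det A)"
    using assms by (subst (asm) cramer) (auto simp: invertible_det_nz)
  then have "column j (matrix_inv A) $ i =
      (\<chi> k. det (\<chi> a b. if b = k then (\<chi> a. mat 1 $ a $ j) $ a else A $ a $ b) / det A) $ i"
    by simp
  then show ?thesis
    by (simp add: column_def cong: if_cong)
qed

section \<open>Limits of matrix functions\<close>

lemma tendsto_matrix_mult:
  fixes f g :: "'a \<Rightarrow> 'n::finite cmat"
  assumes "(f \<longlongrightarrow> a) F" "(g \<longlongrightarrow> b) F"
  shows "((\<lambda>x. f x ** g x) \<longlongrightarrow> a ** b) F"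
  unfolding matrix_matrix_mult_def
  by (intro vec_tendstoI) (auto intro!: tendsto_intros assms)

lemma tendsto_det:
  fixes f :: "'a \<Rightarrow> 'n::finite cmat"
  assumes "(f \<longlongrightarrow> a) F"
  shows "((\<lambda>x. det (f x)) \<longlongrightarrow> det a) F"
  unfolding det_def by (intro tendsto_intros assms)

lemma tendsto_diag_mat:
  assumes "\<And>i. ((\<lambda>x. f x $ i) \<longlongrightarrow> a $ i) F"
  shows "((\<lambda>x. diag_mat (f x)) \<longlongrightarrow> diag_mat a) F"
  unfolding diag_mat_def
  by (intro vec_tendstoI) (auto intro!: tendsto_intros assms)

lemma tendsto_matrixI:
  fixes f :: "'a \<Rightarrow> 'n::finite cmat"
  assumes "\<And>i j. ((\<lambda>x. f x $ i $ j) \<longlongrightarrow> a $ i $ j) F"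
  shows "(f \<longlongrightarrow> a) F"
  using assms by (intro vec_tendstoI) auto

lemma tendsto_matrixD:
  fixes f :: "'a \<Rightarrow> 'n::finite cmat"
  assumes "(f \<longlongrightarrow> a) F"
  shows "((\<lambda>x. f x $ i $ j) \<longlongrightarrow> a $ i $ j) F"
  using assms by (intro tendsto_intros)

lemma eventually_invertible:
  fixes f :: "'a \<Rightarrow> 'n::finite cmat"
  assumes "(f \<longlongrightarrow> a) F" "invertible a"
  shows "\<forall>\<^sub>F x in F. invertible (f x)"
proof -
  have "\<forall>\<^sub>F x in F. det (f x) \<noteq> 0"
    using tendsto_imp_eventually_ne[OF tendsto_det[OF assms(1)]] assms(2)
    by (simp add: invertible_det_nz)
  then show ?thesis
    by (simp add: invertible_det_nz)
qed

lemma tendsto_matrix_inv: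
  fixes f :: "'a \<Rightarrow> 'n::finite cmat"
  assumes "(f \<longlongrightarrow> a) F" "invertible a"
  shows "((\<lambda>x. matrix_inv (f x)) \<longlongrightarrow> matrix_inv a) F"
proof (rule tendsto_matrixI)
  fix i j
  have "((\<lambda>x. det (\<chi> a b. if b = i then mat 1 $ a $ j else f x $ a $ b) / det (f x)) \<longlongrightarrow>
      det (\<chi> c b. if b = i then mat 1 $ c $ j else a $ c $ b) / det a) F"
    using assms(2)
    by (intro tendsto_divide tendsto_det assms(1) tendsto_matrixI)
      (auto simp: invertible_det_nz intro: tendsto_matrixD[OF assms(1)])
  then have "((\<lambda>x. det (\<chi> a b. if b = i then mat 1 $ a $ j else f x $ a $ b) / det (f x)) \<longlongrightarrow>
      matrix_inv a $ i $ j) F"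
    by (simp only: matrix_inv_entry[OF assms(2)])
  then show "((\<lambda>x. matrix_inv (f x) $ i $ j) \<longlongrightarrow> matrix_inv a $ i $ j) F"
    by (rule Lim_transform_eventually)
      (use eventually_invertible[OF assms] in \<open>eventually_elim, simp only: matrix_inv_entry\<close>)
qed

section \<open>Holomorphic matrix functions\<close>

lemma holomorphic_det:
  assumes "\<And>i j. (\<lambda>x. f x $ i $ j) holomorphic_on S"
  shows "(\<lambda>x. det (f x)) holomorphic_on S"
  unfolding det_def by (intro holomorphic_intros assms)

lemma mat_holomorphic_mult:
  assumes "mat_holomorphic_on f S" "mat_holomorphic_on g S"
  shows "mat_holomorphic_on (\<lambda>x. f x ** g x) S"
  using assms unfolding mat_holomorphic_on_def matrix_mult_entry
  by (auto intro!: holomorphic_intros)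

lemma mat_holomorphic_inv:
  assumes "mat_holomorphic_on f S" "\<And>x. x \<in> S \<Longrightarrow> invertible (f x)"
  shows "mat_holomorphic_on (\<lambda>x. matrix_inv (f x)) S"
  unfolding mat_holomorphic_on_def
proof (intro allI)
  fix i j
  have *: "(\<lambda>x. if b = i then mat 1 $ a $ j else f x $ a $ b) holomorphic_on S" for a b
    using assms(1) by (cases "b = i") (simp_all add: mat_holomorphic_on_def)
  have "(\<lambda>x. det (\<chi> a b. if b = i then mat 1 $ a $ j else f x $ a $ b) / det (f x)) holomorphic_on S"
    using assms
    by (intro holomorphic_on_divide holomorphic_det)
      (auto simp: mat_holomorphic_on_def invertible_det_nz intro: *)
  then show "(\<lambda>x. matrix_inv (f x) $ i $ j) holomorphic_on S"
    by (rule holomorphic_transform) (simp add: matrix_inv_entry assms(2))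
qed

lemma mat_holomorphic_diag:
  assumes "\<And>i. (\<lambda>x. f x $ i) holomorphic_on S"
  shows "mat_holomorphic_on (\<lambda>x. diag_mat (f x)) S"
  unfolding mat_holomorphic_on_def
proof (intro allI)
  fix i j
  show "(\<lambda>x. diag_mat (f x) $ i $ j) holomorphic_on S"
    using assms by (cases "i = j") (simp_all add: diag_mat_entry)
qed

lemma mat_holomorphic_subset:
  "mat_holomorphic_on f S \<Longrightarrow> T \<subseteq> S \<Longrightarrow> mat_holomorphic_on f T"
  unfolding mat_holomorphic_on_def by (blast intro: holomorphic_on_subset)

lemma mat_holomorphic_tendsto:
  assumes "mat_holomorphic_on f S" "open S" "a \<in> S"
  shows "(f \<longlongrightarrow> f a) (at a within T)"
proof (rule tendsto_matrixI)
  fix i j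
  have "continuous_on S (\<lambda>k. f k $ i $ j)"
    using assms(1) holomorphic_on_imp_continuous_on unfolding mat_holomorphic_on_def by blast
  then have "isCont (\<lambda>k. f k $ i $ j) a"
    using assms continuous_on_eq_continuous_at by blast
  then show "((\<lambda>k. f k $ i $ j) \<longlongrightarrow> f a $ i $ j) (at a within T)"
    using continuous_at_imp_continuous_at_within continuous_within by blast
qed

section \<open>Eigenvalues\<close>

lemma similar_det:
  fixes A V :: "'n::finite cmat"
  assumes "invertible V"
  shows "det (mat z - V ** A ** matrix_inv V) = det (mat z - A)"
proof -
  have "V ** mat z ** matrix_inv V = mat z"
    using assms by (simp only: mat_commute[of V] mult_inv_cancel)
  then have "mat z - V ** A ** matrix_inv V = V ** (mat z - A) ** matrix_inv V"
    by (simp add: matrix_diff_ldistrib matrix_diff_rdistrib)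
  then have "det (mat z - V ** A ** matrix_inv V) = det (V ** matrix_inv V) * det (mat z - A)"
    by (simp add: det_mul)
  then show ?thesis
    using assms by (simp add: matrix_inv_right det_I)
qed

lemma eigenvalues_det: "eigenvalues A = {c. det (mat c - A) = 0}" for A :: "'n::finite cmat"
proof -
  have "(\<exists>v. v \<noteq> 0 \<and> A *v v = c *s v) \<longleftrightarrow> det (mat c - A) = 0" for c
  proof -
    have "mat c *v v = c *s v" for v :: "complex^'n"
      by (simp add: vec_eq_iff matrix_vector_mult_def mat_entry
          if_distrib if_distribR sum.delta cong: if_cong)
    then have "(mat c - A) *v v = c *s v - A *v v" for v
      by (simp add: matrix_vector_mult_diff_rdistrib)
    then have "(\<exists>v. v \<noteq> 0 \<and> A *v v = c *s v) \<longleftrightarrow> (\<exists>v. v \<noteq> 0 \<and> (mat c - A) *v v = 0)"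
      by auto
    also have "\<dots> \<longleftrightarrow> \<not> invertible (mat c - A)"
      using matrix_left_invertible_ker[of "mat c - A"] invertible_left_inverse by blast
    finally show ?thesis
      by (simp add: invertible_det_nz)
  qed
  then show ?thesis
    by (simp add: eigenvalues_def)
qed

text \<open>The fractions with the residues add up to \<open>M - 1\<close>, so the spectrum of
  \<open>R\<close> is that of \<open>B\<close> shifted by one. The hypothesis is about
  characteristic polynomials because these survive the passage to a tip, where the conjugating
  matrix \<open>U\<close> may have no limit.\<close>

lemma distinct_eigenvalues_cong:
  fixes A B :: "'n::finite cmat"
  assumes "\<And>z. det (mat z - A) = det (mat z - (mat 1 + B))" "distinct_eigenvalues A"
  shows "distinct_eigenvalues B"
proof -
  have *: "mat (z + 1) - (mat 1 + B) = mat z - B" for z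
    by (rule matrix_eqI) (simp add: mat_entry)
  then have "det (mat z - B) = det (mat (z + 1) - A)" for z
    using assms(1)[of "z + 1"] by (simp only: *)
  then have "eigenvalues B = (\<lambda>z. z - 1) ` eigenvalues A"
    unfolding eigenvalues_det by (auto simp: image_iff intro!: exI[of _ "_ + 1"])
  then show ?thesis
    using assms(2) unfolding distinct_eigenvalues_def
    by (simp add: card_image inj_on_def)
qed

text \<open>There are as many eigenvalues as dimensions, and one eigenvector for each gives a basis;
  independence is proved by induction on the index set.\<close>

lemma distinct_eigenvalues_diagonalizable:
  fixes A :: "'n::finite cmat"
  assumes "distinct_eigenvalues A"
  obtains V :: "'n cmat" and e where "invertible V" "inj (($) e)" "A = V ** diag_mat e ** matrix_inv V"
proof -
  have card: "card (eigenvalues A) = CARD('n)"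
    using assms by (simp add: distinct_eigenvalues_def)
  then have "finite (eigenvalues A)"
    by (metis card_eq_0_iff finite_UNIV_card_ge_0 finite less_irrefl)
  then obtain h :: "'n \<Rightarrow> complex" where h: "bij_betw h UNIV (eigenvalues A)"
    using card finite_same_card_bij[of "UNIV :: 'n set" "eigenvalues A"] by auto
  then have "\<exists>v. v \<noteq> 0 \<and> A *v v = h i *s v" for i
    using bij_betwE[OF h] unfolding eigenvalues_def by auto
  then obtain w where w: "\<And>i. w i \<noteq> 0" "\<And>i. A *v w i = h i *s w i"
    by metis
  define V where "V = (\<chi> a i. w i $ a)"
  have V: "A ** V = V ** diag_mat (\<chi> i. h i)"
    using w(2) by (intro matrix_eqI) (simp add: V_def matrix_mult_entry matrix_vector_mult_def
        vec_eq_iff diag_mat_entry if_distrib if_distribR sum.delta' mult.commute cong: if_cong)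
  have ind: "\<forall>i\<in>S. c i = 0" if "finite S" "(\<Sum>i\<in>S. c i *s w i) = 0" for S c
    using that
  proof (induction S arbitrary: c rule: finite_induct)
    case (insert x S)
    have "0 = A *v (\<Sum>i\<in>insert x S. c i *s w i)"
      using insert.prems by simp
    also have "\<dots> = (\<Sum>i\<in>insert x S. A *v (c i *s w i))"
      using linear_sum[OF matrix_vector_mul_linear, of A "\<lambda>i. c i *s w i" "insert x S"] by simp
    also have "\<dots> = (\<Sum>i\<in>insert x S. (c i * h i) *s w i)"
      by (simp add: vector_scalar_commute w(2) vector_smult_assoc)
    \<comment> \<open>Applying \<open>A\<close> to the relation and subtracting \<open>h x\<close>
      times the relation removes the term of \<open>x\<close>; the other coefficients only acquire
      the nonzero factors \<open>h i - h x\<close>.\<close>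
    finally have "(\<Sum>i\<in>insert x S. (c i * h i) *s w i) - h x *s (\<Sum>i\<in>insert x S. c i *s w i) = 0"
      using insert.prems by simp
    then have "(\<Sum>i\<in>insert x S. (c i * (h i - h x)) *s w i) = 0"
      by (simp add: vec_eq_iff sum_distrib_left sum_subtractf[symmetric] algebra_simps)
    then have "(\<Sum>i\<in>S. (c i * (h i - h x)) *s w i) = 0"
      using insert by simp
    then have "\<forall>i\<in>S. c i * (h i - h x) = 0"
      by (rule insert.IH)
    moreover have "h i \<noteq> h x" if "i \<in> S" for i
      using h insert.hyps that by (auto simp: bij_betw_def inj_on_def)
    ultimately have S: "\<forall>i\<in>S. c i = 0"
      by simp
    then have "c x *s w x = 0"
      using insert by simp
    then show ?case
      using S w(1) by simp
  qed simp
  have "V *v u = (\<Sum>i\<in>UNIV. u $ i *s w i)" for u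
    by (simp add: vec_eq_iff V_def matrix_vector_mult_def mult.commute)
  then have "\<forall>u. V *v u = 0 \<longrightarrow> u = 0"
    using ind[of UNIV] by (simp add: vec_eq_iff)
  then have inv: "invertible V"
    using matrix_left_invertible_ker[of V] invertible_left_inverse by blast
  moreover have "inj (($) (\<chi> i. h i))"
    using h by (simp add: bij_betw_def inj_on_def)
  moreover have "A = V ** diag_mat (\<chi> i. h i) ** matrix_inv V"
    using V inv mult_inv_cancel(1)[OF inv, of A] by simp
  ultimately show ?thesis
    by (rule that)
qed

text \<open>In the coordinates given by the columns of \<open>V\<close> the eigenvalue equation
  reads \<open>e $ i * u $ i = c * u $ i\<close>, and distinct entries of \<open>e\<close> leave
  room for one nonzero coordinate only.\<close>

lemma eigenvector_of_diagonalizable: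
  fixes V :: "'n::finite cmat"
  assumes V: "invertible V" and e: "inj (($) e)"
    and v: "(V ** diag_mat e ** matrix_inv V) *v v = c *s v" "v \<noteq> 0"
  obtains i t where "v = V *v axis i t" "t \<noteq> 0" "c = e $ i"
proof -
  define u where "u = matrix_inv V *v v"
  have vu: "v = V *v u"
    using V by (simp add: u_def matrix_vector_mul_assoc matrix_inv_right)
  have "diag_mat e *v u = matrix_inv V *v ((V ** diag_mat e ** matrix_inv V) *v v)"
    using V by (simp add: u_def matrix_vector_mul_assoc matrix_mul_assoc matrix_inv_left)
  also have "\<dots> = c *s u"
    by (simp add: v u_def vector_scalar_commute)
  finally have *: "e $ i * u $ i = c * u $ i" for i
    by (simp add: vec_eq_iff)
  have "u \<noteq> 0"
    using vu v(2) by auto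
  then obtain i where i: "u $ i \<noteq> 0"
    by (auto simp: vec_eq_iff)
  then have c: "c = e $ i"
    using * by auto
  have "u $ l = 0" if "l \<noteq> i" for l
    using *[of l] c injD[OF e] that by auto
  then have "u = axis i (u $ i)"
    by (simp add: vec_eq_iff axis_def)
  then show ?thesis
    using that vu i c by metis
qed

text \<open>\<open>S\<close> maps the one-dimensional eigenspace of \<open>v\<close> into itself.
  Applied to \<open>s j b\<close> and \<open>R\<close>, this turns commutation into the eigenvector
  clause of \<open>F_choice\<close>.\<close>

lemma eigenvector_commuting:
  fixes R S :: "'n::finite cmat"
  assumes "distinct_eigenvalues R" "S ** R = R ** S" "eigenvector R v"
  shows "eigenvector S v"
proof -
  obtain V :: "'n cmat" and e :: "complex^'n" where V: "invertible V" "inj (($) e)" "R = V ** diag_mat e ** matrix_inv V"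
    using distinct_eigenvalues_diagonalizable[OF assms(1)] by metis
  obtain c where v: "v \<noteq> 0" "R *v v = c *s v"
    using assms(3) by (auto simp: eigenvector_def)
  obtain i t where i: "v = V *v axis i t" "t \<noteq> 0" "c = e $ i"
    using eigenvector_of_diagonalizable V v by metis
  have "R *v (S *v v) = S *v (R *v v)"
    by (simp add: matrix_vector_mul_assoc assms(2))
  then have w: "R *v (S *v v) = c *s (S *v v)"
    by (simp add: v vector_scalar_commute)
  show ?thesis
  proof (cases "S *v v = 0")
    case True
    then show ?thesis
      using v by (auto simp: eigenvector_def intro!: exI[of _ 0])
  next
    case False
    then obtain i' t' where i': "S *v v = V *v axis i' t'" "c = e $ i'"
      using eigenvector_of_diagonalizable V w by metis
    then have "i' = i"
      using V(2) i(3) by (simp add: inj_def)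
    moreover have ax: "axis i t' = (t' / t) *s axis i t"
      using i(2) by (simp add: vec_eq_iff axis_def)
    ultimately have "S *v v = V *v ((t' / t) *s axis i t)"
      using i'(1) by simp
    also have "\<dots> = (t' / t) *s v"
      unfolding i(1) by (rule vector_scalar_commute)
    finally have "S *v v = (t' / t) *s v" .
    then show ?thesis
      using v by (auto simp: eigenvector_def)
  qed
qed

text \<open>For the Leibniz expansion of a characteristic polynomial: some slopes \<open>d i\<close>
  vanish there, hence a bound on the degree and the coefficient at \<open>card S\<close> instead of
  a leading coefficient.\<close>

lemma prod_linear_poly:
  fixes c d :: "'i \<Rightarrow> complex"
  assumes "finite S"
  shows "degree (\<Prod>i\<in>S. [:c i, d i:]) \<le> card S" "coeff (\<Prod>i\<in>S. [:c i, d i:]) (card S) = (\<Prod>i\<in>S. d i)"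
proof -
  have "degree (\<Prod>i\<in>S. [:c i, d i:]) \<le> card S \<and>
        coeff (\<Prod>i\<in>S. [:c i, d i:]) (card S) = (\<Prod>i\<in>S. d i)"
    using assms
  proof (induction rule: finite_induct)
    case (insert x S)
    then have "degree ([:c x, d x:] * (\<Prod>i\<in>S. [:c i, d i:])) \<le> 1 + card S"
      by (intro order.trans[OF degree_mult_le] add_mono) auto
    then show ?case
      using insert by (simp add: coeff_eq_0)
  qed simp
  then show "degree (\<Prod>i\<in>S. [:c i, d i:]) \<le> card S"
    "coeff (\<Prod>i\<in>S. [:c i, d i:]) (card S) = (\<Prod>i\<in>S. d i)"
    by auto
qed

text \<open>The characteristic polynomial of \<open>X\<close> splits over the complex numbers; its
  roots, repeated according to multiplicity, are placed on a diagonal.\<close>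

lemma eigenvalue_list_exists:
  fixes X :: "'n::finite cmat"
  obtains e where "same_eigenvalues (diag_mat e) X"
proof -
  define \<delta> :: "'n \<Rightarrow> 'n \<Rightarrow> complex" where "\<delta> = (\<lambda>i j. if i = j then 1 else 0)"
  define q where "q = det ((\<chi> i j. [:- X $ i $ j, \<delta> i j:]) :: complex poly^'n^'n)"
  have sgn: "of_int (sign \<pi>) = [:of_int (sign \<pi>):]" for \<pi> :: "'n \<Rightarrow> 'n"
    by (simp add: sign_def one_pCons)
  have q_sum: "q = (\<Sum>\<pi>\<in>{\<pi>. \<pi> permutes UNIV}.
      smult (of_int (sign \<pi>)) (\<Prod>i\<in>UNIV. [:- X $ i $ \<pi> i, \<delta> i (\<pi> i):]))"
    unfolding q_def det_def by (simp add: sgn)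
  have "mat z $ i $ j = z * \<delta> i j" for z and i j :: 'n
    by (simp add: \<delta>_def mat_entry)
  then have poly_q: "poly q z = det (mat z - X)" for z
    unfolding q_sum det_def by (simp add: poly_sum poly_prod)
  have "degree q \<le> CARD('n)"
    unfolding q_sum
    by (intro degree_sum_le order.trans[OF degree_smult_le] prod_linear_poly finite)
  \<comment> \<open>Only the slopes contribute to this coefficient, and they are the entries of the
    identity matrix.\<close>
  moreover have "coeff q (CARD('n)) = det (mat 1 :: 'n cmat)"
    unfolding q_sum det_def
    by (simp add: coeff_sum prod_linear_poly \<delta>_def mat_entry)
  ultimately have deg: "degree q = CARD('n)" and lead: "lead_coeff q = 1"
    using le_degree[of q "CARD('n)"] by (auto simp: det_I)
  obtain root where "smult (lead_coeff q) (\<Prod>i<degree q. [:- root i, 1:]) = q"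
    by (rule complex_poly_decompose')
  then have q: "q = (\<Prod>i<CARD('n). [:- root i, 1:])"
    using lead deg by simp
  obtain h :: "'n \<Rightarrow> nat" where h: "bij_betw h UNIV {..<CARD('n)}"
    using finite_same_card_bij[of "UNIV :: 'n set" "{..<CARD('n)}"] by auto
  have "det (mat z - diag_mat (\<chi> i. root (h i))) = det (mat z - X)" for z
  proof -
    have "det (mat z - diag_mat (\<chi> i. root (h i))) = (\<Prod>i\<in>UNIV. z - root (h i))"
      by (subst det_diagonal) (auto simp: mat_entry diag_mat_entry)
    also have "\<dots> = (\<Prod>i<CARD('n). z - root i)"
      by (rule prod.reindex_bij_betw[OF h])
    also have "\<dots> = poly q z"
      by (simp add: q poly_prod)
    finally show ?thesis
      by (simp add: poly_q)
  qed
  then show ?thesis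
    using that unfolding same_eigenvalues_def by blast
qed

text \<open>If \<open>Y\<close> has distinct eigenvalues, any list of the eigenvalues of
  \<open>X\<close> is put into the eigenbasis of \<open>Y\<close>; otherwise the eigenvector clause
  is vacuous and \<open>X\<close> itself qualifies. This is the default for the choice built in the
  theorem.\<close>

lemma F_choice_exists: "\<exists>\<Phi> :: 'n::finite cmat \<Rightarrow> 'n cmat \<Rightarrow> 'n cmat. F_choice \<Phi>"
proof -
  have "\<exists>A. same_eigenvalues A X \<and>
      (distinct_eigenvalues Y \<longrightarrow> (\<forall>v. eigenvector Y v \<longrightarrow> eigenvector A v))" for X Y :: "'n cmat"
  proof (cases "distinct_eigenvalues Y")
    case True
    obtain V :: "'n cmat" and e :: "complex^'n" where V: "invertible V" "inj (($) e)" "Y = V ** diag_mat e ** matrix_inv V"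
      using distinct_eigenvalues_diagonalizable[OF True] by metis
    obtain x where x: "same_eigenvalues (diag_mat x) X"
      by (rule eigenvalue_list_exists)
    define A where "A = V ** diag_mat x ** matrix_inv V"
    have "same_eigenvalues A X"
      using x V(1) by (simp add: same_eigenvalues_def A_def similar_det)
    moreover have "eigenvector A v" if v: "eigenvector Y v" for v
    proof -
      obtain c where c: "v \<noteq> 0" "Y *v v = c *s v"
        using v by (auto simp: eigenvector_def)
      obtain i t where "v = V *v axis i t"
        using eigenvector_of_diagonalizable V c by metis
      moreover have "diag_mat x *v axis i t = x $ i *s axis i t"
        by (simp add: vec_eq_iff axis_def)
      moreover have "A *v (V *v u) = V *v (diag_mat x *v u)" for u
        using V(1) by (simp add: A_def matrix_vector_mul_assoc)
      ultimately have "A *v v = x $ i *s v"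
        by (simp add: vector_scalar_commute)
      then show ?thesis
        using c by (auto simp: eigenvector_def)
    qed
    ultimately show ?thesis
      by blast
  next
    case False
    then show ?thesis
      by (auto simp: same_eigenvalues_def)
  qed
  then have "\<exists>\<Phi>. \<forall>X Y :: 'n cmat. same_eigenvalues (\<Phi> X Y) X \<and>
      (distinct_eigenvalues Y \<longrightarrow> (\<forall>v. eigenvector Y v \<longrightarrow> eigenvector (\<Phi> X Y) v))"
    by metis
  then show ?thesis
    unfolding F_choice_def by blast
qed

section \<open>Extension across vertical lines\<close>

definition off_lines :: "real set \<Rightarrow> complex set" where
  "off_lines F = {k. Re k \<notin> F}"

lemma open_off_lines:
  assumes "finite F"
  shows "open (off_lines F)"
proof -
  have "off_lines F = Re -` (- F)"
    by (auto simp: off_lines_def)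
  moreover have "open (Re -` (- F))"
    using assms by (intro open_vimage continuous_intros) (simp add: open_Compl finite_imp_closed)
  ultimately show ?thesis
    by simp
qed

lemma off_lines_dense:
  assumes "finite F"
  shows "at a within off_lines F \<noteq> bot"
proof -
  have "\<exists>x\<in>off_lines F. x \<noteq> a \<and> dist x a < e" if "e > 0" for e
  proof -
    have "infinite {Re a<..<Re a + e}"
      using that by simp
    then have "infinite ({Re a<..<Re a + e} - F)"
      using assms by simp
    then obtain t where t: "t \<in> {Re a<..<Re a + e} - F"
      using infinite_imp_nonempty by blast
    define x where "x = Complex t (Im a)"
    have "dist x a = \<bar>t - Re a\<bar>"
      by (simp add: x_def dist_norm norm_complex_def)
    then have "dist x a < e"
      using t by simp
    moreover have "x \<in> off_lines F" "x \<noteq> a"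
      using t by (auto simp: x_def off_lines_def complex_eq_iff)
    ultimately show ?thesis
      by blast
  qed
  then have "a islimpt off_lines F"
    unfolding islimpt_approachable by simp
  then show ?thesis
    by (simp add: trivial_limit_within)
qed

text \<open>The limits give a continuous extension, which is then glued along one line at a time, as
  in Schwarz reflection. Points of the cuts, tips and poles are treated alike: only the existence of
  limits is asked.\<close>

lemma holomorphic_extension_across_lines:
  assumes F: "finite F" and S: "open S"
    and hol: "f holomorphic_on S \<inter> off_lines F"
    and lim: "\<And>a. a \<in> S \<Longrightarrow> \<exists>l. (f \<longlongrightarrow> l) (at a within off_lines F)"
  shows "\<exists>g. g holomorphic_on S \<and> (\<forall>z\<in>S \<inter> off_lines F. g z = f z) \<and>
    (\<forall>a\<in>S. (f \<longlongrightarrow> g a) (at a within off_lines F))"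
proof -
  define X where "X = off_lines F"
  have X: "open X" "\<And>a. at a within X \<noteq> bot"
    using F open_off_lines off_lines_dense unfolding X_def by blast+
  obtain g where g: "\<And>a. a \<in> S \<Longrightarrow> (f \<longlongrightarrow> g a) (at a within X)"
    using lim unfolding X_def by metis
  have eq: "g z = f z" if "z \<in> S \<inter> X" for z
  proof -
    have "isCont f z"
      using holomorphic_on_imp_continuous_on[OF hol] that open_Int[OF S X(1)]
      by (simp add: X_def continuous_on_eq_continuous_at)
    then have "(f \<longlongrightarrow> f z) (at z within X)"
      using continuous_at_imp_continuous_at_within continuous_within by blast
    then show ?thesis
      using g that X(2) tendsto_unique by blast
  qed
  \<comment> \<open>Near \<open>a\<close> all values of \<open>f\<close> off the lines lie within
    \<open>e / 2\<close> of \<open>g a\<close>, and so do, in the closed sense, the limits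
    \<open>g y\<close> formed from them.\<close>
  have cont: "continuous_on S g"
    unfolding continuous_on_iff
  proof (intro ballI allI impI)
    fix a and e :: real
    assume a: "a \<in> S" and e: "e > 0"
    have "\<forall>\<^sub>F z in at a within X. dist (f z) (g a) < e / 2"
      using g[OF a] e tendstoD half_gt_zero by blast
    then obtain d where d: "d > 0" "\<And>z. z \<in> X \<Longrightarrow> z \<noteq> a \<Longrightarrow> dist z a < d \<Longrightarrow> dist (f z) (g a) < e / 2"
      unfolding eventually_at by blast
    have "dist (g y) (g a) < e" if y: "y \<in> S" "dist y a < d" for y
    proof (cases "y = a")
      case False
      have "open (ball a d - {a})" "y \<in> ball a d - {a}"
        using y False by (auto simp: dist_commute)
      then have "\<forall>\<^sub>F z in at y within X. z \<in> ball a d - {a} \<and> z \<in> X"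
        using eventually_at_in_open'[of "ball a d - {a}" y]
        by (auto simp: eventually_at_filter elim: eventually_mono)
      then have "\<forall>\<^sub>F z in at y within X. dist (f z) (g a) \<le> e / 2"
      proof eventually_elim
        case (elim z)
        then show ?case
          using d(2)[of z] by (simp add: dist_commute)
      qed
      then have "dist (g y) (g a) \<le> e / 2"
        by (rule tendsto_upperbound[OF tendsto_dist[OF g[OF y(1)] tendsto_const] _ X(2)])
      then show ?thesis
        using e by simp
    qed (use e in simp)
    then show "\<exists>d>0. \<forall>x'\<in>S. dist x' a < d \<longrightarrow> dist (g x') (g a) < e"
      using d(1) by blast
  qed
  have "g analytic_on S"
    unfolding analytic_on_def
  proof
    fix a assume a: "a \<in> S"
    \<comment> \<open>Within distance \<open>d\<close> of \<open>a\<close> there is at most the one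
      line through \<open>a\<close>, so it cuts the ball into two halves on which \<open>g\<close>
      agrees with \<open>f\<close>.\<close>
    obtain d where d: "d > 0" "\<And>x. x \<in> F \<Longrightarrow> x \<noteq> Re a \<Longrightarrow> d \<le> dist (Re a) x"
      using finite_set_avoid[OF F, of "Re a"] by blast
    obtain d' where d': "d' > 0" "ball a d' \<subseteq> S"
      using a S open_contains_ball by blast
    define e where "e = min d d'"
    have e: "e > 0" "ball a e \<subseteq> S"
      using d d' by (auto simp: e_def)
    have off: "z \<in> X" if "z \<in> ball a e" "Re z \<noteq> Re a" for z
    proof -
      have "\<bar>Re a - Re z\<bar> < d"
        using that abs_Re_le_cmod[of "a - z"] by (simp add: e_def dist_norm)
      then show ?thesis
        using that(2) d(2)[of "Re z"] by (force simp: X_def off_lines_def dist_real_def)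
    qed
    have holg: "g holomorphic_on T" if "T \<subseteq> S \<inter> X" for T
      using that
      by (intro holomorphic_transform[OF holomorphic_on_subset[OF hol]]) (use eq in \<open>force simp: X_def\<close>)+
    have "g holomorphic_on ball a e"
    proof (rule holomorphic_on_paste_across_line[of _ 1 _ "Re a"])
      show "g holomorphic_on ball a e \<inter> {z. 1 \<bullet> z < Re a}"
        by (rule holg) (use e off in \<open>auto simp: inner_complex_def\<close>)
      show "g holomorphic_on ball a e \<inter> {z. Re a < 1 \<bullet> z}"
        by (rule holg) (use e off in \<open>auto simp: inner_complex_def\<close>)
      show "continuous_on (ball a e) g"
        using cont e(2) continuous_on_subset by blast
    qed auto
    then show "\<exists>e>0. g holomorphic_on ball a e"
      using e(1) by blast
  qed
  then show ?thesis
    using g eq analytic_imp_holomorphic unfolding X_def by blast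
qed

text \<open>The limit at infinity is known off the lines only; continuity of \<open>h\<close>
  spreads it to the lines.\<close>

lemma Liouville_off_lines:
  assumes F: "finite F" and h: "h holomorphic_on UNIV"
    and lim: "(h \<longlongrightarrow> l) (inf at_infinity (principal (off_lines F)))"
  shows "h z = l"
proof (rule Liouville_weak[OF h])
  show "(h \<longlongrightarrow> l) at_infinity"
  proof (rule tendstoI)
    fix e :: real assume e: "e > 0"
    have "\<forall>\<^sub>F z in inf at_infinity (principal (off_lines F)). dist (h z) l < e / 2"
      using lim e tendstoD half_gt_zero by blast
    then obtain b where b: "\<And>z. norm z \<ge> b \<Longrightarrow> z \<in> off_lines F \<Longrightarrow> dist (h z) l < e / 2"
      unfolding eventually_inf_principal eventually_at_infinity by blast
    \<comment> \<open>The margin \<open>1\<close> keeps the unit disc around \<open>z\<close> in the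
      region where the estimate holds off the lines.\<close>
    have "dist (h z) l < e" if z: "norm z \<ge> b + 1" for z
    proof -
      have "isCont h z"
        using h holomorphic_on_imp_continuous_on continuous_on_eq_continuous_at by blast
      then have t: "(h \<longlongrightarrow> h z) (at z within off_lines F)"
        using continuous_at_imp_continuous_at_within continuous_within by blast
      have "norm w \<ge> b" if "dist w z < 1" for w
        using z that norm_triangle_ineq2[of z w] by (simp add: dist_norm norm_minus_commute)
      then have "\<forall>\<^sub>F w in at z within off_lines F. dist (h w) l \<le> e / 2"
        unfolding eventually_at using b by (intro exI[of _ 1]) (auto intro: less_imp_le)
      then have "dist (h z) l \<le> e / 2"
        by (rule tendsto_upperbound[OF tendsto_dist[OF t tendsto_const] _ off_lines_dense[OF F]])
      then show ?thesis
        using e by simp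
    qed
    then show "\<forall>\<^sub>F z in at_infinity. dist (h z) l < e"
      unfolding eventually_at_infinity by blast
  qed
qed

section \<open>Partial fractions\<close>

text \<open>One pole is divided out at a time: the entire part gives a difference quotient, which is
  entire again, plus a fraction at \<open>a\<close>, and each old fraction divided by
  \<open>z - a\<close> splits into fractions at \<open>b\<close> and at \<open>a\<close>.\<close>

lemma entire_partial_fractions:
  assumes "finite A" "g holomorphic_on UNIV"
  shows "\<exists>h r. h holomorphic_on UNIV \<and>
      (\<forall>z. z \<notin> A \<longrightarrow> g z / (\<Prod>a\<in>A. z - a) = h z + (\<Sum>a\<in>A. r a / (z - a)))"
  using assms(1)
proof (induction rule: finite_induct)
  case empty
  then show ?case
    using assms(2) by auto
next
  case (insert a A)
  then obtain h r where h: "h holomorphic_on UNIV"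
    and r: "\<And>z. z \<notin> A \<Longrightarrow> g z / (\<Prod>a\<in>A. z - a) = h z + (\<Sum>a\<in>A. r a / (z - a))"
    by blast
  define h' where "h' = (\<lambda>z. if z = a then deriv h a else (h z - h a) / (z - a))"
  \<comment> \<open>The new pole collects the value \<open>h a\<close> and the corrections that come
    from splitting the old fractions.\<close>
  define r' where "r' = (\<lambda>b. if b = a then h a - (\<Sum>b\<in>A. r b / (b - a)) else r b / (b - a))"
  have "h' holomorphic_on UNIV"
    unfolding h'_def by (rule pole_lemma_open[OF h open_UNIV])
  moreover have "g z / (\<Prod>a\<in>insert a A. z - a) = h' z + (\<Sum>b\<in>insert a A. r' b / (z - b))"
    if z: "z \<notin> insert a A" for z
  proof -
    have "g z / (\<Prod>a\<in>insert a A. z - a) = (h z + (\<Sum>b\<in>A. r b / (z - b))) / (z - a)"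
      using r[of z] z insert.hyps by (simp add: field_simps)
    also have "\<dots> = h z / (z - a) + (\<Sum>b\<in>A. r b / (z - b) / (z - a))"
      by (simp add: add_divide_distrib sum_divide_distrib)
    also have "(\<Sum>b\<in>A. r b / (z - b) / (z - a)) =
        (\<Sum>b\<in>A. r b / (b - a) / (z - b) - r b / (b - a) / (z - a))"
    proof (rule sum.cong[OF refl])
      fix b assume "b \<in> A"
      then have "b - a \<noteq> 0" "z - b \<noteq> 0" "z - a \<noteq> 0"
        using z insert.hyps by auto
      moreover have pf: "x / u / (u + v) = x / v / u - x / v / (u + v)"
        if "v \<noteq> 0" "u \<noteq> 0" "u + v \<noteq> 0" for x u v :: complex
        using that by (simp add: divide_simps) (simp add: algebra_simps)
      ultimately show "r b / (z - b) / (z - a) = r b / (b - a) / (z - b) - r b / (b - a) / (z - a)"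
        using pf[of "b - a" "z - b" "r b"] by simp
    qed
    also have "h z / (z - a) + \<dots> = (h z - h a) / (z - a) + (\<Sum>b\<in>A. r b / (b - a) / (z - b))
        + (h a - (\<Sum>b\<in>A. r b / (b - a))) / (z - a)"
      by (simp add: sum_subtractf diff_divide_distrib sum_divide_distrib)
    also have "(\<Sum>b\<in>A. r b / (b - a) / (z - b)) = (\<Sum>b\<in>A. r' b / (z - b))"
      using insert.hyps by (intro sum.cong) (auto simp: r'_def)
    also have "(h z - h a) / (z - a) + \<dots> + (h a - (\<Sum>b\<in>A. r b / (b - a))) / (z - a) =
        h' z + (\<Sum>b\<in>insert a A. r' b / (z - b))"
      using z insert.hyps by (simp add: h'_def r'_def)
    finally show ?thesis .
  qed
  ultimately show ?case
    by blast
qed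

lemma Lagrange_interpolation:
  fixes p :: "complex poly"
  assumes S: "finite S" and deg: "degree p < card S"
  shows "poly p a = (\<Sum>x\<in>S. poly p x * (\<Prod>y\<in>S - {x}. (a - y) / (x - y)))"
proof -
  define L where "L = (\<lambda>x. smult (poly p x / (\<Prod>y\<in>S - {x}. x - y)) (\<Prod>y\<in>S - {x}. [:- y, 1:]))"
  have degL: "degree (L x) \<le> card S - 1" if "x \<in> S" for x
  proof -
    have "degree (\<Prod>y\<in>S - {x}. [:- y, 1:]) \<le> (\<Sum>y\<in>S - {x}. 1)"
      using S by (intro order.trans[OF degree_prod_sum_le] sum_mono) auto
    then show ?thesis
      using that S by (auto simp: L_def intro: order.trans[OF degree_smult_le])
  qed
  have polyL: "poly (L x) z = poly p x * (\<Prod>y\<in>S - {x}. (z - y) / (x - y))" for x z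
    by (simp add: L_def poly_prod prod_dividef)
  have "p = (\<Sum>x\<in>S. L x)"
  proof (rule poly_eqI_degree[of S])
    fix z assume z: "z \<in> S"
    have "(\<Prod>y\<in>S - {x}. (z - y) / (x - y)) = (if x = z then 1 else 0)" if "x \<in> S" for x
      using that z S by (auto simp: prod_zero_iff)
    then have "poly (\<Sum>x\<in>S. L x) z = (\<Sum>x\<in>S. if x = z then poly p x else 0)"
      unfolding poly_sum polyL by (intro sum.cong) auto
    then show "poly p z = poly (\<Sum>x\<in>S. L x) z"
      using z S by simp
  next
    have "degree (\<Sum>x\<in>S. L x) \<le> card S - 1"
      using degL by (intro degree_sum_le S) auto
    then show "degree (\<Sum>x\<in>S. L x) < card S"
      using deg by linarith
  qed (use deg in auto)
  then have "poly p a = poly (\<Sum>x\<in>S. L x) a"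
    by simp
  then show ?thesis
    by (simp add: poly_sum polyL)
qed

text \<open>The residues of a sum of simple fractions are linear combinations of finitely many values.\<close>

lemma dual_system_exists:
  fixes A X :: "complex set"
  assumes A: "finite A" "a \<in> A" and X: "infinite X"
  obtains S c where "finite S" "S \<subseteq> X - A"
    "\<And>b. b \<in> A \<Longrightarrow> (\<Sum>x\<in>S. c x / (x - b)) = (if b = a then 1 else 0)"
proof -
  have "infinite (X - A)"
    using A X by simp
  then obtain S where S: "finite S" "card S = card A" "S \<subseteq> X - A"
    using infinite_arbitrarily_large by blast
  \<comment> \<open>Clearing denominators turns the fractions into the polynomials
    \<open>p b\<close>, of degree below \<open>card A\<close>, where \<open>p b\<close> vanishes at
    \<open>a\<close> unless \<open>b = a\<close>. The weights \<open>c\<close> are made so that the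
    sum for \<open>b\<close> is the interpolated value of \<open>p b\<close> at \<open>a\<close>,
    divided by that of \<open>p a\<close>.\<close>
  define p where "p = (\<lambda>b. \<Prod>b'\<in>A - {b}. [:- b', 1 :: complex:])"
  define L where "L = (\<lambda>x. \<Prod>y\<in>S - {x}. (a - y) / (x - y))"
  define c where "c = (\<lambda>x. L x * (\<Prod>b\<in>A. x - b) / poly (p a) a)"
  have pa: "poly (p a) a \<noteq> 0"
    using A by (simp add: p_def poly_prod)
  have "(\<Sum>x\<in>S. c x / (x - b)) = (if b = a then 1 else 0)" if b: "b \<in> A" for b
  proof -
    have "degree (p b) \<le> (\<Sum>b'\<in>A - {b}. 1)"
      unfolding p_def using A by (intro order.trans[OF degree_prod_sum_le] sum_mono) auto
    then have "degree (p b) < card S"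
      using A b S(2) card_gt_0_iff[of A] by auto
    then have L: "poly (p b) a = (\<Sum>x\<in>S. poly (p b) x * L x)"
      unfolding L_def by (rule Lagrange_interpolation[OF S(1)])
    have "c x / (x - b) = poly (p b) x * L x / poly (p a) a" if "x \<in> S" for x
    proof -
      have "(\<Prod>b\<in>A. x - b) = (x - b) * poly (p b) x"
        using prod.remove[OF A(1) b, of "\<lambda>b. x - b"] by (simp add: p_def poly_prod)
      moreover have "x - b \<noteq> 0"
        using that b S(3) by auto
      ultimately show ?thesis
        by (simp add: c_def)
    qed
    then have "(\<Sum>x\<in>S. c x / (x - b)) = poly (p b) a / poly (p a) a"
      by (simp add: L sum_divide_distrib)
    moreover have "poly (p b) a = 0" if "b \<noteq> a"
      using A that by (auto simp: p_def poly_prod)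
    ultimately show ?thesis
      using pa by auto
  qed
  then show ?thesis
    using that S by blast
qed

section \<open>The logarithm with the upward cut\<close>

lemma Ln_up_has_derivative:
  assumes "Re z \<noteq> 0 \<or> Im z < 0"
  shows "(Ln_up has_field_derivative 1 / z) (at z)"
proof -
  have "\<i> * z \<notin> \<real>\<^sub>\<le>\<^sub>0"
    using assms by (auto simp: complex_nonpos_Reals_iff)
  then have 1: "(Ln has_field_derivative inverse (\<i> * z)) (at (\<i> * z))"
    by (rule has_field_derivative_Ln)
  have "((*) \<i> has_field_derivative \<i>) (at z)"
    by (rule DERIV_cmult_Id)
  with 1 have "((\<lambda>z. Ln (\<i> * z)) has_field_derivative inverse (\<i> * z) * \<i>) (at z)"
    by (rule DERIV_chain2)
  from DERIV_diff[OF this DERIV_const, of "\<i> * of_real pi / 2"]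
  have "((\<lambda>z. Ln (\<i> * z) - \<i> * of_real pi / 2) has_field_derivative inverse (\<i> * z) * \<i>) (at z)"
    by simp
  moreover have "Ln_up = (\<lambda>z. Ln (\<i> * z) - \<i> * of_real pi / 2)"
    by (simp add: fun_eq_iff Ln_up_def)
  moreover have "inverse (\<i> * z) * \<i> = 1 / z"
    by (simp add: field_simps)
  ultimately show ?thesis
    by simp
qed

lemma Ln_up_right: "Re z > 0 \<Longrightarrow> Ln_up z = Ln z"
  unfolding Ln_up_def by (subst Ln_times_ii) auto

lemma Ln_up_left: "Re z < 0 \<Longrightarrow> Im z > 0 \<Longrightarrow> Ln_up z = Ln z - 2 * of_real pi * \<i>"
  unfolding Ln_up_def by (subst Ln_times_ii) auto

text \<open>From the right shore to the left one the logarithm drops by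
  \<open>2 * pi * \<i>\<close>; this drop in the exponent is what compensates the jump of
  \<open>U\<close>.\<close>

lemma Ln_up_shores:
  assumes "Re k = Re a" "Im k > Im a"
  shows "((\<lambda>z. Ln_up (z - a)) \<longlongrightarrow> Ln (k - a)) (at k within right_side k)"
    and "((\<lambda>z. Ln_up (z - a)) \<longlongrightarrow> Ln (k - a) - 2 * of_real pi * \<i>) (at k within left_side k)"
proof -
  have ka: "k - a \<notin> \<real>\<^sub>\<le>\<^sub>0"
    using assms by (simp add: complex_nonpos_Reals_iff)
  have lim: "((\<lambda>z. Ln (z - a)) \<longlongrightarrow> Ln (k - a)) (at k within S)" for S
    by (rule tendsto_Ln[OF tendsto_diff[OF tendsto_ident_at tendsto_const] ka])
  have "Ln (z - a) = Ln_up (z - a)" if "z \<in> right_side k" for z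
  proof -
    have "Re (z - a) > 0"
      using that assms(1) by (simp add: right_side_def)
    then show ?thesis
      by (rule Ln_up_right[symmetric])
  qed
  then have "\<forall>\<^sub>F z in at k within right_side k. Ln (z - a) = Ln_up (z - a)"
    unfolding eventually_at_filter by simp
  with lim show "((\<lambda>z. Ln_up (z - a)) \<longlongrightarrow> Ln (k - a)) (at k within right_side k)"
    by (rule Lim_transform_eventually)
  have "\<forall>\<^sub>F z in nhds k. z \<in> {z. Im z > Im a}"
    using assms(2) by (intro eventually_nhds_in_open) (simp_all add: open_halfspace_Im_gt)
  then have ev: "\<forall>\<^sub>F z in at k within left_side k. Ln (z - a) - 2 * of_real pi * \<i> = Ln_up (z - a)"
    unfolding eventually_at_filter
  proof eventually_elim
    case (elim z)
    have "Ln_up (z - a) = Ln (z - a) - 2 * of_real pi * \<i>" if "z \<in> left_side k"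
      using that assms(1) elim by (intro Ln_up_left) (simp_all add: left_side_def)
    then show ?case
      by simp
  qed
  have "((\<lambda>z. Ln (z - a) - 2 * of_real pi * \<i>) \<longlongrightarrow> Ln (k - a) - 2 * of_real pi * \<i>)
      (at k within left_side k)"
    using lim by (rule tendsto_diff[OF _ tendsto_const])
  from this ev show "((\<lambda>z. Ln_up (z - a)) \<longlongrightarrow> Ln (k - a) - 2 * of_real pi * \<i>) (at k within left_side k)"
    by (rule Lim_transform_eventually)
qed

text \<open>From \<open>ln y < y\<close> at \<open>y = 1 / sqrt x\<close>.\<close>

lemma abs_mult_ln_le:
  fixes x :: real
  assumes "0 < x" "x < 1"
  shows "x * \<bar>ln x\<bar> \<le> 2 * sqrt x"
proof -
  have "- ln x = 2 * ln (1 / sqrt x)"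
    using assms by (simp add: ln_div ln_sqrt)
  also have "\<dots> \<le> 2 * (1 / sqrt x)"
    using assms by (intro mult_left_mono less_imp_le[OF ln_less_self]) auto
  finally have "x * (- ln x) \<le> x * (2 * (1 / sqrt x))"
    using assms by (intro mult_left_mono) auto
  also have "\<dots> = 2 * (x / sqrt x)"
    by simp
  also have "\<dots> = 2 * sqrt x"
    using real_div_sqrt[of x] assms by simp
  finally show ?thesis
    using assms by simp
qed

text \<open>Near a tip this makes a power of \<open>k - a\<close> with holomorphic exponent
  comparable with the power whose exponent is frozen at \<open>a\<close>.\<close>

lemma mult_Ln_up_tendsto_0: "((\<lambda>w. w * Ln_up w) \<longlongrightarrow> 0) (at 0)"
proof (rule Lim_null_comparison)
  have "\<forall>\<^sub>F w in at (0::complex). dist w 0 < 1"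
    unfolding eventually_at by (intro exI[of _ 1]) auto
  moreover have "\<forall>\<^sub>F w in at (0::complex). w \<noteq> 0"
    by (simp add: eventually_neq_at_within)
  ultimately show "\<forall>\<^sub>F w in at 0. norm (w * Ln_up w) \<le> 2 * sqrt (norm w) + 2 * pi * norm w"
  proof eventually_elim
    case (elim w)
    have "norm (Ln (\<i> * w)) \<le> \<bar>Re (Ln (\<i> * w))\<bar> + \<bar>Im (Ln (\<i> * w))\<bar>"
      by (rule cmod_le)
    also have "\<dots> \<le> \<bar>ln (norm w)\<bar> + pi"
      using elim mpi_less_Im_Ln[of "\<i> * w"] Im_Ln_le_pi[of "\<i> * w"] by (simp add: norm_mult)
    finally have "norm (Ln (\<i> * w)) \<le> \<bar>ln (norm w)\<bar> + pi" .
    moreover have "norm (Ln_up w) \<le> norm (Ln (\<i> * w)) + pi / 2"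
      unfolding Ln_up_def
      using norm_triangle_ineq4[of "Ln (\<i> * w)" "\<i> * of_real pi / 2"]
      by (simp add: norm_mult norm_divide)
    ultimately have "norm (Ln_up w) \<le> \<bar>ln (norm w)\<bar> + 2 * pi"
      using pi_ge_zero by linarith
    then have "norm (w * Ln_up w) \<le> norm w * (\<bar>ln (norm w)\<bar> + 2 * pi)"
      by (simp add: norm_mult mult_left_mono)
    also have "\<dots> \<le> 2 * sqrt (norm w) + 2 * pi * norm w"
      using abs_mult_ln_le[of "norm w"] elim by (simp add: algebra_simps)
    finally show ?case .
  qed
  have "((\<lambda>w::complex. 2 * sqrt (norm w) + 2 * pi * norm w) \<longlongrightarrow> 2 * sqrt (norm (0::complex)) + 2 * pi * norm (0::complex)) (at 0)"
    by (intro tendsto_intros)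
  then show "((\<lambda>w::complex. 2 * sqrt (norm w) + 2 * pi * norm w) \<longlongrightarrow> 0) (at 0)"
    by simp
qed

lemma matrix_mult_zero_right: "A ** (0 :: 'n::finite cmat) = 0" for A :: "'n::finite cmat"
  by (rule matrix_eqI) (simp add: matrix_mult_entry)

lemma matrix_mult_minus_right: "A ** (- C) = - (A ** C)" for A C :: "'n::finite cmat"
  by (rule matrix_eqI) (simp add: matrix_mult_entry sum_negf)

section \<open>Derivatives of matrix functions\<close>

definition mat_deriv :: "(complex \<Rightarrow> 'n::finite cmat) \<Rightarrow> 'n cmat \<Rightarrow> complex filter \<Rightarrow> bool" where
  "mat_deriv M D F \<longleftrightarrow> (\<forall>m n. ((\<lambda>b. M b $ m $ n) has_field_derivative D $ m $ n) F)"

text \<open>With the difference quotient as one matrix, the product and inverse rules become limits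
  of matrix products, in which the order of the factors is kept.\<close>

lemma mat_deriv_iff:
  "mat_deriv M D (at x within S) \<longleftrightarrow>
    ((\<lambda>y. mat (1 / (y - x)) ** (M y - M x)) \<longlongrightarrow> D) (at x within S)"
proof -
  have "((\<lambda>y. mat (1 / (y - x)) ** (M y - M x)) \<longlongrightarrow> D) (at x within S) \<longleftrightarrow>
      (\<forall>m n. ((\<lambda>y. (mat (1 / (y - x)) ** (M y - M x)) $ m $ n) \<longlongrightarrow> D $ m $ n) (at x within S))"
    by (auto intro: tendsto_matrixI dest: tendsto_matrixD simp del: mat_mult_entry)
  then show ?thesis
    by (simp add: mat_deriv_def has_field_derivative_iff)
qed

lemma mat_deriv_unique:
  "mat_deriv M D (at x within S) \<Longrightarrow> mat_deriv M E (at x within S) \<Longrightarrow> at x within S \<noteq> bot \<Longrightarrow> D = E"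
  unfolding mat_deriv_iff using tendsto_unique by blast

lemma mat_deriv_tendsto:
  assumes "mat_deriv M D (at x within S)"
  shows "(M \<longlongrightarrow> M x) (at x within S)"
proof (rule tendsto_matrixI)
  fix i j
  show "((\<lambda>y. M y $ i $ j) \<longlongrightarrow> M x $ i $ j) (at x within S)"
    using assms DERIV_continuous unfolding mat_deriv_def continuous_within by blast
qed

lemma mat_deriv_const: "mat_deriv (\<lambda>_. C) 0 F"
  by (simp add: mat_deriv_def)

lemma mat_deriv_diff:
  "mat_deriv M D (at x within S) \<Longrightarrow> mat_deriv N E (at x within S) \<Longrightarrow> mat_deriv (\<lambda>y. M y - N y) (D - E) (at x within S)"
  by (simp add: mat_deriv_def DERIV_diff)

lemma mat_deriv_add:
  "mat_deriv M D (at x within S) \<Longrightarrow> mat_deriv N E (at x within S) \<Longrightarrow> mat_deriv (\<lambda>y. M y + N y) (D + E) (at x within S)"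
  by (simp add: mat_deriv_def DERIV_add)

lemma mat_deriv_sum:
  "(\<And>i. i \<in> I \<Longrightarrow> mat_deriv (M i) (D i) (at x within S)) \<Longrightarrow>
    mat_deriv (\<lambda>y. \<Sum>i\<in>I. M i y) (\<Sum>i\<in>I. D i) (at x within S)"
  by (simp add: mat_deriv_def DERIV_sum)

lemma mat_deriv_cong:
  assumes "mat_deriv M D (at x within S)" "x \<in> S" "\<And>y. y \<in> S \<Longrightarrow> M y = N y"
  shows "mat_deriv N D (at x within S)"
  unfolding mat_deriv_def
proof (intro allI)
  fix m n
  show "((\<lambda>b. N b $ m $ n) has_field_derivative D $ m $ n) (at x within S)"
    by (rule has_field_derivative_transform_within[of "\<lambda>b. M b $ m $ n" _ _ _ 1])
      (use assms in \<open>simp_all add: mat_deriv_def\<close>)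
qed

lemma mat_deriv_mult:
  assumes "mat_deriv M D (at x within S)" "mat_deriv N E (at x within S)"
  shows "mat_deriv (\<lambda>y. M y ** N y) (D ** N x + M x ** E) (at x within S)"
proof -
  have "((\<lambda>y. (mat (1 / (y - x)) ** (M y - M x)) ** N y + M x ** (mat (1 / (y - x)) ** (N y - N x)))
      \<longlongrightarrow> D ** N x + M x ** E) (at x within S)"
    using assms mat_deriv_tendsto[OF assms(2)] unfolding mat_deriv_iff
    by (intro tendsto_add tendsto_matrix_mult tendsto_const)
  moreover have "(mat c ** (M y - M x)) ** N y + M x ** (mat c ** (N y - N x)) =
      mat c ** (M y ** N y - M x ** N x)" for c y
    by (simp add: matrix_mul_assoc mat_commute[of "M x"] matrix_diff_ldistrib matrix_diff_rdistrib)
  ultimately show ?thesis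
    by (simp add: mat_deriv_iff)
qed

text \<open>Rests on \<open>N y - N x = - (N y ** (M y - M x) ** N x)\<close> for the inverses
  \<open>N\<close> of \<open>M\<close>.\<close>

lemma mat_deriv_inv:
  assumes M: "mat_deriv M D (at x within S)" and x: "x \<in> S" and inv: "\<And>y. y \<in> S \<Longrightarrow> invertible (M y)"
  shows "mat_deriv (\<lambda>y. matrix_inv (M y)) (- (matrix_inv (M x) ** D ** matrix_inv (M x))) (at x within S)"
proof -
  have "((\<lambda>y. - (matrix_inv (M y) ** (mat (1 / (y - x)) ** (M y - M x)) ** matrix_inv (M x)))
      \<longlongrightarrow> - (matrix_inv (M x) ** D ** matrix_inv (M x))) (at x within S)"
    using M inv x unfolding mat_deriv_iff
    by (intro tendsto_minus tendsto_matrix_mult tendsto_const tendsto_matrix_inv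
        mat_deriv_tendsto[OF M]) auto
  moreover have "\<forall>\<^sub>F y in at x within S. - (matrix_inv (M y) ** (mat (1 / (y - x)) ** (M y - M x)) ** matrix_inv (M x)) =
      mat (1 / (y - x)) ** (matrix_inv (M y) - matrix_inv (M x))"
    unfolding eventually_at_filter
  proof (intro always_eventually allI impI)
    fix y assume "y \<in> S"
    define c where "c = 1 / (y - x)"
    have "matrix_inv (M y) ** (M y - M x) ** matrix_inv (M x) = matrix_inv (M x) - matrix_inv (M y)"
      using inv x \<open>y \<in> S\<close> by (simp add: matrix_diff_ldistrib matrix_diff_rdistrib matrix_inv_left)
    moreover have "matrix_inv (M y) ** (mat c ** (M y - M x)) ** matrix_inv (M x) =
        mat c ** (matrix_inv (M y) ** (M y - M x) ** matrix_inv (M x))"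
      by (simp only: matrix_mul_assoc mat_commute[of "matrix_inv (M y)"])
    ultimately have "- (matrix_inv (M y) ** (mat c ** (M y - M x)) ** matrix_inv (M x)) =
        - (mat c ** (matrix_inv (M x) - matrix_inv (M y)))"
      by (simp only:)
    also have "\<dots> = mat c ** (matrix_inv (M y) - matrix_inv (M x))"
      by (simp add: matrix_diff_ldistrib)
    finally show "- (matrix_inv (M y) ** (mat (1 / (y - x)) ** (M y - M x)) ** matrix_inv (M x)) =
        mat (1 / (y - x)) ** (matrix_inv (M y) - matrix_inv (M x))"
      by (simp only: c_def)
  qed
  ultimately show ?thesis
    unfolding mat_deriv_iff by (rule Lim_transform_eventually)
qed

text \<open>Extracts a residue. The numerators may depend on \<open>k\<close>, so that in a double
  sum over tips and poles one family of fractions can be absorbed into the numerators of the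
  other.\<close>

lemma tendsto_leading_fraction:
  fixes \<phi> :: "'i \<Rightarrow> complex \<Rightarrow> complex" and c :: "'i \<Rightarrow> complex"
  assumes "finite I" "i0 \<in> I" "inj_on c I"
    and "\<And>i. i \<in> I \<Longrightarrow> (\<phi> i \<longlongrightarrow> l i) (at (c i0) within S)"
  shows "((\<lambda>k. (k - c i0) * (\<Sum>i\<in>I. \<phi> i k / (k - c i))) \<longlongrightarrow> l i0) (at (c i0) within S)"
proof -
  have "((\<lambda>k. (k - c i0) * (\<Sum>i\<in>I - {i0}. \<phi> i k / (k - c i)) + \<phi> i0 k) \<longlongrightarrow>
      (c i0 - c i0) * (\<Sum>i\<in>I - {i0}. l i / (c i0 - c i)) + l i0) (at (c i0) within S)"
  proof (intro tendsto_add tendsto_mult tendsto_diff tendsto_sum tendsto_divide tendsto_const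
      tendsto_ident_at assms(4))
    fix i assume "i \<in> I - {i0}"
    then show "c i0 - c i \<noteq> 0"
      using assms(2,3) by (auto simp: inj_on_def)
  qed (use assms(2) in auto)
  moreover have "\<forall>\<^sub>F k in at (c i0) within S. (k - c i0) * (\<Sum>i\<in>I - {i0}. \<phi> i k / (k - c i)) + \<phi> i0 k =
      (k - c i0) * (\<Sum>i\<in>I. \<phi> i k / (k - c i))"
    unfolding eventually_at_filter
    by (rule always_eventually) (use assms(1,2) in \<open>auto simp: sum.remove distrib_left\<close>)
  ultimately have "((\<lambda>k. (k - c i0) * (\<Sum>i\<in>I. \<phi> i k / (k - c i))) \<longlongrightarrow>
      (c i0 - c i0) * (\<Sum>i\<in>I - {i0}. l i / (c i0 - c i)) + l i0) (at (c i0) within S)"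
    by (rule Lim_transform_eventually)
  then show ?thesis
    by simp
qed

lemma tendsto_fraction_sum:
  fixes c :: "'i \<Rightarrow> complex"
  assumes "\<And>i. i \<in> I \<Longrightarrow> a \<noteq> c i"
  shows "((\<lambda>k. \<Sum>i\<in>I. y i / (k - c i)) \<longlongrightarrow> (\<Sum>i\<in>I. y i / (a - c i))) (at a within S)"
  using assms by (intro tendsto_sum tendsto_divide tendsto_const tendsto_diff tendsto_ident_at) auto

section \<open>Cuts\<close>

text \<open>Used with \<open>E\<close> empty for the uniqueness of derivatives along the ray, and
  with \<open>E\<close> the exceptional parameters for limits that reach them.\<close>

lemma imag_ray_dense:
  assumes "finite E" "b \<in> imag_ray"
  shows "at b within (imag_ray - E) \<noteq> bot"
proof -
  have "\<exists>x\<in>imag_ray - E. x \<noteq> b \<and> dist x b < e" if "e > 0" for e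
  proof -
    have "infinite {0<..<e}"
      using that by simp
    moreover have "inj_on (\<lambda>t. b + \<i> * of_real t) {0<..<e}"
      by (simp add: inj_on_def)
    ultimately have "infinite ((\<lambda>t. b + \<i> * of_real t) ` {0<..<e} - E)"
      using assms(1) finite_imageD by (metis Diff_infinite_finite)
    then obtain t where "t \<in> {0<..<e}" "b + \<i> * of_real t \<notin> E"
      using infinite_imp_nonempty by blast
    then show ?thesis
      using assms(2)
      by (intro bexI[of _ "b + \<i> * of_real t"]) (auto simp: imag_ray_def dist_norm norm_mult)
  qed
  then have "b islimpt (imag_ray - E)"
    unfolding islimpt_approachable by blast
  then show ?thesis
    by (simp add: trivial_limit_within)
qed

lemma closed_cut_union: "closed (cut_union p \<kappa> b)"
proof -
  have "insert a (cut a) = {k. Re k = Re a} \<inter> {k. Im k \<ge> Im a}" for a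
    by (auto simp: cut_def complex_eq_iff)
  then have "closed (insert a (cut a))" for a
    by (simp add: closed_Int closed_halfspace_Im_ge closed_Collect_eq continuous_on_Re)
  then show ?thesis
    unfolding cut_union_def by (intro closed_UN) auto
qed

lemma tendsto_off_lines_shores:
  assumes "Re a \<in> F" "(f \<longlongrightarrow> l) (at a within right_side a)" "(f \<longlongrightarrow> l) (at a within left_side a)"
  shows "(f \<longlongrightarrow> l) (at a within off_lines F)"
proof -
  have "off_lines F \<subseteq> right_side a \<union> left_side a"
    using assms(1) by (auto simp: off_lines_def right_side_def left_side_def) (metis linorder_neqE)
  then show ?thesis
    using Lim_Un[OF assms(2,3)] tendsto_within_subset by blast
qed

lemma diag_power_invertible: "invertible (diag_power z e)"
proof (rule invertibleI)
  show "diag_power z e ** diag_mat (\<chi> i. exp (- (e $ i * Ln_up z))) = mat 1"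
    by (rule matrix_eqI) (simp add: diag_power_def diag_mat_entry mat_entry exp_minus)
qed

lemma diag_power_commute: "diag_power z e ** diag_mat u = diag_mat u ** diag_power z e"
  by (simp add: diag_power_def diag_mat_mult mult.commute)

text \<open>The inner factors \<open>matrix_inv K\<close> and \<open>K\<close> of the prescribed
  behaviour cancel. What remains has its only singular factor on the far right, and that factor is
  diagonal.\<close>

lemma leading_term_at_factorization:
  fixes U P :: "complex \<Rightarrow> 'n::finite cmat"
  assumes "leading_term_at a C e P U" "\<forall>k\<in>W. invertible (P k)" "X \<subseteq> - C"
  shows "\<exists>K Y. invertible K \<and> (Y \<longlongrightarrow> mat 1) (at a within X) \<and>
    (\<forall>k\<in>W. U k ** P k = Y k ** K ** diag_power (k - a) e)"
proof -
  obtain K where K: "invertible K" and lim: "((\<lambda>k. U k **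
      matrix_inv ((K ** diag_power (k - a) e ** matrix_inv K) ** (K ** matrix_inv (P k))))
      \<longlongrightarrow> mat 1) (at a within - C)"
    using assms(1) unfolding leading_term_at_def by blast
  define Y where "Y = (\<lambda>k. U k **
      matrix_inv ((K ** diag_power (k - a) e ** matrix_inv K) ** (K ** matrix_inv (P k))))"
  have "U k ** P k = Y k ** K ** diag_power (k - a) e" if k: "k \<in> W" for k
  proof -
    define D where "D = diag_power (k - a) e"
    have P: "invertible (P k)" and D: "invertible D"
      using k assms(2) diag_power_invertible by (auto simp: D_def)
    have eq: "(K ** D ** matrix_inv K) ** (K ** matrix_inv (P k)) = K ** D ** matrix_inv (P k)"
      using K by (simp add: matrix_mul_assoc)
    have "invertible (K ** D ** matrix_inv (P k))"
      using K P D by (intro invertible_mult invertible_matrix_inv)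
    then have "U k = Y k ** (K ** D ** matrix_inv (P k))"
      unfolding Y_def D_def[symmetric] eq by simp
    then show ?thesis
      using P by (simp add: D_def matrix_mul_assoc)
  qed
  moreover have "(Y \<longlongrightarrow> mat 1) (at a within X)"
    using lim assms(3) tendsto_within_subset unfolding Y_def by blast
  ultimately show ?thesis
    using K by blast
qed

section \<open>The conjugated matrix\<close>

locale rh_setting =
  fixes G :: "complex \<Rightarrow> complex^'n::finite^'n"
    and p d :: nat
    and \<kappa> \<rho> :: "nat \<Rightarrow> complex"
    and \<epsilon> :: real
    and H s :: "nat \<Rightarrow> complex \<Rightarrow> complex^'n^'n"
    and Z W :: "complex set"
    and P B :: "complex \<Rightarrow> complex^'n^'n"
    and f lf :: "nat \<Rightarrow> complex \<Rightarrow> complex^'n"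
    and U :: "complex \<Rightarrow> complex \<Rightarrow> complex^'n^'n"
  assumes orig: "original_data G p \<kappa>"
    and eps: "\<epsilon> > 0"
    and coeff: "coefficients G p \<kappa> \<epsilon> H"
    and comm: "commutativity_restriction p \<kappa> \<epsilon> H"
    and eig: "common_eigenvectors p \<kappa> \<epsilon> H Z W P f"
    and logb: "log_branch p \<kappa> f lf"
    and RH: "RH_family p \<kappa> H Z P lf U"
    and s_hol: "\<forall>j\<in>{1..p}. mat_holomorphic_on (s j) (half_strip \<epsilon>)"
    and ode: "ODE1 p \<kappa> U s"
    and matB: "matrix_B p \<kappa> \<epsilon> H W P d \<rho> B"
begin

text \<open>Since \<open>b\<close> is imaginary, \<open>\<kappa> j + b\<close> keeps the real part
  of \<open>\<kappa> j\<close>, and the lines do not depend on \<open>b\<close>.\<close>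

definition "lines = Re ` (\<kappa> ` {1..p} \<union> \<rho> ` {1..d})"
definition "X = off_lines lines"
definition "A b k = (\<Sum>j=1..p. mat (1 / (k - (\<kappa> j + b))) ** s j b)"
definition "M b k = U b k ** B k ** matrix_inv (U b k)"
text \<open>Its simple zeros match the poles of \<open>B\<close>, so that \<open>q\<close> times
  \<open>M\<close> has limits at the \<open>\<rho> l\<close> as well.\<close>

definition "q k = (\<Prod>a\<in>\<rho> ` {1..d}. k - a)"

lemma finite_lines: "finite lines"
  by (simp add: lines_def)

lemma X_dense: "at a within X \<noteq> bot"
  unfolding X_def by (rule off_lines_dense[OF finite_lines])

lemma X_rho: "k \<in> X \<Longrightarrow> k \<notin> \<rho> ` {1..d}"
  by (auto simp: X_def off_lines_def lines_def)

lemma X_cut: "k \<in> X \<Longrightarrow> b \<in> imag_ray \<Longrightarrow> k \<notin> cut_union p \<kappa> b"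
  by (auto simp: X_def off_lines_def lines_def imag_ray_def cut_union_def cut_def)

lemma tip_in_cut: "b \<in> imag_ray \<Longrightarrow> \<kappa> j + b \<in> cut (\<kappa> j)"
  by (auto simp: imag_ray_def cut_def)

lemma cut_in_cut: "b \<in> imag_ray \<Longrightarrow> k \<in> cut (\<kappa> j + b) \<Longrightarrow> k \<in> cut (\<kappa> j)"
  by (auto simp: imag_ray_def cut_def)

lemma cut_strip: "cut (\<kappa> j) \<subseteq> strip_at \<epsilon> (\<kappa> j)"
proof
  fix k assume "k \<in> cut (\<kappa> j)"
  then have "k - \<kappa> j \<in> half_strip \<epsilon>"
    using eps by (simp add: cut_def half_strip_def)
  then show "k \<in> strip_at \<epsilon> (\<kappa> j)"
    unfolding strip_at_def by (intro image_eqI[of _ _ "k - \<kappa> j"]) auto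
qed

lemma open_half_strip: "open (half_strip \<epsilon>)"
proof -
  have "half_strip \<epsilon> = {z. Re z < \<epsilon>} \<inter> {z. Re z > - \<epsilon>} \<inter> {z. Im z > 0}"
    by (auto simp: half_strip_def)
  then show ?thesis
    by (simp add: open_Int open_halfspace_Im_gt open_halfspace_Re_lt open_halfspace_Re_gt)
qed

lemma open_strip: "open (strip_at \<epsilon> a)"
  unfolding strip_at_def using open_translation[OF open_half_strip, of a] by (simp add: add.commute[of _ a])

lemma H_hol: "j \<in> {1..p} \<Longrightarrow> mat_holomorphic_on (H j) (strip_at \<epsilon> (\<kappa> j))"
  using coeff by (simp add: coefficients_def)

lemmas eig' = eig [unfolded common_eigenvectors_def]

lemmas finite_Z = eig' [THEN conjunct1]
lemmas open_W = eig' [THEN conjunct2, THEN conjunct1]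
lemmas cut_W = eig' [THEN conjunct2, THEN conjunct2, THEN conjunct1]
lemmas P_hol = eig' [THEN conjunct2, THEN conjunct2, THEN conjunct2, THEN conjunct1]
lemmas inv_P = eig' [THEN conjunct2, THEN conjunct2, THEN conjunct2, THEN conjunct2, THEN conjunct2, THEN conjunct1]
lemmas f_eig = eig' [THEN conjunct2, THEN conjunct2, THEN conjunct2, THEN conjunct2, THEN conjunct2, THEN conjunct2, THEN conjunct2]

lemma H_eig: "j \<in> {1..p} \<Longrightarrow> k \<in> cut (\<kappa> j) \<Longrightarrow> k \<notin> Z \<Longrightarrow>
    H j k = P k ** diag_mat (\<chi> i. exp (lf j k $ i)) ** matrix_inv (P k)"
proof -
  assume *: "j \<in> {1..p}" "k \<in> cut (\<kappa> j)" "k \<notin> Z"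
  then have "H j k = P k ** diag_mat (f j k) ** matrix_inv (P k)"
    using f_eig by simp
  moreover have "f j k = (\<chi> i. exp (lf j k $ i))"
    using * logb by (simp add: log_branch_def vec_eq_iff)
  ultimately show ?thesis
    by simp
qed

lemmas orig' = orig [unfolded original_data_def]
lemmas kappa_inj = orig' [THEN conjunct2, THEN conjunct1]
lemmas kappa_cut = orig' [THEN conjunct2, THEN conjunct2, THEN conjunct2, THEN conjunct2, THEN conjunct2, THEN conjunct2, THEN conjunct2, THEN conjunct2, THEN conjunct1]

text \<open>Of two points on one vertical line the upper one would lie on the cut of the lower one,
  which the original data exclude.\<close>

lemma kappa_Re_inj:
  assumes "i \<in> {1..p}" "j \<in> {1..p}" "i \<noteq> j"
  shows "Re (\<kappa> i) \<noteq> Re (\<kappa> j)"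
proof
  assume "Re (\<kappa> i) = Re (\<kappa> j)"
  moreover have "\<kappa> i \<noteq> \<kappa> j"
    using inj_onD[OF kappa_inj _ assms(1,2)] assms(3) by blast
  ultimately have "\<kappa> i \<in> cut (\<kappa> j) \<or> \<kappa> j \<in> cut (\<kappa> i)"
    by (auto simp: cut_def complex_eq_iff)
  moreover have "\<kappa> i \<notin> cut (\<kappa> j)" "\<kappa> j \<notin> cut (\<kappa> i)"
    using bspec[OF bspec[OF kappa_cut assms(1)] assms(2)] bspec[OF bspec[OF kappa_cut assms(2)] assms(1)]
    by simp_all
  ultimately show False
    by blast
qed

lemma tips_inj: "inj_on (\<lambda>j. \<kappa> j + b) {1..p}"
proof (rule inj_onI)
  fix i j
  assume *: "i \<in> {1..p}" "j \<in> {1..p}" "\<kappa> i + b = \<kappa> j + b"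
  then have "Re (\<kappa> i) = Re (\<kappa> j)"
    by simp
  then show "i = j"
    using kappa_Re_inj * by blast
qed

lemmas RH' = bspec [OF conjunct1 [OF RH [unfolded RH_family_def]]]

lemma U_hol: "b \<in> imag_ray \<Longrightarrow> mat_holomorphic_on (U b) (- cut_union p \<kappa> b)"
  by (rule RH' [THEN conjunct1])

lemma U_inv:
  assumes "b \<in> imag_ray" "k \<notin> cut_union p \<kappa> b"
  shows "invertible (U b k)"
proof -
  have "\<forall>k\<in>- cut_union p \<kappa> b. invertible (U b k)"
    by (rule RH' [OF assms(1), THEN conjunct2, THEN conjunct1])
  then show ?thesis
    using assms(2) by simp
qed

lemma U_inf: "b \<in> imag_ray \<Longrightarrow> (U b \<longlongrightarrow> mat 1) (inf at_infinity (principal (- cut_union p \<kappa> b)))"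
  by (rule RH' [THEN conjunct2, THEN conjunct2, THEN conjunct2, THEN conjunct1])

lemma U_shores:
  assumes "b \<in> imag_ray" "j \<in> {1..p}" "k \<in> cut (\<kappa> j + b)"
  shows "\<exists>Uplus Uminus.
           (U b \<longlongrightarrow> Uplus) (at k within right_side k) \<and>
           (U b \<longlongrightarrow> Uminus) (at k within left_side k) \<and>
           invertible Uplus \<and> invertible Uminus \<and> Uplus = Uminus ** H j k"
proof -
  have "\<forall>j\<in>{1..p}. \<forall>k\<in>cut (\<kappa> j + b). \<exists>Uplus Uminus.
           (U b \<longlongrightarrow> Uplus) (at k within right_side k) \<and>
           (U b \<longlongrightarrow> Uminus) (at k within left_side k) \<and>
           invertible Uplus \<and> invertible Uminus \<and> Uplus = Uminus ** H j k"
    by (rule RH' [OF assms(1), THEN conjunct2, THEN conjunct2, THEN conjunct1])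
  from bspec[OF bspec[OF this assms(2)] assms(3)] show ?thesis .
qed

lemma U_tip:
  assumes "b \<in> imag_ray" "j \<in> {1..p}" "\<kappa> j + b \<notin> Z"
  shows "leading_term_at (\<kappa> j + b) (cut_union p \<kappa> b)
             (\<chi> i. lf j (\<kappa> j + b) $ i / (2 * of_real pi * \<i>)) P (U b)"
proof -
  have "\<forall>j\<in>{1..p}. \<kappa> j + b \<notin> Z \<longrightarrow>
           leading_term_at (\<kappa> j + b) (cut_union p \<kappa> b)
             (\<chi> i. lf j (\<kappa> j + b) $ i / (2 * of_real pi * \<i>)) P (U b)"
    by (rule RH' [OF assms(1), THEN conjunct2, THEN conjunct2, THEN conjunct2, THEN conjunct2])
  from mp[OF bspec[OF this assms(2)] assms(3)] show ?thesis .
qed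

lemma U_deriv:
  assumes "b \<in> imag_ray" "\<And>b. b \<in> imag_ray \<Longrightarrow> k \<notin> cut_union p \<kappa> b"
  shows "mat_deriv (\<lambda>b. U b k) (A b k ** U b k) (at b within imag_ray)"
proof -
  have "k \<in> - cut_union p \<kappa> b"
    using assms by simp
  from bspec[OF bspec[OF ode[unfolded ODE1_def] assms(1)] this] show ?thesis
    unfolding mat_deriv_def A_def .
qed

text \<open>The Lax equation: \<open>B\<close> is constant in \<open>b\<close>, \<open>U\<close>
  contributes \<open>A\<close> on the left, and its inverse contributes \<open>A\<close> on the
  right with a minus sign.\<close>

lemma M_deriv:
  assumes "b \<in> imag_ray" "k \<in> X"
  shows "mat_deriv (\<lambda>b. M b k) (commutator (A b k) (M b k)) (at b within imag_ray)"
proof -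
  have off: "k \<notin> cut_union p \<kappa> c" if "c \<in> imag_ray" for c
    by (rule X_cut[OF assms(2) that])
  have U: "mat_deriv (\<lambda>b. U b k) (A b k ** U b k) (at b within imag_ray)"
    by (rule U_deriv[OF assms(1) off])
  have Ui: "mat_deriv (\<lambda>b. matrix_inv (U b k))
      (- (matrix_inv (U b k) ** (A b k ** U b k) ** matrix_inv (U b k))) (at b within imag_ray)"
    by (rule mat_deriv_inv[OF U assms(1)]) (rule U_inv[OF _ off])
  have inv: "invertible (U b k)"
    by (rule U_inv[OF assms(1) off[OF assms(1)]])
  have "mat_deriv (\<lambda>b. M b k) ((A b k ** U b k ** B k + U b k ** 0) ** matrix_inv (U b k) +
      U b k ** B k ** (- (matrix_inv (U b k) ** (A b k ** U b k) ** matrix_inv (U b k))))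
      (at b within imag_ray)"
    unfolding M_def by (rule mat_deriv_mult[OF mat_deriv_mult[OF U mat_deriv_const] Ui])
  also have "(A b k ** U b k ** B k + U b k ** 0) ** matrix_inv (U b k) +
      U b k ** B k ** (- (matrix_inv (U b k) ** (A b k ** U b k) ** matrix_inv (U b k))) =
      commutator (A b k) (M b k)"
    using inv by (simp add: matrix_mult_zero_right matrix_mult_minus_right commutator_def M_def matrix_mul_assoc)
  finally show ?thesis .
qed

lemmas matB' = matB [unfolded matrix_B_def]

lemmas rho_inj = matB' [THEN conjunct1]
lemmas B_hol = matB' [THEN conjunct2, THEN conjunct2, THEN conjunct1]
lemmas B_pole = matB' [THEN conjunct2, THEN conjunct2, THEN conjunct2, THEN conjunct1]
lemmas B_inf = matB' [THEN conjunct2, THEN conjunct2, THEN conjunct2, THEN conjunct2, THEN conjunct1]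
lemmas B_comm = matB' [THEN conjunct2, THEN conjunct2, THEN conjunct2, THEN conjunct2, THEN conjunct2, THEN conjunct1]
lemmas B_diag = matB' [THEN conjunct2, THEN conjunct2, THEN conjunct2, THEN conjunct2, THEN conjunct2, THEN conjunct2]

lemma B_tendsto: "a \<notin> \<rho> ` {1..d} \<Longrightarrow> (B \<longlongrightarrow> B a) (at a within S)"
  by (rule mat_holomorphic_tendsto[OF B_hol open_Compl[OF finite_imp_closed]]) simp_all

lemma q_hol: "q holomorphic_on S"
  unfolding q_def by (intro holomorphic_intros)

lemma q_tendsto: "(q \<longlongrightarrow> q a) (at a within S)"
proof -
  have "isCont q a"
    using holomorphic_on_imp_continuous_on[OF q_hol[of UNIV]] by (simp add: continuous_on_eq_continuous_at)
  then show ?thesis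
    using continuous_at_imp_continuous_at_within continuous_within by blast
qed

text \<open>At a pole one factor of \<open>q\<close> cancels it, and the remaining factors are
  continuous.\<close>

lemma qB_limit: "\<exists>C. ((\<lambda>k. mat (q k) ** B k) \<longlongrightarrow> C) (at a within S)"
proof (cases "a \<in> \<rho> ` {1..d}")
  case False
  have "((\<lambda>k. mat (q k) ** B k) \<longlongrightarrow> mat (q a) ** B a) (at a within S)"
    using tendsto_matrixD[OF B_tendsto[OF False]]
    by (intro tendsto_matrixI) (auto intro!: tendsto_mult q_tendsto)
  then show ?thesis
    by blast
next
  case True
  then obtain l where l: "l \<in> {1..d}" "a = \<rho> l"
    by blast
  obtain C where C: "((\<lambda>k. mat (k - a) ** B k) \<longlongrightarrow> C) (at a)"
    using bspec[OF B_pole l(1)] l(2) by blast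
  define c where "c = (\<Prod>a'\<in>\<rho> ` {1..d} - {a}. a - a')"
  have qk: "q k = (\<Prod>a'\<in>\<rho> ` {1..d} - {a}. k - a') * (k - a)" for k
    unfolding q_def using True by (simp add: prod.remove[of _ a])
  have "((\<lambda>k. \<Prod>a'\<in>\<rho> ` {1..d} - {a}. k - a') \<longlongrightarrow> c) (at a within S)"
    unfolding c_def by (intro tendsto_prod tendsto_diff tendsto_const tendsto_ident_at)
  moreover have "((\<lambda>k. (k - a) * B k $ i $ j) \<longlongrightarrow> C $ i $ j) (at a within S)" for i j
    using Lim_at_imp_Lim_at_within[OF tendsto_matrixD[OF C, of i j], of S] by simp
  ultimately have "((\<lambda>k. (\<Prod>a'\<in>\<rho> ` {1..d} - {a}. k - a') * ((k - a) * B k $ i $ j)) \<longlongrightarrow>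
      c * C $ i $ j) (at a within S)" for i j
    by (intro tendsto_mult) auto
  then have "((\<lambda>k. mat (q k) ** B k) \<longlongrightarrow> mat c ** C) (at a within S)"
    by (intro tendsto_matrixI) (simp add: qk mult.assoc)
  then show ?thesis
    by blast
qed

lemma BH_commute:
  assumes "j \<in> {1..p}" "k \<in> strip_at \<epsilon> (\<kappa> j)" "k \<notin> \<rho> ` {1..d}"
  shows "B k ** H j k = H j k ** B k"
proof -
  have "\<forall>k\<in>strip_at \<epsilon> (\<kappa> j) - \<rho> ` {1..d}. B k ** H j k = H j k ** B k"
    by (rule mp[OF spec[OF spec[OF bspec[OF B_comm assms(1)]]] continuation.base])
  then show ?thesis
    using assms(2,3) by blast
qed

text \<open>On a cut the limits from both shores agree because the limit \<open>C\<close> of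
  \<open>q\<close> times \<open>B\<close> commutes with the jump; at a tip the singular factor of
  \<open>U\<close> is diagonal in the eigenvector basis, where \<open>B\<close> is diagonal too, and
  drops out of the conjugation. A pole of \<open>B\<close> may lie on a cut or at a tip, which is
  why \<open>C\<close> replaces a value of \<open>B\<close>.\<close>

lemma qM_limit:
  assumes b: "b \<in> imag_ray" and Z: "\<And>j. j \<in> {1..p} \<Longrightarrow> \<kappa> j + b \<notin> Z"
  shows "\<exists>L. ((\<lambda>k. U b k ** (mat (q k) ** B k) ** matrix_inv (U b k)) \<longlongrightarrow> L) (at a within X)"
proof -
  obtain C where C: "((\<lambda>k. mat (q k) ** B k) \<longlongrightarrow> C) (at a)"
    using qB_limit[of a UNIV] by blast
  then have CS: "((\<lambda>k. mat (q k) ** B k) \<longlongrightarrow> C) (at a within S)" for S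
    using Lim_at_imp_Lim_at_within by blast
  show ?thesis
  proof (cases "a \<in> cut_union p \<kappa> b")
    case False
    have "(U b \<longlongrightarrow> U b a) (at a within X)"
      using False closed_cut_union[of p \<kappa> b] by (intro mat_holomorphic_tendsto[OF U_hol[OF b]]) auto
    then have "((\<lambda>k. U b k ** (mat (q k) ** B k) ** matrix_inv (U b k)) \<longlongrightarrow>
        U b a ** C ** matrix_inv (U b a)) (at a within X)"
      using U_inv[OF b False] by (intro tendsto_matrix_mult tendsto_matrix_inv CS)
    then show ?thesis
      by blast
  next
    case True
    then obtain j where j: "j \<in> {1..p}" "a = \<kappa> j + b \<or> a \<in> cut (\<kappa> j + b)"
      by (auto simp: cut_union_def)
    have cut: "a \<in> cut (\<kappa> j)"
      using j(2) tip_in_cut cut_in_cut b by blast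
    have aL: "Re a \<in> lines"
      using j b cut by (auto simp: lines_def cut_def)
    show ?thesis
      using j(2)
    proof
      assume a: "a \<in> cut (\<kappa> j + b)"
      obtain Up Um where Up: "(U b \<longlongrightarrow> Up) (at a within right_side a)" "invertible Up"
        and Um: "(U b \<longlongrightarrow> Um) (at a within left_side a)" "invertible Um"
        and jump: "Up = Um ** H j a"
        using U_shores[OF b j(1) a] by (elim exE conjE)
      have strip: "a \<in> strip_at \<epsilon> (\<kappa> j)"
        using cut cut_strip by blast
      \<comment> \<open>As \<open>a\<close> may be a pole of \<open>B\<close>, commutation of
        \<open>C\<close> with \<open>H j a\<close> is obtained as a limit from points of the strip
        off the lines, where \<open>B\<close> commutes with the continuation of
        \<open>H j\<close>.\<close>
      have lim: "((\<lambda>k. (mat (q k) ** B k) ** H j k) \<longlongrightarrow> C ** H j a) (at a within X)"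
          "((\<lambda>k. H j k ** (mat (q k) ** B k)) \<longlongrightarrow> H j a ** C) (at a within X)"
        by (intro tendsto_matrix_mult CS mat_holomorphic_tendsto[OF H_hol[OF j(1)] open_strip strip])+
      have "\<forall>\<^sub>F k in nhds a. k \<in> strip_at \<epsilon> (\<kappa> j)"
        by (rule eventually_nhds_in_open[OF open_strip strip])
      then have ev: "\<forall>\<^sub>F k in at a within X. (mat (q k) ** B k) ** H j k = H j k ** (mat (q k) ** B k)"
        unfolding eventually_at_filter
      proof eventually_elim
        case (elim k)
        have "H j k ** (mat (q k) ** B k) = mat (q k) ** (H j k ** B k)"
          by (simp only: matrix_mul_assoc mat_commute[of "H j k"])
        then show ?case
          using BH_commute[OF j(1) elim] X_rho by (auto simp: matrix_mul_assoc[symmetric])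
      qed
      have HC: "C ** H j a = H j a ** C"
        using tendsto_unique[OF X_dense Lim_transform_eventually[OF lim(1) ev] lim(2)] .
      have "matrix_inv Um ** Up = H j a"
        using Um(2) by (simp add: jump matrix_mul_assoc matrix_inv_left)
      then have H: "invertible (H j a)"
        using invertible_mult[OF invertible_matrix_inv[OF Um(2)] Up(2)] by simp
      have "Up ** C ** matrix_inv Up = Um ** (H j a ** C) ** matrix_inv (H j a) ** matrix_inv Um"
        using H Um(2) by (simp add: jump matrix_inv_mult matrix_mul_assoc)
      also have "\<dots> = Um ** C ** matrix_inv Um"
        using H by (simp add: HC[symmetric] matrix_mul_assoc)
      finally have eq: "Up ** C ** matrix_inv Up = Um ** C ** matrix_inv Um" .
      have "((\<lambda>k. U b k ** (mat (q k) ** B k) ** matrix_inv (U b k)) \<longlongrightarrow> Up ** C ** matrix_inv Up)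
          (at a within right_side a)"
        using Up by (intro tendsto_matrix_mult tendsto_matrix_inv CS)
      moreover have "((\<lambda>k. U b k ** (mat (q k) ** B k) ** matrix_inv (U b k)) \<longlongrightarrow> Up ** C ** matrix_inv Up)
          (at a within left_side a)"
        unfolding eq using Um by (intro tendsto_matrix_mult tendsto_matrix_inv CS)
      ultimately show ?thesis
        using tendsto_off_lines_shores[OF aL] unfolding X_def by blast
    next
      assume a: "a = \<kappa> j + b"
      define e :: "complex^'n" where "e = (\<chi> i. lf j (\<kappa> j + b) $ i / (2 * of_real pi * \<i>))"
      have "a \<in> W"
        using cut_W j(1) cut Z a by blast
      have lead: "leading_term_at a (cut_union p \<kappa> b) e P (U b)"
        using U_tip[OF b j(1) Z[OF j(1)]] by (simp add: a e_def)
      have Xsub: "X \<subseteq> - cut_union p \<kappa> b"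
        using X_cut b by blast
      obtain K Y where K: "invertible K" and Y: "(Y \<longlongrightarrow> mat 1) (at a within X)"
        and UP: "\<And>k. k \<in> W \<Longrightarrow> U b k ** P k = Y k ** K ** diag_power (k - a) e"
        using leading_term_at_factorization[OF lead inv_P Xsub] by blast
      have P: "(P \<longlongrightarrow> P a) (at a within X)"
        by (rule mat_holomorphic_tendsto[OF P_hol open_W \<open>a \<in> W\<close>])
      have PC: "((\<lambda>k. matrix_inv (P k) ** (mat (q k) ** B k) ** P k) \<longlongrightarrow>
          matrix_inv (P a) ** C ** P a) (at a within X)"
        by (rule tendsto_matrix_mult[OF tendsto_matrix_mult[OF
              tendsto_matrix_inv[OF P bspec[OF inv_P \<open>a \<in> W\<close>]] CS] P])
      have inv1: "invertible (mat 1 :: complex^'n^'n)"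
        by (simp add: invertible_det_nz det_I)
      have limY: "((\<lambda>k. Y k ** K ** (matrix_inv (P k) ** (mat (q k) ** B k) ** P k) ** matrix_inv K ** matrix_inv (Y k))
          \<longlongrightarrow> mat 1 ** K ** (matrix_inv (P a) ** C ** P a) ** matrix_inv K ** matrix_inv (mat 1)) (at a within X)"
        by (rule tendsto_matrix_mult[OF tendsto_matrix_mult[OF tendsto_matrix_mult[OF
              tendsto_matrix_mult[OF Y tendsto_const] PC] tendsto_const] tendsto_matrix_inv[OF Y inv1]])
      have "\<forall>\<^sub>F k in at a within X.
          Y k ** K ** (matrix_inv (P k) ** (mat (q k) ** B k) ** P k) ** matrix_inv K ** matrix_inv (Y k)
          = U b k ** (mat (q k) ** B k) ** matrix_inv (U b k)"
      proof -
        have "\<forall>\<^sub>F k in nhds a. k \<in> W"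
          by (rule eventually_nhds_in_open[OF open_W \<open>a \<in> W\<close>])
        then have "\<forall>\<^sub>F k in at a within X. k \<in> W \<and> k \<in> X"
          unfolding eventually_at_filter by eventually_elim simp
        moreover have "\<forall>\<^sub>F k in at a within X. invertible (Y k)"
          by (rule eventually_invertible[OF Y inv1])
        ultimately show ?thesis
        proof eventually_elim
          case (elim k)
          define D where "D = diag_power (k - a) e"
          have inv: "invertible (P k)" "invertible (Y k)" "invertible D" "invertible K"
            using inv_P elim diag_power_invertible K by (auto simp: D_def)
          obtain v where "B k = P k ** diag_mat v ** matrix_inv (P k)"
            using B_diag X_rho elim by blast
          then have "matrix_inv (P k) ** (mat (q k) ** B k) ** P k =
              matrix_inv (P k) ** mat (q k) ** P k ** diag_mat v"
            using inv(1) by (simp add: matrix_mul_assoc)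
          also have "\<dots> = diag_mat (\<chi> i. q k * v $ i)"
          proof -
            have "matrix_inv (P k) ** mat (q k) ** P k = mat (q k)"
              using inv(1) by (simp only: mat_commute[of "matrix_inv (P k)"] mult_inv_cancel)
            then show ?thesis
              by (intro matrix_eqI) (simp add: diag_mat_entry mat_entry)
          qed
          finally obtain u where u: "matrix_inv (P k) ** (mat (q k) ** B k) ** P k = diag_mat u"
            by blast
          have "U b k = U b k ** P k ** matrix_inv (P k)"
            using inv(1) by simp
          also have "\<dots> = Y k ** K ** D ** matrix_inv (P k)"
            using UP elim by (simp add: D_def)
          finally have Uk: "U b k = Y k ** K ** D ** matrix_inv (P k)" .
          then have Ui: "matrix_inv (U b k) = P k ** matrix_inv D ** matrix_inv K ** matrix_inv (Y k)"
            using inv by (simp add: matrix_inv_mult invertible_mult invertible_matrix_inv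
                matrix_inv_inv matrix_mul_assoc)
          have "U b k ** (mat (q k) ** B k) ** matrix_inv (U b k) = Y k ** K ** (D **
              (matrix_inv (P k) ** (mat (q k) ** B k) ** P k) ** matrix_inv D) ** matrix_inv K ** matrix_inv (Y k)"
            unfolding Uk Ui[unfolded Uk] by (simp only: matrix_mul_assoc)
          \<comment> \<open>Diagonal matrices commute, so the possibly unbounded powers disappear
            before the limit is taken.\<close>
          also have "D ** (matrix_inv (P k) ** (mat (q k) ** B k) ** P k) ** matrix_inv D = diag_mat u"
            unfolding u D_def diag_power_commute using inv(3) by (simp add: D_def)
          finally show ?case
            by (simp only: u)
        qed
      qed
      with limY have "((\<lambda>k. U b k ** (mat (q k) ** B k) ** matrix_inv (U b k)) \<longlongrightarrow>
          mat 1 ** K ** (matrix_inv (P a) ** C ** P a) ** matrix_inv K ** matrix_inv (mat 1)) (at a within X)"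
        by (rule Lim_transform_eventually)
      then show ?thesis
        by (rule exI)
    qed
  qed
qed

end

section \<open>Commutators of sums and scalar multiples\<close>

lemma matrix_sum_left: "(\<Sum>i\<in>I. f i) ** C = (\<Sum>i\<in>I. f i ** C)"
  for f :: "'i \<Rightarrow> 'n::finite cmat" and C :: "'n cmat"
  by (rule matrix_eqI) (simp add: matrix_mult_entry sum_distrib_right sum.swap[of _ I])

lemma matrix_sum_right: "C ** (\<Sum>i\<in>I. f i) = (\<Sum>i\<in>I. C ** f i)"
  for f :: "'i \<Rightarrow> 'n::finite cmat" and C :: "'n cmat"
  by (rule matrix_eqI) (simp add: matrix_mult_entry sum_distrib_left sum.swap[of _ I])

lemma commutator_sum_left: "commutator (\<Sum>i\<in>I. f i) C = (\<Sum>i\<in>I. commutator (f i) C)"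
  by (simp add: commutator_def matrix_sum_left matrix_sum_right sum_subtractf)

lemma commutator_sum_right: "commutator C (\<Sum>i\<in>I. f i) = (\<Sum>i\<in>I. commutator C (f i))"
  by (simp add: commutator_def matrix_sum_left matrix_sum_right sum_subtractf)

lemma matrix_add_rdistrib: "(A + B) ** C = A ** C + B ** C" for A B C :: "'n::finite cmat"
  by (rule matrix_eqI) (simp add: matrix_mult_entry distrib_right sum.distrib)

lemma commutator_1_add: "commutator C (mat 1 + Y) = commutator C Y"
proof -
  have "(mat 1 + Y) ** C = C + Y ** C"
    by (simp add: matrix_add_rdistrib)
  then show ?thesis
    by (simp add: commutator_def matrix_add_ldistrib)
qed

lemma commutator_scale: "commutator (mat a ** S) (mat c ** R) = mat (a * c) ** commutator S R"
proof -
  have *: "mat a ** S ** (mat c ** R) = mat (a * c) ** (S ** R)" for a c and S R :: "'n::finite cmat"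
  proof -
    have "mat a ** S ** (mat c ** R) = mat a ** (S ** mat c) ** R"
      by (simp only: matrix_mul_assoc)
    also have "\<dots> = mat a ** mat c ** (S ** R)"
      by (simp only: mat_commute[of S] matrix_mul_assoc)
    also have "mat a ** mat c = (mat (a * c) :: 'n cmat)"
      by (rule matrix_eqI) (simp add: mat_entry)
    finally show ?thesis .
  qed
  show ?thesis
    unfolding commutator_def * by (simp add: matrix_diff_ldistrib mult.commute)
qed

lemma tendsto_fraction_at_infinity: "((\<lambda>k. r / (k - a)) \<longlongrightarrow> 0) at_infinity" for r a :: complex
proof -
  have "filterlim (\<lambda>k. - a + k) at_infinity at_infinity"
    by (rule tendsto_add_filterlim_at_infinity[OF tendsto_const filterlim_ident])
  then have "((\<lambda>k. r / (- a + k)) \<longlongrightarrow> 0) at_infinity"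
    by (rule tendsto_divide_0[OF tendsto_const])
  then show ?thesis
    by simp
qed

context rh_setting
begin

section \<open>The expansion of \<open>M\<close> in simple fractions\<close>

lemma infinite_X: "infinite X"
  using X_dense[of 0] islimpt_finite by (auto simp: trivial_limit_within)

lemma q_nonzero: "k \<in> X \<Longrightarrow> q k \<noteq> 0"
  using X_rho by (auto simp: q_def)

lemma X_subset: "b \<in> imag_ray \<Longrightarrow> X \<subseteq> - cut_union p \<kappa> b"
  using X_cut by blast

lemma M_inf:
  assumes "b \<in> imag_ray"
  shows "(M b \<longlongrightarrow> mat 1) (inf at_infinity (principal X))"
proof -
  have U: "(U b \<longlongrightarrow> mat 1) (inf at_infinity (principal X))"
    by (rule tendsto_mono[OF _ U_inf[OF assms]]) (use X_subset[OF assms] in \<open>simp add: inf.coboundedI2\<close>)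
  have B: "(B \<longlongrightarrow> mat 1) (inf at_infinity (principal X))"
    by (rule tendsto_mono[OF inf_le1 B_inf])
  have "invertible (mat 1 :: complex^'n^'n)"
    by (simp add: invertible_det_nz det_I)
  then have "((\<lambda>k. U b k ** B k ** matrix_inv (U b k)) \<longlongrightarrow> mat 1 ** mat 1 ** matrix_inv (mat 1))
      (inf at_infinity (principal X))"
    by (rule tendsto_matrix_mult[OF tendsto_matrix_mult[OF U B] tendsto_matrix_inv[OF U]])
  moreover have "matrix_inv (mat 1) = (mat 1 :: complex^'n^'n)"
    by (rule matrix_inv_eqI) simp
  ultimately show ?thesis
    unfolding M_def [abs_def] by simp
qed

text \<open>The entry of \<open>q\<close> times \<open>M\<close> continues to an entire function,
  and division by \<open>q\<close> leaves an entire part \<open>h\<close> besides the fractions. Off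
  the lines the fractions vanish at infinity while \<open>M\<close> has a limit, which forces
  \<open>h\<close> to be constant.\<close>

lemma M_rep_entry:
  assumes b: "b \<in> imag_ray" and Z: "\<And>j. j \<in> {1..p} \<Longrightarrow> \<kappa> j + b \<notin> Z"
  shows "\<exists>r. \<forall>k\<in>X. M b k $ m $ n = mat 1 $ m $ n + (\<Sum>a\<in>\<rho> ` {1..d}. r a / (k - a))"
proof -
  define N where "N k = U b k ** (mat (q k) ** B k) ** matrix_inv (U b k)" for k
  have qN: "N k $ m $ n = q k * M b k $ m $ n" for k
  proof -
    have "N k = mat (q k) ** M b k"
      by (simp only: N_def M_def matrix_mul_assoc mat_commute[of "U b k"])
    then show ?thesis
      by simp
  qed
  have qB: "mat_holomorphic_on (\<lambda>k. mat (q k) ** B k) X"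
    using mat_holomorphic_subset[OF B_hol, of X] X_rho q_hol
    by (auto simp: mat_holomorphic_on_def intro!: holomorphic_on_mult)
  have U: "mat_holomorphic_on (U b) X"
    by (rule mat_holomorphic_subset[OF U_hol[OF b] X_subset[OF b]])
  have "mat_holomorphic_on (\<lambda>k. matrix_inv (U b k)) X"
    by (rule mat_holomorphic_inv[OF U]) (rule U_inv[OF b X_cut[OF _ b]])
  then have "mat_holomorphic_on N X"
    unfolding N_def by (rule mat_holomorphic_mult[OF mat_holomorphic_mult[OF U qB]])
  then have hol: "(\<lambda>k. N k $ m $ n) holomorphic_on UNIV \<inter> off_lines lines"
    by (simp add: mat_holomorphic_on_def X_def)
  have "\<exists>l. ((\<lambda>k. N k $ m $ n) \<longlongrightarrow> l) (at a within off_lines lines)" for a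
  proof -
    obtain L where "(N \<longlongrightarrow> L) (at a within X)"
      using qM_limit[OF b Z] unfolding N_def by blast
    from tendsto_matrixD[OF this, of m n] show ?thesis
      unfolding X_def by blast
  qed
  from holomorphic_extension_across_lines[OF finite_lines open_UNIV hol this]
  obtain g where g: "g holomorphic_on UNIV"
    and gN: "\<forall>k\<in>UNIV \<inter> off_lines lines. g k = N k $ m $ n"
    by blast
  have "finite (\<rho> ` {1..d})"
    by simp
  from entire_partial_fractions[OF this g] obtain h r where h: "h holomorphic_on UNIV"
    and hr: "\<forall>z. z \<notin> \<rho> ` {1..d} \<longrightarrow>
      g z / (\<Prod>a\<in>\<rho> ` {1..d}. z - a) = h z + (\<Sum>a\<in>\<rho> ` {1..d}. r a / (z - a))"
    by blast
  have Mr: "M b k $ m $ n = h k + (\<Sum>a\<in>\<rho> ` {1..d}. r a / (k - a))" if "k \<in> X" for k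
  proof -
    have "g k = q k * M b k $ m $ n"
      using bspec[OF gN, of k] that by (simp add: qN X_def)
    moreover have "g k / q k = h k + (\<Sum>a\<in>\<rho> ` {1..d}. r a / (k - a))"
      using mp[OF spec[OF hr] X_rho[OF that]] by (simp only: q_def)
    ultimately show ?thesis
      using q_nonzero[OF that] by simp
  qed
  have frac: "((\<lambda>k. \<Sum>a\<in>\<rho> ` {1..d}. r a / (k - a)) \<longlongrightarrow> (\<Sum>a\<in>\<rho> ` {1..d}. 0))
      (inf at_infinity (principal X))"
    by (intro tendsto_sum tendsto_mono[OF inf_le1 tendsto_fraction_at_infinity])
  have "((\<lambda>k. M b k $ m $ n - (\<Sum>a\<in>\<rho> ` {1..d}. r a / (k - a))) \<longlongrightarrow> mat 1 $ m $ n - (\<Sum>a\<in>\<rho> ` {1..d}. 0))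
      (inf at_infinity (principal X))"
    by (rule tendsto_diff[OF tendsto_matrixD[OF M_inf[OF b]] frac])
  moreover have "\<forall>\<^sub>F k in inf at_infinity (principal X).
      M b k $ m $ n - (\<Sum>a\<in>\<rho> ` {1..d}. r a / (k - a)) = h k"
    unfolding eventually_inf_principal by (intro always_eventually allI impI) (simp add: Mr)
  ultimately have "(h \<longlongrightarrow> mat 1 $ m $ n - (\<Sum>a\<in>\<rho> ` {1..d}. 0)) (inf at_infinity (principal X))"
    by (rule Lim_transform_eventually)
  then have "h k = mat 1 $ m $ n" for k
    using Liouville_off_lines[OF finite_lines h] unfolding X_def by simp
  then show ?thesis
    using Mr by auto
qed

lemma M_rep_generic:
  assumes b: "b \<in> imag_ray" and Z: "\<And>j. j \<in> {1..p} \<Longrightarrow> \<kappa> j + b \<notin> Z"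
  shows "\<exists>r. \<forall>k\<in>X. M b k = mat 1 + (\<Sum>l=1..d. mat (1 / (k - \<rho> l)) ** r l)"
proof -
  have "\<forall>m n. \<exists>r. \<forall>k\<in>X. M b k $ m $ n = mat 1 $ m $ n + (\<Sum>a\<in>\<rho> ` {1..d}. r a / (k - a))"
    using M_rep_entry[OF b Z] by blast
  then obtain R where R: "\<And>m n k. k \<in> X \<Longrightarrow>
      M b k $ m $ n = mat 1 $ m $ n + (\<Sum>a\<in>\<rho> ` {1..d}. R m n a / (k - a))"
    unfolding choice_iff by blast
  have "M b k = mat 1 + (\<Sum>l=1..d. mat (1 / (k - \<rho> l)) ** (\<chi> m n. R m n (\<rho> l)))" if "k \<in> X" for k
    by (rule matrix_eqI) (simp add: R[OF that] sum.reindex[OF rho_inj] del: One_nat_def)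
  then show ?thesis
    by (intro exI[of _ "\<lambda>l. \<chi> m n. R m n (\<rho> l)"]) blast
qed

section \<open>The residues as functions of \<open>b\<close>\<close>

definition "exceptional = {b. \<exists>j\<in>{1..p}. \<kappa> j + b \<in> Z}"

lemma finite_exceptional: "finite exceptional"
proof -
  have "exceptional = (\<Union>j\<in>{1..p}. (\<lambda>b. \<kappa> j + b) -` Z)"
    by (auto simp: exceptional_def)
  moreover have "finite ((\<lambda>b. \<kappa> j + b) -` Z)" for j
    by (rule finite_vimageI[OF finite_Z]) simp
  ultimately show ?thesis
    by simp
qed

lemma exceptional_dense: "b \<in> imag_ray \<Longrightarrow> at b within (imag_ray - exceptional) \<noteq> bot"
  by (rule imag_ray_dense[OF finite_exceptional])

text \<open>Includes the exceptional parameters, for which the expansion is reached only by a limit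
  in \<open>b\<close>.\<close>

definition "M_residues r \<longleftrightarrow>
  (\<forall>b\<in>imag_ray. \<forall>k\<in>X. M b k = mat 1 + (\<Sum>l=1..d. mat (1 / (k - \<rho> l)) ** r l b))"

lemma M_residuesD: "M_residues r \<Longrightarrow> b \<in> imag_ray \<Longrightarrow> k \<in> X \<Longrightarrow>
    M b k = mat 1 + (\<Sum>l=1..d. mat (1 / (k - \<rho> l)) ** r l b)"
  by (simp add: M_residues_def)

lemma residues_exist:
  "\<exists>r. M_residues r \<and> (\<forall>b\<in>imag_ray. \<forall>l. \<exists>D. mat_deriv (r l) D (at b within imag_ray))"
proof -
  have "\<exists>S c. l \<in> {1..d} \<longrightarrow> finite S \<and> S \<subseteq> X \<and>
      (\<forall>m\<in>{1..d}. (\<Sum>x\<in>S. c x / (x - \<rho> m)) = (if m = l then 1 else 0))" for l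
  proof (cases "l \<in> {1..d}")
    case True
    have "finite (\<rho> ` {1..d})" "\<rho> l \<in> \<rho> ` {1..d}"
      using True by auto
    from dual_system_exists[OF this infinite_X] obtain S c where S: "finite S" "S \<subseteq> X - \<rho> ` {1..d}"
      "\<And>b. b \<in> \<rho> ` {1..d} \<Longrightarrow> (\<Sum>x\<in>S. c x / (x - b)) = (if b = \<rho> l then 1 else 0)"
      by blast
    have "\<forall>m\<in>{1..d}. (\<Sum>x\<in>S. c x / (x - \<rho> m)) = (if m = l then 1 else 0)"
      using S(3) inj_on_eq_iff[OF rho_inj _ True] by auto
    then show ?thesis
      using S(1,2) by blast
  qed auto
  then obtain S c where S: "\<And>l. l \<in> {1..d} \<Longrightarrow> finite (S l)" "\<And>l. l \<in> {1..d} \<Longrightarrow> S l \<subseteq> X"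
    and c: "\<And>l m. l \<in> {1..d} \<Longrightarrow> m \<in> {1..d} \<Longrightarrow>
      (\<Sum>x\<in>S l. c l x / (x - \<rho> m)) = (if m = l then 1 else 0)"
    by metis
  \<comment> \<open>The points of \<open>S l\<close> and the weights \<open>c l\<close> do not
    depend on \<open>b\<close>, so \<open>r l\<close> is differentiable along with the values of
    \<open>M\<close>. The value \<open>0\<close> outside \<open>1..d\<close> keeps the derivative
    claim true for all \<open>l\<close>.\<close>
  define r where "r l b = (if l \<in> {1..d} then \<Sum>x\<in>S l. mat (c l x) ** (M b x - mat 1) else 0)" for l b
  have deriv: "\<exists>D. mat_deriv (r l) D (at b within imag_ray)" if b: "b \<in> imag_ray" for b l
  proof (cases "l \<in> {1..d}")
    case True
    have "mat_deriv (\<lambda>b. \<Sum>x\<in>S l. mat (c l x) ** (M b x - mat 1))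
        (\<Sum>x\<in>S l. 0 ** (M b x - mat 1) + mat (c l x) ** (commutator (A b x) (M b x) - 0))
        (at b within imag_ray)"
    proof (rule mat_deriv_sum)
      fix x assume "x \<in> S l"
      then have "x \<in> X"
        using S(2)[OF True] by blast
      then show "mat_deriv (\<lambda>b. mat (c l x) ** (M b x - mat 1))
          (0 ** (M b x - mat 1) + mat (c l x) ** (commutator (A b x) (M b x) - 0))
          (at b within imag_ray)"
        by (rule mat_deriv_mult[OF mat_deriv_const mat_deriv_diff[OF M_deriv[OF b] mat_deriv_const]])
    qed
    moreover have "r l = (\<lambda>b. \<Sum>x\<in>S l. mat (c l x) ** (M b x - mat 1))"
      using True by (simp add: r_def fun_eq_iff)
    ultimately show ?thesis
      by metis
  next
    case False
    then have "r l = (\<lambda>b. 0)"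
      by (intro ext) (simp only: r_def if_False)
    then show ?thesis
      using mat_deriv_const by metis
  qed
  have generic: "M b k = mat 1 + (\<Sum>l=1..d. mat (1 / (k - \<rho> l)) ** r l b)"
    if b: "b \<in> imag_ray - exceptional" and k: "k \<in> X" for b k
  proof -
    have "b \<in> imag_ray" "\<And>j. j \<in> {1..p} \<Longrightarrow> \<kappa> j + b \<notin> Z"
      using b by (auto simp: exceptional_def)
    from M_rep_generic[OF this] obtain r' where
      r': "\<And>k. k \<in> X \<Longrightarrow> M b k = mat 1 + (\<Sum>l=1..d. mat (1 / (k - \<rho> l)) ** r' l)"
      by blast
    \<comment> \<open>The weights are dual to the fractions, so whatever residues represent
      \<open>M\<close> at this \<open>b\<close>, the weighted sum returns them.\<close>
    have "r l b = r' l" if l: "l \<in> {1..d}" for l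
    proof (rule matrix_eqI)
      fix m n
      have "r l b $ m $ n = (\<Sum>x\<in>S l. c l x * (\<Sum>i=1..d. 1 / (x - \<rho> i) * r' i $ m $ n))"
        using l S(2)[OF l] by (simp add: r_def) (intro sum.cong, auto simp: r')
      also have "\<dots> = (\<Sum>x\<in>S l. \<Sum>i=1..d. c l x / (x - \<rho> i) * r' i $ m $ n)"
        by (simp add: sum_distrib_left)
      also have "\<dots> = (\<Sum>i=1..d. \<Sum>x\<in>S l. c l x / (x - \<rho> i) * r' i $ m $ n)"
        by (rule sum.swap)
      also have "\<dots> = (\<Sum>i=1..d. (if i = l then 1 else 0) * r' i $ m $ n)"
      proof (rule sum.cong[OF refl])
        fix i assume i: "i \<in> {1..d}"
        have "(\<Sum>x\<in>S l. c l x / (x - \<rho> i) * r' i $ m $ n) = (\<Sum>x\<in>S l. c l x / (x - \<rho> i)) * r' i $ m $ n"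
          by (simp only: sum_distrib_right)
        then show "(\<Sum>x\<in>S l. c l x / (x - \<rho> i) * r' i $ m $ n) = (if i = l then 1 else 0) * r' i $ m $ n"
          by (simp only: c[OF l i])
      qed
      also have "\<dots> = r' l $ m $ n"
        using l by (simp add: if_distrib if_distribR sum.delta cong: if_cong)
      finally show "r l b $ m $ n = r' l $ m $ n" .
    qed
    then show ?thesis
      using r'[OF k] by simp
  qed
  \<comment> \<open>Both sides are continuous in \<open>b\<close> along the ray and agree off the
    finitely many exceptional parameters.\<close>
  have "M b k = mat 1 + (\<Sum>l=1..d. mat (1 / (k - \<rho> l)) ** r l b)"
    if b: "b \<in> imag_ray" and k: "k \<in> X" for b k
  proof (rule tendsto_unique[OF exceptional_dense[OF b]])
    show "((\<lambda>b. M b k) \<longlongrightarrow> M b k) (at b within (imag_ray - exceptional))"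
      using mat_deriv_tendsto[OF M_deriv[OF b k]] by (rule tendsto_within_subset) blast
    have "(r l \<longlongrightarrow> r l b) (at b within (imag_ray - exceptional))" for l
    proof -
      obtain D where "mat_deriv (r l) D (at b within imag_ray)"
        using deriv[OF b] by blast
      from mat_deriv_tendsto[OF this] show ?thesis
        by (rule tendsto_within_subset) blast
    qed
    then have lim: "((\<lambda>b. mat 1 + (\<Sum>l=1..d. mat (1 / (k - \<rho> l)) ** r l b)) \<longlongrightarrow>
        mat 1 + (\<Sum>l=1..d. mat (1 / (k - \<rho> l)) ** r l b)) (at b within (imag_ray - exceptional))"
      by (intro tendsto_add tendsto_const tendsto_sum tendsto_matrix_mult)
    show "((\<lambda>b. M b k) \<longlongrightarrow>
        mat 1 + (\<Sum>l=1..d. mat (1 / (k - \<rho> l)) ** r l b)) (at b within (imag_ray - exceptional))"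
      by (rule Lim_transform_eventually[OF lim])
        (simp add: eventually_at_filter generic[OF _ k])
  qed
  then have "M_residues r"
    by (simp add: M_residues_def)
  then show ?thesis
    using deriv by (intro exI[of _ r] conjI ballI allI)
qed

text \<open>The derivative of \<open>M\<close> in \<open>b\<close> is computed twice: term by term
  from the expansion, and from the Lax equation, where the identity summand of \<open>M\<close>
  drops out of the commutator. Both results are rational in \<open>k\<close> with poles only at the
  \<open>\<rho> l\<close> and at the tips.\<close>

lemma residue_identity:
  assumes r: "M_residues r"
    and D: "\<And>l. mat_deriv (r l) (D l) (at b within imag_ray)"
    and b: "b \<in> imag_ray" and k: "k \<in> X"
  shows "(\<Sum>l=1..d. D l $ m $ n / (k - \<rho> l)) =
    (\<Sum>j=1..p. \<Sum>l=1..d. commutator (s j b) (r l b) $ m $ n / ((k - (\<kappa> j + b)) * (k - \<rho> l)))"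
proof -
  have "mat_deriv (\<lambda>b. mat 1 + (\<Sum>l=1..d. mat (1 / (k - \<rho> l)) ** r l b))
      (0 + (\<Sum>l=1..d. 0 ** r l b + mat (1 / (k - \<rho> l)) ** D l)) (at b within imag_ray)"
    by (intro mat_deriv_add[OF mat_deriv_const] mat_deriv_sum mat_deriv_mult[OF mat_deriv_const] D)
  from mat_deriv_unique[OF mat_deriv_cong[OF M_deriv[OF b k] b M_residuesD[OF r _ k]] this] imag_ray_dense[OF finite.emptyI b]
  have "commutator (A b k) (M b k) = (\<Sum>l=1..d. 0 ** r l b + mat (1 / (k - \<rho> l)) ** D l)"
    by simp
  moreover have "commutator (A b k) (M b k) =
      (\<Sum>j=1..p. \<Sum>l=1..d. mat (1 / (k - (\<kappa> j + b)) * (1 / (k - \<rho> l))) ** commutator (s j b) (r l b))"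
    unfolding A_def M_residuesD[OF r b k] commutator_1_add commutator_sum_left
    by (simp only: commutator_sum_right commutator_scale)
  ultimately have "(\<Sum>l=1..d. 0 ** r l b + mat (1 / (k - \<rho> l)) ** D l) $ m $ n =
      (\<Sum>j=1..p. \<Sum>l=1..d. mat (1 / (k - (\<kappa> j + b)) * (1 / (k - \<rho> l))) ** commutator (s j b) (r l b)) $ m $ n"
    by (simp only:)
  moreover have "(0 ** r l b) $ m $ n = 0" for l
    by (simp add: matrix_mult_entry)
  ultimately show ?thesis
    by simp
qed

text \<open>Multiplication by \<open>k - \<rho> l\<close> and passage to the pole; without a tip at
  \<open>\<rho> l\<close> the inner sums over \<open>j\<close> are continuous there.\<close>

lemma residue_ode:
  assumes r: "M_residues r"
    and D: "\<And>l. mat_deriv (r l) (D l) (at b within imag_ray)"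
    and b: "b \<in> imag_ray" and l: "l \<in> {1..d}" and off: "\<And>j. j \<in> {1..p} \<Longrightarrow> \<rho> l \<noteq> \<kappa> j + b"
  shows "D l $ m $ n = (\<Sum>j=1..p. commutator (s j b) (r l b) $ m $ n / (\<rho> l - (\<kappa> j + b)))"
proof (rule tendsto_unique[OF X_dense])
  have fin: "finite {1..d}"
    by simp
  show "((\<lambda>k. (k - \<rho> l) * (\<Sum>i=1..d. D i $ m $ n / (k - \<rho> i))) \<longlongrightarrow> D l $ m $ n) (at (\<rho> l) within X)"
    by (rule tendsto_leading_fraction[OF fin l rho_inj, of "\<lambda>i _. D i $ m $ n"]) (rule tendsto_const)
  have lim: "((\<lambda>k. (k - \<rho> l) * (\<Sum>i=1..d.
        (\<Sum>j=1..p. commutator (s j b) (r i b) $ m $ n / (k - (\<kappa> j + b))) / (k - \<rho> i))) \<longlongrightarrow>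
      (\<Sum>j=1..p. commutator (s j b) (r l b) $ m $ n / (\<rho> l - (\<kappa> j + b)))) (at (\<rho> l) within X)"
    by (rule tendsto_leading_fraction[OF fin l rho_inj,
          of "\<lambda>i k. \<Sum>j=1..p. commutator (s j b) (r i b) $ m $ n / (k - (\<kappa> j + b))"
             "\<lambda>i. \<Sum>j=1..p. commutator (s j b) (r i b) $ m $ n / (\<rho> l - (\<kappa> j + b))"])
      (rule tendsto_fraction_sum, rule off)
  have eq: "(\<Sum>i=1..d. (\<Sum>j=1..p. commutator (s j b) (r i b) $ m $ n / (k - (\<kappa> j + b))) / (k - \<rho> i)) =
      (\<Sum>i=1..d. D i $ m $ n / (k - \<rho> i))" if k: "k \<in> X" for k
    unfolding residue_identity[OF r D b k]
    by (subst sum.swap) (simp add: sum_divide_distrib del: One_nat_def)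
  show "((\<lambda>k. (k - \<rho> l) * (\<Sum>i=1..d. D i $ m $ n / (k - \<rho> i))) \<longlongrightarrow>
      (\<Sum>j=1..p. commutator (s j b) (r l b) $ m $ n / (\<rho> l - (\<kappa> j + b)))) (at (\<rho> l) within X)"
    by (rule Lim_transform_eventually[OF lim])
      (simp add: eventually_at_filter eq del: One_nat_def)
qed

text \<open>The termwise derivative has no pole at the tip, so the residue of the Lax side vanishes
  there, and that residue is the commutator of \<open>s j b\<close> with \<open>R\<close>.\<close>

lemma residue_commute:
  assumes r: "M_residues r"
    and D: "\<And>l. mat_deriv (r l) (D l) (at b within imag_ray)"
    and b: "b \<in> imag_ray" and j: "j \<in> {1..p}" and off: "\<And>l. l \<in> {1..d} \<Longrightarrow> \<kappa> j + b \<noteq> \<rho> l"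
  shows "s j b ** R_matrix d \<rho> r b (\<kappa> j + b) = R_matrix d \<rho> r b (\<kappa> j + b) ** s j b"
proof -
  have fin: "finite {1..p}"
    by simp
  have "(\<Sum>l=1..d. commutator (s j b) (r l b) $ m $ n / (\<kappa> j + b - \<rho> l)) = 0" for m n
  proof (rule tendsto_unique[OF X_dense])
    show "((\<lambda>k. (k - (\<kappa> j + b)) * (\<Sum>i=1..p.
          (\<Sum>l=1..d. commutator (s i b) (r l b) $ m $ n / (k - \<rho> l)) / (k - (\<kappa> i + b)))) \<longlongrightarrow>
        (\<Sum>l=1..d. commutator (s j b) (r l b) $ m $ n / (\<kappa> j + b - \<rho> l))) (at (\<kappa> j + b) within X)"
      by (rule tendsto_leading_fraction[OF fin j tips_inj,
            of "\<lambda>i k. \<Sum>l=1..d. commutator (s i b) (r l b) $ m $ n / (k - \<rho> l)"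
               "\<lambda>i. \<Sum>l=1..d. commutator (s i b) (r l b) $ m $ n / (\<kappa> j + b - \<rho> l)"])
        (rule tendsto_fraction_sum, rule off)
    have "((\<lambda>k. (k - (\<kappa> j + b)) * (\<Sum>l=1..d. D l $ m $ n / (k - \<rho> l))) \<longlongrightarrow>
        (\<kappa> j + b - (\<kappa> j + b)) * (\<Sum>l=1..d. D l $ m $ n / (\<kappa> j + b - \<rho> l))) (at (\<kappa> j + b) within X)"
      by (intro tendsto_mult tendsto_diff tendsto_ident_at tendsto_const tendsto_fraction_sum off)
    then have lim: "((\<lambda>k. (k - (\<kappa> j + b)) * (\<Sum>l=1..d. D l $ m $ n / (k - \<rho> l))) \<longlongrightarrow> 0) (at (\<kappa> j + b) within X)"
      by simp
    have eq: "(\<Sum>l=1..d. D l $ m $ n / (k - \<rho> l)) = (\<Sum>i=1..p.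
          (\<Sum>l=1..d. commutator (s i b) (r l b) $ m $ n / (k - \<rho> l)) / (k - (\<kappa> i + b)))" if k: "k \<in> X" for k
      unfolding residue_identity[OF r D b k]
      by (simp add: sum_divide_distrib mult.commute del: One_nat_def)
    show "((\<lambda>k. (k - (\<kappa> j + b)) * (\<Sum>i=1..p.
          (\<Sum>l=1..d. commutator (s i b) (r l b) $ m $ n / (k - \<rho> l)) / (k - (\<kappa> i + b)))) \<longlongrightarrow> 0)
        (at (\<kappa> j + b) within X)"
      by (rule Lim_transform_eventually[OF lim])
        (simp add: eventually_at_filter eq del: One_nat_def)
  qed
  then have "(\<Sum>l=1..d. mat (1 / (\<kappa> j + b - \<rho> l)) ** commutator (s j b) (r l b)) = 0"
    by (intro matrix_eqI) simp
  moreover have "commutator (s j b) (R_matrix d \<rho> r b (\<kappa> j + b)) =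
      (\<Sum>l=1..d. mat (1 / (\<kappa> j + b - \<rho> l)) ** commutator (s j b) (r l b))"
  proof -
    have "commutator (s j b) (mat c ** Y) = mat c ** commutator (s j b) Y" for c Y
      using commutator_scale[of 1 "s j b" c Y] by simp
    then show ?thesis
      unfolding R_matrix_def by (simp only: commutator_sum_right)
  qed
  ultimately show ?thesis
    by (simp add: commutator_def)
qed

text \<open>Off the lines \<open>1 + R\<close> is conjugate to \<open>B\<close> by \<open>U\<close>.
  At a tip \<open>U\<close> may be singular, but both characteristic polynomials are continuous
  there.\<close>

lemma R_matrix_det:
  assumes r: "M_residues r"
    and b: "b \<in> imag_ray" and off: "\<And>l. l \<in> {1..d} \<Longrightarrow> a \<noteq> \<rho> l"
  shows "det (mat z - B a) = det (mat z - (mat 1 + R_matrix d \<rho> r b a))"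
proof (rule tendsto_unique[OF X_dense])
  have a: "a \<notin> \<rho> ` {1..d}"
    using off by blast
  show "((\<lambda>k. det (mat z - B k)) \<longlongrightarrow> det (mat z - B a)) (at a within X)"
    by (rule tendsto_det[OF tendsto_diff[OF tendsto_const B_tendsto[OF a]]])
  have R: "(R_matrix d \<rho> r b \<longlongrightarrow> R_matrix d \<rho> r b a) (at a within X)"
  proof (rule tendsto_matrixI)
    fix i j
    show "((\<lambda>k. R_matrix d \<rho> r b k $ i $ j) \<longlongrightarrow> R_matrix d \<rho> r b a $ i $ j) (at a within X)"
      using tendsto_fraction_sum[of "{1..d}" a \<rho> "\<lambda>l. r l b $ i $ j" X] off
      by (simp add: R_matrix_def)
  qed
  have lim: "((\<lambda>k. det (mat z - (mat 1 + R_matrix d \<rho> r b k))) \<longlongrightarrow>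
      det (mat z - (mat 1 + R_matrix d \<rho> r b a))) (at a within X)"
    by (rule tendsto_det[OF tendsto_diff[OF tendsto_const tendsto_add[OF tendsto_const R]]])
  have eq: "det (mat z - (mat 1 + R_matrix d \<rho> r b k)) = det (mat z - B k)" if k: "k \<in> X" for k
  proof -
    have "mat 1 + R_matrix d \<rho> r b k = M b k"
      unfolding R_matrix_def M_residuesD[OF r b k] by (rule refl)
    also have "\<dots> = U b k ** B k ** matrix_inv (U b k)"
      by (rule M_def)
    finally show ?thesis
      using similar_det[OF U_inv[OF b X_cut[OF k b]]] by simp
  qed
  show "((\<lambda>k. det (mat z - B k)) \<longlongrightarrow> det (mat z - (mat 1 + R_matrix d \<rho> r b a))) (at a within X)"
    by (rule Lim_transform_eventually[OF lim]) (simp add: eventually_at_filter eq del: One_nat_def)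
qed

end

section \<open>The residues at the moving points\<close>

text \<open>A Gronwall estimate on a short set, without exponentials: with \<open>\<phi>\<close> the
  sum of the entry norms and \<open>b1\<close> a point where it is maximal, the mean value bound
  gives \<open>\<phi> b1 \<le> \<phi> b0 + \<phi> b1 / 2\<close>.\<close>

lemma field_derivative_growth_bound:
  fixes y :: "complex \<Rightarrow> 'n::finite cmat"
  assumes S: "convex S" "compact S" "b0 \<in> S"
    and deriv: "\<And>b. b \<in> S \<Longrightarrow> mat_deriv y (D b) (at b within S)"
    and bound: "\<And>b m n. b \<in> S \<Longrightarrow> norm (D b $ m $ n) \<le> \<gamma> * (\<Sum>i\<in>UNIV. \<Sum>j\<in>UNIV. norm (y b $ i $ j))"
    and small: "\<And>b. b \<in> S \<Longrightarrow> real (CARD('n) * CARD('n)) * \<gamma> * norm (b - b0) \<le> 1 / 2"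
    and \<gamma>: "\<gamma> \<ge> 0" and b: "b \<in> S"
  shows "norm (y b $ m $ n - y b0 $ m $ n) \<le> 2 * \<gamma> * (\<Sum>i\<in>UNIV. \<Sum>j\<in>UNIV. norm (y b0 $ i $ j)) * norm (b - b0)"
proof -
  define \<phi> where "\<phi> b = (\<Sum>i\<in>UNIV. \<Sum>j\<in>UNIV. norm (y b $ i $ j))" for b
  have "continuous_on S (\<lambda>b. y b $ i $ j)" for i j
    unfolding continuous_on_def
    by (intro ballI tendsto_matrixD mat_deriv_tendsto) (erule deriv)
  then have "continuous_on S \<phi>"
    unfolding \<phi>_def by (intro continuous_on_sum continuous_on_norm)
  moreover have "S \<noteq> {}"
    using S(3) by blast
  ultimately obtain b1 where b1: "b1 \<in> S" "\<forall>b\<in>S. \<phi> b \<le> \<phi> b1"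
    using continuous_attains_sup[OF S(2)] by blast
  have diff: "norm (y b $ m $ n - y b0 $ m $ n) \<le> \<gamma> * \<phi> b1 * norm (b - b0)" if "b \<in> S" for b m n
  proof (rule field_differentiable_bound[OF S(1) _ _ that S(3)])
    fix z assume z: "z \<in> S"
    show "((\<lambda>b. y b $ m $ n) has_field_derivative D z $ m $ n) (at z within S)"
      using deriv[OF z] by (simp add: mat_deriv_def)
    have "norm (D z $ m $ n) \<le> \<gamma> * \<phi> z"
      using bound[OF z] by (simp add: \<phi>_def)
    also have "\<dots> \<le> \<gamma> * \<phi> b1"
      using b1(2) z \<gamma> by (intro mult_left_mono) auto
    finally show "norm (D z $ m $ n) \<le> \<gamma> * \<phi> b1" .
  qed
  have "\<phi> b1 \<le> (\<Sum>i\<in>UNIV. \<Sum>j\<in>UNIV. norm (y b0 $ i $ j) + \<gamma> * \<phi> b1 * norm (b1 - b0))"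
    unfolding \<phi>_def[of b1]
  proof (intro sum_mono)
    fix i j
    show "norm (y b1 $ i $ j) \<le> norm (y b0 $ i $ j) + \<gamma> * (\<Sum>i\<in>UNIV. \<Sum>j\<in>UNIV. norm (y b1 $ i $ j)) * norm (b1 - b0)"
      using diff[OF b1(1), of i j] norm_triangle_sub[of "y b1 $ i $ j" "y b0 $ i $ j"]
      unfolding \<phi>_def by linarith
  qed
  \<comment> \<open>Every entry obeys the same bound; summing them yields the factor in the
    smallness hypothesis.\<close>
  also have "\<dots> = \<phi> b0 + real (CARD('n) * CARD('n)) * \<gamma> * norm (b1 - b0) * \<phi> b1"
    by (simp add: \<phi>_def sum.distrib)
  also have "\<dots> \<le> \<phi> b0 + 1 / 2 * \<phi> b1"
    using small[OF b1(1)] by (intro add_left_mono mult_right_mono) (auto simp: \<phi>_def intro!: sum_nonneg)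
  finally have "\<phi> b1 \<le> 2 * \<phi> b0"
    by simp
  then have "\<gamma> * \<phi> b1 * norm (b - b0) \<le> \<gamma> * (2 * \<phi> b0) * norm (b - b0)"
    using \<gamma> by (intro mult_right_mono mult_left_mono) auto
  with diff[OF b, of m n]
  have "norm (y b $ m $ n - y b0 $ m $ n) \<le> \<gamma> * (2 * \<phi> b0) * norm (b - b0)"
    by (rule order_trans)
  then show ?thesis
    by (simp only: \<phi>_def mult_ac)
qed

lemma Ln_up_holomorphic: "Ln_up holomorphic_on {z. Re z \<noteq> 0 \<or> Im z < 0}"
  unfolding holomorphic_on_def field_differentiable_def
proof
  fix z assume "z \<in> {z. Re z \<noteq> 0 \<or> Im z < 0}"
  then have "Re z \<noteq> 0 \<or> Im z < 0"
    by simp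
  from DERIV_subset[OF Ln_up_has_derivative[OF this] subset_UNIV]
  show "\<exists>f'. (Ln_up has_field_derivative f') (at z within {z. Re z \<noteq> 0 \<or> Im z < 0})"
    by (rule exI)
qed

lemma Ln_up_shift_holomorphic:
  assumes "S \<subseteq> {k. Re k \<noteq> Re c \<or> Im k < Im c}"
  shows "(\<lambda>k. Ln_up (k - c)) holomorphic_on S"
proof -
  have 1: "(\<lambda>k. k - c) holomorphic_on S"
    by (intro holomorphic_intros)
  have 2: "(\<lambda>k. k - c) ` S \<subseteq> {z. Re z \<noteq> 0 \<or> Im z < 0}"
    using assms by auto
  show ?thesis
    using holomorphic_on_compose_gen[OF 1 Ln_up_holomorphic 2] by (simp add: o_def)
qed

lemma tendsto_within_ball:
  assumes "a \<in> ball c R" "(f \<longlongrightarrow> l) (at a within (ball c R \<inter> X))"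
  shows "(f \<longlongrightarrow> l) (at a within X)"
proof -
  have "at a within (ball c R \<inter> X) = at a within X"
    by (rule at_within_nhd[OF assms(1) open_ball]) auto
  then show ?thesis
    using assms(2) by simp
qed

section \<open>Local logarithms of the eigenvalues and the regularized solution
  \<open>T\<close>\<close>

context rh_setting
begin

text \<open>\<open>\<omega>\<close> extends the logarithms of the eigenvalues from the cut to a disc around a point of the cut.\<close>

definition "log_chart j a0 R \<omega> \<longleftrightarrow> j \<in> {1..p} \<and> R > 0 \<and> ball a0 R \<subseteq> W \<and>
  (\<forall>i. (\<lambda>k. \<omega> k $ i) holomorphic_on ball a0 R) \<and>
  (\<forall>k\<in>ball a0 R \<inter> cut (\<kappa> j). k \<notin> Z \<and> \<omega> k = lf j k) \<and>
  Re a0 = Re (\<kappa> j) \<and> R \<le> Im a0 - Im (\<kappa> j) \<and>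
  (\<forall>i\<in>{1..p}. i \<noteq> j \<longrightarrow> R \<le> \<bar>Re (\<kappa> i) - Re (\<kappa> j)\<bar>)"

lemma log_chartD:
  assumes "log_chart j a0 R \<omega>"
  shows "j \<in> {1..p}" "R > 0" "ball a0 R \<subseteq> W" "(\<lambda>k. \<omega> k $ i) holomorphic_on ball a0 R"
    "k \<in> ball a0 R \<Longrightarrow> k \<in> cut (\<kappa> j) \<Longrightarrow> k \<notin> Z \<and> \<omega> k = lf j k"
    "Re a0 = Re (\<kappa> j)" "R \<le> Im a0 - Im (\<kappa> j)"
    "l \<in> {1..p} \<Longrightarrow> l \<noteq> j \<Longrightarrow> R \<le> \<bar>Re (\<kappa> l) - Re (\<kappa> j)\<bar>"
  using assms by (simp_all add: log_chart_def)

text \<open>The diagonal of \<open>matrix_inv (P k) ** H j k ** P k\<close> is holomorphic around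
  the cut and lists the eigenvalues there in the order of \<open>lf\<close>; its logarithm is taken
  near \<open>lf j a0\<close>.\<close>

lemma log_extension:
  assumes j: "j \<in> {1..p}" and a0: "a0 \<in> cut (\<kappa> j)" "a0 \<notin> Z"
  shows "\<exists>R \<omega>. R > 0 \<and> ball a0 R \<subseteq> W \<and> (\<forall>i. (\<lambda>k. \<omega> k $ i) holomorphic_on ball a0 R) \<and>
    (\<forall>k\<in>ball a0 R \<inter> cut (\<kappa> j). k \<notin> Z \<and> \<omega> k = lf j k)"
proof -
  define V where "V = W \<inter> strip_at \<epsilon> (\<kappa> j)"
  define g where "g k = matrix_inv (P k) ** H j k ** P k" for k
  \<comment> \<open>Division by the value at \<open>a0\<close> brings the argument close to
    \<open>1\<close>, where the principal logarithm is holomorphic; adding \<open>lf j a0\<close>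
    restores the branch.\<close>
  define \<omega> where "\<omega> k = (\<chi> i. lf j a0 $ i + Ln (g k $ i $ i / exp (lf j a0 $ i)))" for k
  have V: "open V" "a0 \<in> V"
  proof -
    have "a0 \<in> (\<Union>j\<in>{1..p}. cut (\<kappa> j)) - Z"
      using j a0 by blast
    then show "a0 \<in> V"
      using subsetD[OF cut_W] subsetD[OF cut_strip a0(1)] by (simp add: V_def)
    show "open V"
      unfolding V_def by (rule open_Int[OF open_W open_strip])
  qed
  have PV: "mat_holomorphic_on P V"
    by (rule mat_holomorphic_subset[OF P_hol]) (simp add: V_def)
  have HV: "mat_holomorphic_on (H j) V"
    by (rule mat_holomorphic_subset[OF H_hol[OF j]]) (simp add: V_def)
  have "mat_holomorphic_on (\<lambda>k. matrix_inv (P k)) V"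
    by (rule mat_holomorphic_inv[OF PV]) (use inv_P in \<open>simp add: V_def\<close>)
  then have g_hol: "mat_holomorphic_on g V"
    unfolding g_def by (intro mat_holomorphic_mult PV HV)
  have g_cut: "g k $ i $ i = exp (lf j k $ i)" if k: "k \<in> V" "k \<in> cut (\<kappa> j)" "k \<notin> Z" for k i
  proof -
    have "invertible (P k)"
      using inv_P k by (simp add: V_def)
    then have "g k = diag_mat (\<chi> i. exp (lf j k $ i))"
      using H_eig[OF j k(2,3)] by (simp add: g_def matrix_mul_assoc matrix_inv_left)
    then show ?thesis
      by (simp add: diag_mat_entry)
  qed
  have g0: "g a0 $ i $ i = exp (lf j a0 $ i)" for i
    by (rule g_cut[OF V(2) a0])
  have lim: "((\<lambda>k. g k $ i $ i / exp (lf j a0 $ i)) \<longlongrightarrow> 1) (at a0 within S)" for i S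
  proof -
    have "((\<lambda>k. g k $ i $ i / exp (lf j a0 $ i)) \<longlongrightarrow> g a0 $ i $ i / exp (lf j a0 $ i)) (at a0 within S)"
      by (rule tendsto_divide[OF tendsto_matrixD[OF mat_holomorphic_tendsto[OF g_hol V]] tendsto_const])
        simp
    then show ?thesis
      by (simp add: g0)
  qed
  have "\<forall>\<^sub>F k in nhds a0. k \<in> V"
    by (rule eventually_nhds_in_open[OF V])
  moreover have "\<forall>\<^sub>F k in nhds a0. k \<in> - Z"
    using a0(2) finite_Z by (intro eventually_nhds_in_open) (auto simp: finite_imp_closed open_Compl)
  moreover have "\<forall>\<^sub>F k in nhds a0. \<forall>i. dist (g k $ i $ i / exp (lf j a0 $ i)) 1 < 1"
  proof (rule eventually_all_finite)
    fix i
    show "\<forall>\<^sub>F k in nhds a0. dist (g k $ i $ i / exp (lf j a0 $ i)) 1 < 1"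
      using tendstoD[OF lim[of i UNIV] zero_less_one] by (simp add: eventually_nhds_conv_at g0)
  qed
  \<comment> \<open>Along the cut \<open>lf\<close> and \<open>\<omega>\<close> are continuous at
    \<open>a0\<close> with the same value, so nearby they are less than \<open>2 * pi\<close> apart;
    being logarithms of the same number, they then coincide.\<close>
  moreover have "\<forall>\<^sub>F k in nhds a0. \<forall>i. k \<noteq> a0 \<longrightarrow> k \<in> cut (\<kappa> j) \<longrightarrow> dist (lf j k $ i - \<omega> k $ i) 0 < 2 * pi"
  proof (rule eventually_all_finite)
    fix i
    have "continuous_on (cut (\<kappa> j)) (lf j)"
      using logb j by (simp add: log_branch_def)
    then have "(lf j \<longlongrightarrow> lf j a0) (at a0 within cut (\<kappa> j))"
      using a0(1) by (simp add: continuous_on_def)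
    then have 1: "((\<lambda>k. lf j k $ i) \<longlongrightarrow> lf j a0 $ i) (at a0 within cut (\<kappa> j))"
      by (rule tendsto_vec_nth)
    have "(1::complex) \<notin> \<real>\<^sub>\<le>\<^sub>0"
      by simp
    from tendsto_diff[OF 1 tendsto_add[OF tendsto_const[of "lf j a0 $ i"] tendsto_Ln[OF lim[of i] this]]]
    have "((\<lambda>k. lf j k $ i - \<omega> k $ i) \<longlongrightarrow> lf j a0 $ i - (lf j a0 $ i + Ln 1)) (at a0 within cut (\<kappa> j))"
      by (simp add: \<omega>_def)
    then have "((\<lambda>k. lf j k $ i - \<omega> k $ i) \<longlongrightarrow> 0) (at a0 within cut (\<kappa> j))"
      by simp
    moreover have "2 * pi > 0"
      by simp
    ultimately have "\<forall>\<^sub>F k in at a0 within cut (\<kappa> j). dist (lf j k $ i - \<omega> k $ i) 0 < 2 * pi"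
      by (rule tendstoD)
    then show "\<forall>\<^sub>F k in nhds a0. k \<noteq> a0 \<longrightarrow> k \<in> cut (\<kappa> j) \<longrightarrow> dist (lf j k $ i - \<omega> k $ i) 0 < 2 * pi"
      by (simp only: eventually_at_filter)
  qed
  ultimately have "\<forall>\<^sub>F k in nhds a0. k \<in> V \<and> k \<in> - Z \<and>
      (\<forall>i. dist (g k $ i $ i / exp (lf j a0 $ i)) 1 < 1) \<and>
      (\<forall>i. k \<noteq> a0 \<longrightarrow> k \<in> cut (\<kappa> j) \<longrightarrow> dist (lf j k $ i - \<omega> k $ i) 0 < 2 * pi)"
    by (intro eventually_conj)
  then obtain R where R: "R > 0" and ball: "\<forall>k. dist k a0 < R \<longrightarrow> k \<in> V \<and> k \<in> - Z \<and>
      (\<forall>i. dist (g k $ i $ i / exp (lf j a0 $ i)) 1 < 1) \<and>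
      (\<forall>i. k \<noteq> a0 \<longrightarrow> k \<in> cut (\<kappa> j) \<longrightarrow> dist (lf j k $ i - \<omega> k $ i) 0 < 2 * pi)"
    unfolding eventually_nhds_metric by (elim exE conjE)
  have chart: "k \<in> V" "k \<notin> Z" "dist (g k $ i $ i / exp (lf j a0 $ i)) 1 < 1"
    "k \<noteq> a0 \<Longrightarrow> k \<in> cut (\<kappa> j) \<Longrightarrow> dist (lf j k $ i - \<omega> k $ i) 0 < 2 * pi"
    if "k \<in> ball a0 R" for k i
  proof -
    have "dist k a0 < R"
      using that by (simp add: dist_commute)
    note * = mp[OF spec[OF ball] this]
    show "k \<in> V"
      by (rule conjunct1[OF *])
    show "k \<notin> Z"
      using conjunct1[OF conjunct2[OF *]] by simp
    show "dist (g k $ i $ i / exp (lf j a0 $ i)) 1 < 1"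
      by (rule spec[OF conjunct1[OF conjunct2[OF conjunct2[OF *]]]])
    show "k \<noteq> a0 \<Longrightarrow> k \<in> cut (\<kappa> j) \<Longrightarrow> dist (lf j k $ i - \<omega> k $ i) 0 < 2 * pi"
      by (rule mp[OF mp[OF spec[OF conjunct2[OF conjunct2[OF conjunct2[OF *]]]]]])
  qed
  have ballV: "ball a0 R \<subseteq> V"
    using chart(1) by blast
  have hol: "(\<lambda>k. \<omega> k $ i) holomorphic_on ball a0 R" for i
  proof -
    have "(\<lambda>k. g k $ i $ i / exp (lf j a0 $ i)) holomorphic_on ball a0 R"
      using mat_holomorphic_subset[OF g_hol ballV]
      by (intro holomorphic_on_divide holomorphic_on_const) (simp_all add: mat_holomorphic_on_def)
    moreover have "g k $ i $ i / exp (lf j a0 $ i) \<notin> \<real>\<^sub>\<le>\<^sub>0" if "k \<in> ball a0 R" for k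
    proof -
      have "norm (g k $ i $ i / exp (lf j a0 $ i) - 1) < 1"
        using chart(3)[OF that, of i] by (simp only: dist_norm)
      then have "\<bar>Re (g k $ i $ i / exp (lf j a0 $ i) - 1)\<bar> < 1"
        using abs_Re_le_cmod le_less_trans by blast
      then have "Re (g k $ i $ i / exp (lf j a0 $ i)) > 0"
        by (simp only: minus_complex.sel one_complex.sel)
      then show ?thesis
        by (auto simp: complex_nonpos_Reals_iff)
    qed
    ultimately have "(\<lambda>k. lf j a0 $ i + Ln (g k $ i $ i / exp (lf j a0 $ i))) holomorphic_on ball a0 R"
      by (intro holomorphic_on_add holomorphic_on_const holomorphic_on_Ln')
    then show ?thesis
      by (simp add: \<omega>_def)
  qed
  have vals: "k \<notin> Z \<and> \<omega> k = lf j k" if k: "k \<in> ball a0 R" "k \<in> cut (\<kappa> j)" for k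
  proof -
    have kV: "k \<in> V" "k \<notin> Z"
      using chart(1,2)[OF k(1)] by simp_all
    have "lf j k $ i = \<omega> k $ i" for i
    proof (cases "k = a0")
      case True
      then show ?thesis
        by (simp add: \<omega>_def g0)
    next
      case False
      then have "norm (lf j k $ i - \<omega> k $ i) < 2 * pi"
        using chart(4)[OF k(1) _ k(2), of i] by (simp only: dist_norm diff_zero simp_thms)
      then have "\<bar>Im (lf j k $ i) - Im (\<omega> k $ i)\<bar> < 2 * pi"
        using abs_Im_le_cmod[of "lf j k $ i - \<omega> k $ i"] by (simp only: minus_complex.sel)
      moreover have "exp (lf j k $ i) = exp (\<omega> k $ i)"
        using g_cut[OF kV(1) k(2) kV(2), of i] by (simp add: \<omega>_def exp_add)
      ultimately show ?thesis
        by (rule exp_complex_eqI)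
    qed
    then show ?thesis
      using kV(2) by (simp add: vec_eq_iff)
  qed
  have "V \<subseteq> W"
    by (simp add: V_def)
  then have ballW: "ball a0 R \<subseteq> W"
    using ballV by (rule order_trans[rotated])
  have vals': "\<forall>k\<in>ball a0 R \<inter> cut (\<kappa> j). k \<notin> Z \<and> \<omega> k = lf j k"
    using vals by simp
  show ?thesis
    by (rule exI[of _ R], rule exI[of _ \<omega>], intro conjI R ballW allI hol vals')
qed

lemma log_chart_exists:
  assumes j: "j \<in> {1..p}" and a0: "a0 \<in> cut (\<kappa> j)" "a0 \<notin> Z"
  shows "\<exists>R \<omega>. log_chart j a0 R \<omega>"
proof -
  obtain R1 \<omega> where R1: "R1 > 0" "ball a0 R1 \<subseteq> W" "\<forall>i. (\<lambda>k. \<omega> k $ i) holomorphic_on ball a0 R1"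
    "\<forall>k\<in>ball a0 R1 \<inter> cut (\<kappa> j). k \<notin> Z \<and> \<omega> k = lf j k"
    using log_extension[OF assms] by (elim exE conjE)
  \<comment> \<open>Staying below these distances keeps the disc above \<open>\<kappa> j\<close> and
    away from the lines of the other cuts.\<close>
  define N where "N = insert (Im a0 - Im (\<kappa> j)) ((\<lambda>i. \<bar>Re (\<kappa> i) - Re (\<kappa> j)\<bar>) ` ({1..p} - {j}))"
  define R where "R = Min (insert R1 N)"
  have N: "finite N"
    by (simp add: N_def)
  have "\<forall>x\<in>N. x > 0"
    using a0(1) kappa_Re_inj[OF _ j] by (auto simp: N_def cut_def)
  then have "R > 0"
    using N R1(1) unfolding R_def by (subst Min_gr_iff) auto
  have R: "R \<le> x" if "x \<in> insert R1 N" for x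
    unfolding R_def using N that by (intro Min_le) auto
  have "ball a0 R \<subseteq> ball a0 R1"
    using R[of R1] by auto
  then have sub: "ball a0 R \<subseteq> W" and vals: "\<forall>k\<in>ball a0 R \<inter> cut (\<kappa> j). k \<notin> Z \<and> \<omega> k = lf j k"
    using R1(2,4) by blast+
  have hol: "(\<lambda>k. \<omega> k $ i) holomorphic_on ball a0 R" for i
    by (rule holomorphic_on_subset[OF spec[OF R1(3)] \<open>ball a0 R \<subseteq> ball a0 R1\<close>])
  have Re: "Re a0 = Re (\<kappa> j)"
    using a0(1) by (simp add: cut_def)
  have Im: "R \<le> Im a0 - Im (\<kappa> j)"
    by (rule R) (simp add: N_def)
  have others: "R \<le> \<bar>Re (\<kappa> i) - Re (\<kappa> j)\<bar>" if "i \<in> {1..p}" "i \<noteq> j" for i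
    by (rule R) (use that in \<open>simp add: N_def\<close>)
  have "log_chart j a0 R \<omega>"
    unfolding log_chart_def
    by (intro conjI j \<open>R > 0\<close> sub allI hol vals Re Im ballI impI others)
  then show ?thesis
    by (intro exI)
qed

text \<open>The exponent varies with \<open>k\<close> instead of being frozen at the tip: then the
  jump of \<open>U\<close> is cancelled at every point of the cut in the disc. As
  \<open>\<omega>\<close> does not depend on \<open>b\<close>, one chart serves all tips in the
  disc.\<close>

definition "T j \<omega> b k = U b k ** P k **
  diag_mat (\<chi> i. exp (- (\<omega> k $ i / (2 * of_real pi * \<i>)) * Ln_up (k - (\<kappa> j + b))))"

text \<open>The other cuts lie on lines at distance at least \<open>R\<close> from the centre, so
  only the ray above the moving tip meets the disc.\<close>

lemma chart_cut_union:
  assumes "log_chart j a0 R \<omega>" "b \<in> imag_ray" "k \<in> ball a0 R"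
  shows "k \<in> cut_union p \<kappa> b \<longleftrightarrow> Re k = Re a0 \<and> Im k \<ge> Im (\<kappa> j + b)"
proof
  assume "k \<in> cut_union p \<kappa> b"
  then obtain i where i: "i \<in> {1..p}" "Re k = Re (\<kappa> i)" "Im k \<ge> Im (\<kappa> i + b)"
    using assms(2) by (auto simp: cut_union_def cut_def imag_ray_def)
  have "i = j"
  proof (rule ccontr)
    assume "i \<noteq> j"
    then have "R \<le> \<bar>Re k - Re a0\<bar>"
      using log_chartD(8)[OF assms(1) i(1)] log_chartD(6)[OF assms(1)] i(2) by simp
    moreover have "\<bar>Re k - Re a0\<bar> \<le> norm (k - a0)"
      using abs_Re_le_cmod[of "k - a0"] by simp
    ultimately show False
      using assms(3) by (simp add: dist_norm norm_minus_commute)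
  qed
  then show "Re k = Re a0 \<and> Im k \<ge> Im (\<kappa> j + b)"
    using i log_chartD(6)[OF assms(1)] by simp
next
  assume "Re k = Re a0 \<and> Im k \<ge> Im (\<kappa> j + b)"
  then have "k \<in> insert (\<kappa> j + b) (cut (\<kappa> j + b))"
    using log_chartD(6)[OF assms(1)] assms(2) by (auto simp: cut_def imag_ray_def complex_eq_iff)
  then show "k \<in> cut_union p \<kappa> b"
    using log_chartD(1)[OF assms(1)] unfolding cut_union_def by blast
qed

text \<open>The cut of \<open>Ln_up\<close> runs upwards and thus falls on the cut of
  \<open>U\<close>, so the part of the vertical line below the tip is included.\<close>

lemma T_holomorphic:
  assumes c: "log_chart j a0 R \<omega>" and b: "b \<in> imag_ray"
    and S: "S \<subseteq> ball a0 R" "S \<subseteq> {k. Re k \<noteq> Re a0 \<or> Im k < Im (\<kappa> j + b)}"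
  shows "mat_holomorphic_on (T j \<omega> b) S"
proof -
  have "Re (\<kappa> j + b) = Re a0"
    using log_chartD(6)[OF c] b by (simp add: imag_ray_def)
  then have "S \<subseteq> {k. Re k \<noteq> Re (\<kappa> j + b) \<or> Im k < Im (\<kappa> j + b)}"
    using S(2) by simp
  then have L: "(\<lambda>k. Ln_up (k - (\<kappa> j + b))) holomorphic_on S"
    by (rule Ln_up_shift_holomorphic)
  have "S \<subseteq> - cut_union p \<kappa> b"
  proof
    fix k assume k: "k \<in> S"
    then have "Re k \<noteq> Re a0 \<or> Im k < Im (\<kappa> j + b)"
      using S(2) by blast
    then show "k \<in> - cut_union p \<kappa> b"
      unfolding Compl_iff chart_cut_union[OF c b subsetD[OF S(1) k]] by linarith
  qed
  then have U: "mat_holomorphic_on (U b) S"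
    by (rule mat_holomorphic_subset[OF U_hol[OF b]])
  have P: "mat_holomorphic_on P S"
    by (rule mat_holomorphic_subset[OF P_hol]) (use S(1) log_chartD(3)[OF c] in blast)
  have w: "(\<lambda>k. \<omega> k $ i) holomorphic_on S" for i
    by (rule holomorphic_on_subset[OF log_chartD(4)[OF c] S(1)])
  have nz: "2 * complex_of_real pi * \<i> \<noteq> 0"
    by simp
  have "(\<lambda>k. exp (- (\<omega> k $ i / (2 * of_real pi * \<i>)) * Ln_up (k - (\<kappa> j + b)))) holomorphic_on S" for i
    by (rule holomorphic_on_exp'[OF holomorphic_on_mult[OF
          holomorphic_on_minus[OF holomorphic_on_divide[OF w holomorphic_on_const nz]] L]])
  then have "mat_holomorphic_on (\<lambda>k. diag_mat (\<chi> i. exp (- (\<omega> k $ i / (2 * of_real pi * \<i>)) *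
      Ln_up (k - (\<kappa> j + b))))) S"
    by (intro mat_holomorphic_diag) (simp only: vec_lambda_beta)
  from mat_holomorphic_mult[OF mat_holomorphic_mult[OF U P] this] show ?thesis
    by (simp add: T_def [abs_def])
qed

text \<open>The leading term has the exponent frozen at the tip, \<open>T\<close> the varying one.
  The difference of the exponents vanishes at the tip at least to first order, which beats the
  logarithm, so the mismatch tends to the identity.\<close>

lemma T_tip_limit:
  assumes c: "log_chart j a0 R \<omega>" and b: "b \<in> imag_ray" and tip: "\<kappa> j + b \<in> ball a0 R"
  shows "\<exists>K. invertible K \<and> (T j \<omega> b \<longlongrightarrow> K) (at (\<kappa> j + b) within off_lines {Re a0})"
proof -
  define a where "a = \<kappa> j + b"
  define X1 where "X1 = ball a0 R \<inter> off_lines {Re a0}"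
  define e :: "complex^'n" where "e = (\<chi> i. lf j a $ i / (2 * of_real pi * \<i>))"
  have a: "a \<in> ball a0 R" "a \<in> cut (\<kappa> j)"
    using tip tip_in_cut[OF b] by (simp_all add: a_def)
  have aZ: "a \<notin> Z" "\<omega> a = lf j a"
    using log_chartD(5)[OF c a] by simp_all
  have lead: "leading_term_at a (cut_union p \<kappa> b) e P (U b)"
    using U_tip[OF b log_chartD(1)[OF c]] aZ(1) by (simp add: a_def e_def)
  have inv: "\<forall>k\<in>ball a0 R. invertible (P k)"
    using inv_P log_chartD(3)[OF c] by blast
  have sub: "X1 \<subseteq> - cut_union p \<kappa> b"
  proof
    fix k assume "k \<in> X1"
    then show "k \<in> - cut_union p \<kappa> b"
      using chart_cut_union[OF c b, of k] by (simp add: X1_def off_lines_def)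
  qed
  obtain K Y where K: "invertible K" and Y: "(Y \<longlongrightarrow> mat 1) (at a within X1)"
    and UP: "\<forall>k\<in>ball a0 R. U b k ** P k = Y k ** K ** diag_power (k - a) e"
    using leading_term_at_factorization[OF lead inv sub] by (elim exE conjE)
  define h where "h k = (\<chi> i. exp ((e $ i - \<omega> k $ i / (2 * of_real pi * \<i>)) * Ln_up (k - a)))" for k
  have "((\<lambda>k. h k $ i) \<longlongrightarrow> 1) (at a within X1)" for i
  proof -
    define u where "u k = \<omega> k $ i / (2 * of_real pi * \<i>)" for k
    have "u holomorphic_on ball a0 R"
      unfolding u_def by (intro holomorphic_on_divide holomorphic_on_const log_chartD(4)[OF c]) simp
    then have "u field_differentiable at a"
      using open_ball a(1) by (rule holomorphic_on_imp_differentiable_at)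
    then obtain u' where "(u has_field_derivative u') (at a)"
      unfolding field_differentiable_def by (rule exE)
    then have "((\<lambda>k. (u k - u a) / (k - a)) \<longlongrightarrow> u') (at a)"
      by (simp only: has_field_derivative_iff)
    then have 1: "((\<lambda>k. (u k - u a) / (k - a)) \<longlongrightarrow> u') (at a within X1)"
      by (rule Lim_at_imp_Lim_at_within)
    have "((\<lambda>k. k - a) \<longlongrightarrow> a - a) (at a)"
      by (rule tendsto_diff[OF tendsto_ident_at tendsto_const])
    then have "filterlim (\<lambda>k. k - a) (at 0) (at a)"
      by (simp add: filterlim_at eventually_at_filter)
    then have "((\<lambda>k. (k - a) * Ln_up (k - a)) \<longlongrightarrow> 0) (at a)"
      by (rule filterlim_compose[OF mult_Ln_up_tendsto_0])
    then have 2: "((\<lambda>k. (k - a) * Ln_up (k - a)) \<longlongrightarrow> 0) (at a within X1)"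
      by (rule Lim_at_imp_Lim_at_within)
    have "((\<lambda>k. exp (- ((u k - u a) / (k - a) * ((k - a) * Ln_up (k - a))))) \<longlongrightarrow> exp (- (u' * 0))) (at a within X1)"
      by (rule tendsto_exp[OF tendsto_minus[OF tendsto_mult[OF 1 2]]])
    moreover have "\<forall>\<^sub>F k in at a within X1.
        exp (- ((u k - u a) / (k - a) * ((k - a) * Ln_up (k - a)))) = h k $ i"
      unfolding eventually_at_filter
    proof (intro always_eventually allI impI)
      fix k assume k: "k \<noteq> a"
      have "- ((u k - u a) / (k - a) * ((k - a) * Ln_up (k - a))) = (u a - u k) * Ln_up (k - a)"
      proof -
        have cancel: "x / w * (w * y) = x * y" if "w \<noteq> 0" for x y w :: complex
          using that by simp
        have "k - a \<noteq> 0"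
          using k by simp
        then show ?thesis
          unfolding cancel[OF \<open>k - a \<noteq> 0\<close>] by (simp add: left_diff_distrib)
      qed
      moreover have "h k $ i = exp ((u a - u k) * Ln_up (k - a))"
        by (simp add: h_def u_def e_def aZ(2))
      ultimately show "exp (- ((u k - u a) / (k - a) * ((k - a) * Ln_up (k - a)))) = h k $ i"
        by (simp only:)
    qed
    ultimately have "((\<lambda>k. h k $ i) \<longlongrightarrow> exp (- (u' * 0))) (at a within X1)"
      by (rule Lim_transform_eventually)
    then show ?thesis
      by simp
  qed
  then have "((\<lambda>k. diag_mat (h k)) \<longlongrightarrow> diag_mat (\<chi> i. 1)) (at a within X1)"
    by (intro tendsto_diag_mat) simp
  then have "((\<lambda>k. Y k ** K ** diag_mat (h k)) \<longlongrightarrow> mat 1 ** K ** diag_mat (\<chi> i. 1)) (at a within X1)"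
    by (rule tendsto_matrix_mult[OF tendsto_matrix_mult[OF Y tendsto_const]])
  moreover have "\<forall>\<^sub>F k in at a within X1. Y k ** K ** diag_mat (h k) = T j \<omega> b k"
    unfolding eventually_at_filter
  proof (intro always_eventually allI impI)
    fix k assume "k \<in> X1"
    then have "k \<in> ball a0 R"
      by (simp add: X1_def)
    then have "T j \<omega> b k = Y k ** K ** (diag_power (k - a) e **
        diag_mat (\<chi> i. exp (- (\<omega> k $ i / (2 * of_real pi * \<i>)) * Ln_up (k - a))))"
      unfolding T_def using UP by (simp add: a_def matrix_mul_assoc)
    also have "diag_power (k - a) e ** diag_mat (\<chi> i. exp (- (\<omega> k $ i / (2 * of_real pi * \<i>)) * Ln_up (k - a))) =
        diag_mat (h k)"
      by (simp add: diag_power_def diag_mat_mult h_def exp_add[symmetric] algebra_simps)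
    finally show "Y k ** K ** diag_mat (h k) = T j \<omega> b k"
      by simp
  qed
  ultimately have "(T j \<omega> b \<longlongrightarrow> mat 1 ** K ** diag_mat (\<chi> i. 1)) (at a within X1)"
    by (rule Lim_transform_eventually)
  then have "(T j \<omega> b \<longlongrightarrow> K) (at a within off_lines {Re a0})"
    unfolding X1_def diag_mat_1 matrix_mul_lid matrix_mul_rid by (rule tendsto_within_ball[OF a(1)])
  from conjI[OF K this] show ?thesis
    unfolding a_def by (rule exI)
qed

text \<open>Off the line and below the tip \<open>T\<close> is holomorphic, and at the tip the
  leading term decides. On the cut the factor \<open>exp \<omega>\<close> from the jump of
  \<open>U\<close> equals the one produced by the drop of \<open>Ln_up\<close> by
  \<open>2 * pi * \<i>\<close>.\<close>

lemma T_limit: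
  assumes c: "log_chart j a0 R \<omega>" and b: "b \<in> imag_ray" and tip: "\<kappa> j + b \<in> ball a0 R"
    and a: "a \<in> ball a0 R"
  shows "\<exists>L. (T j \<omega> b \<longlongrightarrow> L) (at a within off_lines {Re a0})"
proof -
  have Re_tip: "Re (\<kappa> j + b) = Re a0"
    using log_chartD(6)[OF c] b by (simp add: imag_ray_def)
  consider "Re a \<noteq> Re a0 \<or> Im a < Im (\<kappa> j + b)" | "a = \<kappa> j + b" | "a \<in> cut (\<kappa> j + b)"
    using Re_tip by (force simp: cut_def complex_eq_iff)
  then show ?thesis
  proof cases
    case 1
    define S where "S = ball a0 R \<inter> ({k. Re k \<noteq> Re a0} \<union> {k. Im k < Im (\<kappa> j + b)})"
    have "open {k. Re k \<noteq> Re a0}"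
      using open_off_lines[of "{Re a0}"] by (simp add: off_lines_def)
    then have "open S"
      unfolding S_def by (intro open_Int open_Un open_ball open_halfspace_Im_lt)
    moreover have "mat_holomorphic_on (T j \<omega> b) S"
      by (rule T_holomorphic[OF c b]) (auto simp: S_def)
    ultimately have "(T j \<omega> b \<longlongrightarrow> T j \<omega> b a) (at a within off_lines {Re a0})"
      using a 1 by (intro mat_holomorphic_tendsto) (auto simp: S_def)
    then show ?thesis
      by (rule exI)
  next
    case 2
    obtain K where "(T j \<omega> b \<longlongrightarrow> K) (at (\<kappa> j + b) within off_lines {Re a0})"
      using T_tip_limit[OF c b tip] by (elim exE conjE)
    then show ?thesis
      unfolding 2 by (rule exI)
  next
    case 3
    obtain Up Um where Up: "(U b \<longlongrightarrow> Up) (at a within right_side a)"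
      and Um: "(U b \<longlongrightarrow> Um) (at a within left_side a)" and jump: "Up = Um ** H j a"
      using U_shores[OF b log_chartD(1)[OF c] 3] by (elim exE conjE)
    have cut: "a \<in> cut (\<kappa> j)"
      by (rule cut_in_cut[OF b 3])
    have aZ: "a \<notin> Z" "\<omega> a = lf j a"
      using log_chartD(5)[OF c a cut] by simp_all
    have H: "H j a = P a ** diag_mat (\<chi> i. exp (\<omega> a $ i)) ** matrix_inv (P a)"
      using H_eig[OF log_chartD(1)[OF c] cut aZ(1)] by (simp add: aZ(2))
    have aW: "a \<in> W"
      using a log_chartD(3)[OF c] by blast
    have P: "(P \<longlongrightarrow> P a) (at a within S)" for S
      by (rule mat_holomorphic_tendsto[OF P_hol open_W aW])
    have ell: "((\<lambda>k. \<omega> k $ i) \<longlongrightarrow> \<omega> a $ i) (at a within S)" for i S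
    proof -
      have "isCont (\<lambda>k. \<omega> k $ i) a"
        using holomorphic_on_imp_continuous_on[OF log_chartD(4)[OF c]] a
        by (simp add: continuous_on_eq_continuous_at)
      then have "((\<lambda>k. \<omega> k $ i) \<longlongrightarrow> \<omega> a $ i) (at a)"
        by (simp add: isCont_def)
      then show ?thesis
        by (rule Lim_at_imp_Lim_at_within)
    qed
    have E: "((\<lambda>k. diag_mat (\<chi> i. exp (- (\<omega> k $ i / (2 * of_real pi * \<i>)) * Ln_up (k - (\<kappa> j + b)))))
        \<longlongrightarrow> diag_mat (\<chi> i. exp (- (\<omega> a $ i / (2 * of_real pi * \<i>)) * z))) (at a within S)"
      if "((\<lambda>k. Ln_up (k - (\<kappa> j + b))) \<longlongrightarrow> z) (at a within S)" for S z
    proof (rule tendsto_diag_mat)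
      fix i
      have nz: "2 * complex_of_real pi * \<i> \<noteq> 0"
        by simp
      from tendsto_exp[OF tendsto_mult[OF tendsto_minus[OF tendsto_divide[OF ell tendsto_const nz]] that]]
      show "((\<lambda>k. (\<chi> i. exp (- (\<omega> k $ i / (2 * of_real pi * \<i>)) * Ln_up (k - (\<kappa> j + b)))) $ i)
        \<longlongrightarrow> (\<chi> i. exp (- (\<omega> a $ i / (2 * of_real pi * \<i>)) * z)) $ i) (at a within S)"
        by simp
    qed
    have a_cut: "Re a = Re (\<kappa> j + b)" "Im a > Im (\<kappa> j + b)"
      using 3 by (simp_all add: cut_def)
    define z where "z = Ln (a - (\<kappa> j + b))"
    have right: "(T j \<omega> b \<longlongrightarrow> Up ** P a ** diag_mat (\<chi> i. exp (- (\<omega> a $ i / (2 * of_real pi * \<i>)) * z)))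
        (at a within right_side a)"
      unfolding T_def [abs_def]
      by (rule tendsto_matrix_mult[OF tendsto_matrix_mult[OF Up P] E])
        (unfold z_def, rule Ln_up_shores(1)[OF a_cut])
    have left: "(T j \<omega> b \<longlongrightarrow> Um ** P a ** diag_mat (\<chi> i. exp (- (\<omega> a $ i / (2 * of_real pi * \<i>)) *
        (z - 2 * of_real pi * \<i>)))) (at a within left_side a)"
      unfolding T_def [abs_def]
      by (rule tendsto_matrix_mult[OF tendsto_matrix_mult[OF Um P] E])
        (unfold z_def, rule Ln_up_shores(2)[OF a_cut])
    have eq: "exp (\<omega> a $ i) * exp (- (\<omega> a $ i / (2 * of_real pi * \<i>)) * z) =
        exp (- (\<omega> a $ i / (2 * of_real pi * \<i>)) * (z - 2 * of_real pi * \<i>))" for i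
    proof -
      have "- (\<omega> a $ i / (2 * of_real pi * \<i>)) * (z - 2 * of_real pi * \<i>) =
          \<omega> a $ i + - (\<omega> a $ i / (2 * of_real pi * \<i>)) * z"
        by (simp add: right_diff_distrib)
      then show ?thesis
        by (simp only: exp_add)
    qed
    have "invertible (P a)"
      using inv_P aW by blast
    \<comment> \<open>\<open>P\<close> diagonalizes the jump, which therefore moves past
      \<open>P\<close> as a diagonal factor and can be merged with the power.\<close>
    then have "Up ** P a = Um ** P a ** diag_mat (\<chi> i. exp (\<omega> a $ i))"
      by (simp add: jump H matrix_mul_assoc)
    then have "Up ** P a ** diag_mat (\<chi> i. exp (- (\<omega> a $ i / (2 * of_real pi * \<i>)) * z)) =
        Um ** P a ** (diag_mat (\<chi> i. exp (\<omega> a $ i)) ** diag_mat (\<chi> i. exp (- (\<omega> a $ i / (2 * of_real pi * \<i>)) * z)))"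
      by (simp only: matrix_mul_assoc)
    also have "diag_mat (\<chi> i. exp (\<omega> a $ i)) ** diag_mat (\<chi> i. exp (- (\<omega> a $ i / (2 * of_real pi * \<i>)) * z)) =
        diag_mat (\<chi> i. exp (- (\<omega> a $ i / (2 * of_real pi * \<i>)) * (z - 2 * of_real pi * \<i>)))"
      unfolding diag_mat_mult vec_lambda_beta eq ..
    finally have "(T j \<omega> b \<longlongrightarrow> Um ** P a ** diag_mat (\<chi> i. exp (- (\<omega> a $ i / (2 * of_real pi * \<i>)) *
        (z - 2 * of_real pi * \<i>)))) (at a within right_side a)"
      using right by simp
    moreover have "Re a \<in> {Re a0}"
      using a_cut(1) Re_tip by simp
    ultimately have "(T j \<omega> b \<longlongrightarrow> Um ** P a ** diag_mat (\<chi> i. exp (- (\<omega> a $ i / (2 * of_real pi * \<i>)) *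
        (z - 2 * of_real pi * \<i>)))) (at a within off_lines {Re a0})"
      using left by (intro tendsto_off_lines_shores)
    then show ?thesis
      by (rule exI)
  qed
qed

end

section \<open>Dependence of \<open>T\<close> on \<open>b\<close> and the eigenvalues of
  \<open>s\<close>\<close>

context rh_setting
begin

text \<open>Off the vertical line \<open>k\<close> lies on no cut, whatever \<open>b\<close>. The
  base \<open>k - (\<kappa> j + b)\<close> has derivative \<open>-1\<close> in \<open>b\<close> and
  the exponent is negative, hence the plus sign of the last term.\<close>

lemma T_deriv:
  assumes c: "log_chart j a0 R \<omega>" and b: "b \<in> imag_ray" and k: "k \<in> ball a0 R" "Re k \<noteq> Re a0"
  shows "mat_deriv (\<lambda>b. T j \<omega> b k)
    (A b k ** T j \<omega> b k + T j \<omega> b k ** diag_mat (\<chi> i. \<omega> k $ i / (2 * of_real pi * \<i>) / (k - (\<kappa> j + b))))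
    (at b within imag_ray)"
proof -
  define E where "E b = diag_mat (\<chi> i. exp (- (\<omega> k $ i / (2 * of_real pi * \<i>)) * Ln_up (k - (\<kappa> j + b))))" for b
  define L where "L = diag_mat (\<chi> i. \<omega> k $ i / (2 * of_real pi * \<i>) / (k - (\<kappa> j + b)))"
  have off: "k \<notin> cut_union p \<kappa> b'" if "b' \<in> imag_ray" for b'
    using chart_cut_union[OF c that k(1)] k(2) by simp
  have "Re (k - (\<kappa> j + b)) \<noteq> 0"
    using k(2) log_chartD(6)[OF c] b by (simp add: imag_ray_def)
  then have "Re (k - (\<kappa> j + b)) \<noteq> 0 \<or> Im (k - (\<kappa> j + b)) < 0"
    by blast
  note Ln = Ln_up_has_derivative[OF this]
  have "((\<lambda>b. k - (\<kappa> j + b)) has_field_derivative (0 - (0 + 1))) (at b within imag_ray)"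
    by (rule DERIV_diff[OF DERIV_const DERIV_add[OF DERIV_const DERIV_ident]])
  note Ln' = DERIV_chain2[OF Ln this]
  have "((\<lambda>b. E b $ m $ n) has_field_derivative (E b ** L) $ m $ n) (at b within imag_ray)" for m n
  proof (cases "m = n")
    case True
    define u where "u = - (\<omega> k $ m / (2 * of_real pi * \<i>))"
    have "((\<lambda>b. exp (u * Ln_up (k - (\<kappa> j + b)))) has_field_derivative
        exp (u * Ln_up (k - (\<kappa> j + b))) * (u * (1 / (k - (\<kappa> j + b)) * (0 - (0 + 1))))) (at b within imag_ray)"
      by (rule DERIV_chain2[OF DERIV_exp DERIV_cmult[OF Ln']])
    then show ?thesis
      using True by (simp add: E_def L_def diag_mat_entry u_def)
  next
    case False
    then show ?thesis
      by (simp add: E_def L_def diag_mat_entry)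
  qed
  then have E: "mat_deriv E (E b ** L) (at b within imag_ray)"
    by (simp add: mat_deriv_def)
  have "mat_deriv (\<lambda>b. U b k ** P k ** E b)
      ((A b k ** U b k ** P k + U b k ** 0) ** E b + U b k ** P k ** (E b ** L)) (at b within imag_ray)"
    by (rule mat_deriv_mult[OF mat_deriv_mult[OF U_deriv[OF b off] mat_deriv_const] E])
  moreover have T: "T j \<omega> b k = U b k ** P k ** E b" for b
    by (simp only: T_def E_def)
  ultimately show ?thesis
    unfolding T L_def [symmetric] by (simp add: matrix_mult_zero_right matrix_mul_assoc)
qed

lemma half_strip_ray: "imag_ray \<subseteq> half_strip \<epsilon>"
  using eps by (auto simp: imag_ray_def half_strip_def)

lemma s_tendsto:
  assumes "j \<in> {1..p}" "b \<in> imag_ray"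
  shows "(s j \<longlongrightarrow> s j b) (at b within S)"
  by (rule mat_holomorphic_tendsto[OF bspec[OF s_hol assms(1)] open_half_strip
        subsetD[OF half_strip_ray assms(2)]])

lemma s_bounded:
  assumes S: "compact S" "S \<subseteq> imag_ray"
  shows "\<exists>\<sigma>\<ge>0. \<forall>b\<in>S. \<forall>m n. (\<Sum>i=1..p. norm (s i b $ m $ n)) \<le> \<sigma>"
proof -
  define \<Phi> where "\<Phi> b = (\<Sum>m\<in>UNIV. \<Sum>n\<in>UNIV. \<Sum>i=1..p. norm (s i b $ m $ n))" for b
  have "continuous_on S (\<lambda>b. s i b $ m $ n)" if "i \<in> {1..p}" for i m n
    unfolding continuous_on_def
    by (intro ballI tendsto_matrixD s_tendsto that) (use S(2) in blast)
  then have "continuous_on S \<Phi>"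
    unfolding \<Phi>_def by (intro continuous_on_sum continuous_on_norm)
  then have "bounded (\<Phi> ` S)"
    using S(1) compact_continuous_image compact_imp_bounded by blast
  then obtain \<sigma> where \<sigma>: "\<forall>b\<in>S. norm (\<Phi> b) \<le> \<sigma>"
    unfolding bounded_iff by blast
  have "(\<Sum>i=1..p. norm (s i b $ m $ n)) \<le> max \<sigma> 0" if "b \<in> S" for b m n
  proof -
    have "(\<Sum>i=1..p. norm (s i b $ m $ n)) \<le> (\<Sum>n\<in>UNIV. \<Sum>i=1..p. norm (s i b $ m $ n))"
      by (rule member_le_sum[of n UNIV "\<lambda>n. \<Sum>i=1..p. norm (s i b $ m $ n)"]) (auto intro!: sum_nonneg)
    also have "\<dots> \<le> \<Phi> b"
      unfolding \<Phi>_def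
      by (rule member_le_sum[of m UNIV "\<lambda>m. \<Sum>n\<in>UNIV. \<Sum>i=1..p. norm (s i b $ m $ n)"])
        (auto intro!: sum_nonneg)
    also have "\<dots> \<le> \<sigma>"
      using \<sigma> that by force
    finally show ?thesis
      by simp
  qed
  then show ?thesis
    by (intro exI[of _ "max \<sigma> 0"]) auto
qed

lemma T_extension:
  assumes c: "log_chart j a0 R \<omega>" and b: "b \<in> imag_ray" and tip: "\<kappa> j + b \<in> ball a0 R"
  shows "\<exists>g. g holomorphic_on ball a0 R \<and> (\<forall>k\<in>ball a0 R \<inter> off_lines {Re a0}. g k = T j \<omega> b k $ m $ n) \<and>
    (\<forall>a\<in>ball a0 R. ((\<lambda>k. T j \<omega> b k $ m $ n) \<longlongrightarrow> g a) (at a within off_lines {Re a0}))"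
proof (rule holomorphic_extension_across_lines)
  have "mat_holomorphic_on (T j \<omega> b) (ball a0 R \<inter> off_lines {Re a0})"
    by (rule T_holomorphic[OF c b]) (auto simp: off_lines_def)
  then show "(\<lambda>k. T j \<omega> b k $ m $ n) holomorphic_on ball a0 R \<inter> off_lines {Re a0}"
    by (simp add: mat_holomorphic_on_def)
  fix a assume "a \<in> ball a0 R"
  then obtain L where "(T j \<omega> b \<longlongrightarrow> L) (at a within off_lines {Re a0})"
    using T_limit[OF c b tip] by blast
  from tendsto_matrixD[OF this, of m n]
  show "\<exists>l. ((\<lambda>k. T j \<omega> b k $ m $ n) \<longlongrightarrow> l) (at a within off_lines {Re a0})"
    by (rule exI)
qed simp_all

text \<open>The holomorphic extension is continuous on the compact smaller disc, which gives a bound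
  right up to the cut and the tip.\<close>

lemma T_bounded:
  assumes c: "log_chart j a0 R \<omega>" and b: "b \<in> imag_ray" and tip: "\<kappa> j + b \<in> ball a0 R" and r: "r < R"
  shows "\<exists>\<tau>\<ge>0. \<forall>k\<in>cball a0 r \<inter> off_lines {Re a0}. (\<Sum>i\<in>UNIV. \<Sum>l\<in>UNIV. norm (T j \<omega> b k $ i $ l)) \<le> \<tau>"
proof -
  have "\<exists>\<tau>. \<forall>k\<in>cball a0 r \<inter> off_lines {Re a0}. norm (T j \<omega> b k $ i $ l) \<le> \<tau>" for i l
  proof -
    obtain g where g: "g holomorphic_on ball a0 R"
      and gT: "\<forall>k\<in>ball a0 R \<inter> off_lines {Re a0}. g k = T j \<omega> b k $ i $ l"
      using T_extension[OF c b tip, of i l] by (elim exE conjE)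
    have sub: "cball a0 r \<subseteq> ball a0 R"
      using r by auto
    have "continuous_on (cball a0 r) g"
      by (rule continuous_on_subset[OF holomorphic_on_imp_continuous_on[OF g] sub])
    then have "bounded (g ` cball a0 r)"
      using compact_continuous_image compact_cball compact_imp_bounded by blast
    then obtain \<tau> where "\<forall>k\<in>cball a0 r. norm (g k) \<le> \<tau>"
      unfolding bounded_iff by blast
    moreover have "g k = T j \<omega> b k $ i $ l" if "k \<in> cball a0 r \<inter> off_lines {Re a0}" for k
      by (rule bspec[OF gT]) (use that sub in blast)
    ultimately have "\<forall>k\<in>cball a0 r \<inter> off_lines {Re a0}. norm (T j \<omega> b k $ i $ l) \<le> \<tau>"
      by (metis IntD1)
    then show ?thesis
      by (rule exI)
  qed
  then obtain \<tau> where \<tau>: "\<And>i l. \<forall>k\<in>cball a0 r \<inter> off_lines {Re a0}. norm (T j \<omega> b k $ i $ l) \<le> \<tau> i l"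
    by metis
  have "(\<Sum>i\<in>UNIV. \<Sum>l\<in>UNIV. norm (T j \<omega> b k $ i $ l)) \<le> (\<Sum>i\<in>UNIV. \<Sum>l\<in>UNIV. \<tau> i l)"
    if "k \<in> cball a0 r \<inter> off_lines {Re a0}" for k
    using \<tau> that by (intro sum_mono) blast
  then show ?thesis
    by (intro exI[of _ "max 0 (\<Sum>i\<in>UNIV. \<Sum>l\<in>UNIV. \<tau> i l)"]) (auto intro: max.coboundedI2)
qed

text \<open>The tip of \<open>j\<close> stays within \<open>R / 4\<close> of the centre and the
  annulus starts at \<open>3 * R / 8\<close>, which leaves \<open>R / 8\<close>. The other tips are
  at horizontal distance at least \<open>R\<close> from the centre, and the annulus ends at
  \<open>5 * R / 8\<close>.\<close>

lemma chart_distance: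
  assumes c: "log_chart j a0 R \<omega>" and b: "b \<in> imag_ray" "dist (\<kappa> j + b) a0 \<le> R / 4"
    and k: "3 * R / 8 < dist a0 k" "dist a0 k < 5 * R / 8" and i: "i \<in> {1..p}"
  shows "R / 8 \<le> norm (k - (\<kappa> i + b))"
proof (cases "i = j")
  case True
  have "dist a0 k \<le> dist a0 (\<kappa> j + b) + dist (\<kappa> j + b) k"
    by (rule dist_triangle)
  then have "R / 8 \<le> dist (\<kappa> j + b) k"
    using b(2) k(1) by (simp add: dist_commute)
  then show ?thesis
    using True by (simp add: dist_norm norm_minus_commute)
next
  case False
  have "R \<le> \<bar>Re (\<kappa> i) - Re (\<kappa> j)\<bar>"
    by (rule log_chartD(8)[OF c i False])
  also have "\<dots> \<le> \<bar>Re (k - (\<kappa> i + b))\<bar> + \<bar>Re (k - a0)\<bar>"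
    using b(1) log_chartD(6)[OF c] by (simp add: imag_ray_def)
  also have "\<dots> \<le> norm (k - (\<kappa> i + b)) + dist a0 k"
    using abs_Re_le_cmod[of "k - (\<kappa> i + b)"] abs_Re_le_cmod[of "k - a0"]
    by (simp add: dist_norm norm_minus_commute)
  finally show ?thesis
    using k(2) log_chartD(2)[OF c] by simp
qed

text \<open>The maximum principle carries the Lipschitz bound in \<open>b\<close> from an annulus around the tip,
  where the coefficients of the equation are bounded, to the punctured disc.\<close>

lemma T_Lipschitz:
  assumes c: "log_chart j a0 R \<omega>" and b0: "b0 \<in> imag_ray" "a0 = \<kappa> j + b0"
  shows "\<exists>C \<delta>. \<delta> > 0 \<and> (\<forall>b\<in>imag_ray. dist b b0 \<le> \<delta> \<longrightarrow>
    (\<forall>k\<in>ball a0 (R / 2) \<inter> off_lines {Re a0}. \<forall>m n.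
      norm (T j \<omega> b k $ m $ n - T j \<omega> b0 k $ m $ n) \<le> C * norm (b - b0)))"
proof -
  have R: "R > 0"
    by (rule log_chartD(2)[OF c])
  \<comment> \<open>As \<open>a0\<close> is the tip for \<open>b0\<close>, its height above
    \<open>\<kappa> j\<close> is \<open>Im b0\<close>; parameters within \<open>R / 4\<close> of
    \<open>b0\<close> on the imaginary axis therefore stay on the ray.\<close>
  have ImR: "R \<le> Im b0"
    using log_chartD(7)[OF c] by (simp add: b0(2))
  define S where "S \<delta> = {b. Re b = 0} \<inter> cball b0 \<delta>" for \<delta>
  have S: "convex (S \<delta>)" "compact (S \<delta>)" for \<delta>
  proof -
    have re: "{b. Re b = 0} = {b. inner 1 b = (0::real)}"
      by (simp add: inner_complex_def)
    show "convex (S \<delta>)"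
      unfolding S_def re by (intro convex_Int convex_hyperplane convex_cball)
    show "compact (S \<delta>)"
      unfolding S_def re by (intro closed_Int_compact closed_hyperplane compact_cball)
  qed
  have S_ray: "S \<delta> \<subseteq> imag_ray" if "\<delta> \<le> R / 4" for \<delta>
  proof
    fix b assume b: "b \<in> S \<delta>"
    have "\<bar>Im (b0 - b)\<bar> \<le> norm (b0 - b)"
      by (rule abs_Im_le_cmod)
    also have "\<dots> \<le> R / 4"
      using b that by (simp add: S_def dist_norm)
    finally have "Im b > 0"
      using ImR R unfolding minus_complex.sel by linarith
    then show "b \<in> imag_ray"
      using b by (simp add: S_def imag_ray_def)
  qed
  obtain \<sigma> where \<sigma>: "\<sigma> \<ge> 0" "\<forall>b\<in>S (R / 4). \<forall>m n. (\<Sum>i=1..p. norm (s i b $ m $ n)) \<le> \<sigma>"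
    using s_bounded[OF S(2) S_ray[OF order.refl]] by (elim exE conjE)
  have tip0: "\<kappa> j + b0 \<in> ball a0 R"
    using R by (simp add: b0(2))
  have r: "5 * R / 8 < R"
    using R by simp
  obtain \<tau> where \<tau>: "\<tau> \<ge> 0" "\<forall>k\<in>cball a0 (5 * R / 8) \<inter> off_lines {Re a0}.
      (\<Sum>i\<in>UNIV. \<Sum>l\<in>UNIV. norm (T j \<omega> b0 k $ i $ l)) \<le> \<tau>"
    using T_bounded[OF c b0(1) tip0 r] by (elim exE conjE)
  define L where "L k i = \<omega> k $ i / (2 * of_real pi * \<i>)" for k i
  have "\<exists>\<mu>. \<forall>k\<in>cball a0 (5 * R / 8). norm (\<Sum>i\<in>UNIV. norm (L k i)) \<le> \<mu>"
  proof -
    have "continuous_on (cball a0 (5 * R / 8)) (\<lambda>k. \<omega> k $ i)" for i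
      by (rule continuous_on_subset[OF holomorphic_on_imp_continuous_on[OF log_chartD(4)[OF c]]])
        (use R in auto)
    then have "continuous_on (cball a0 (5 * R / 8)) (\<lambda>k. \<Sum>i\<in>UNIV. norm (L k i))"
      unfolding L_def by (intro continuous_on_sum continuous_on_norm continuous_on_divide continuous_on_const) auto
    then have "bounded ((\<lambda>k. \<Sum>i\<in>UNIV. norm (L k i)) ` cball a0 (5 * R / 8))"
      using compact_continuous_image compact_cball compact_imp_bounded by blast
    then show ?thesis
      unfolding bounded_iff by simp
  qed
  then obtain \<mu> where mu0: "\<forall>k\<in>cball a0 (5 * R / 8). norm (\<Sum>i\<in>UNIV. norm (L k i)) \<le> \<mu>"
    by (rule exE)
  have mu: "norm (L k i) \<le> \<mu>" if "k \<in> cball a0 (5 * R / 8)" for k i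
  proof -
    have "norm (L k i) \<le> (\<Sum>i\<in>UNIV. norm (L k i))"
      by (rule member_le_sum[of i UNIV "\<lambda>i. norm (L k i)"]) auto
    also have "\<dots> \<le> \<mu>"
      using bspec[OF mu0 that] by simp
    finally show ?thesis .
  qed
  have mu_ge: "\<mu> \<ge> 0"
    using order_trans[OF norm_ge_zero mu[of a0]] R by simp
  \<comment> \<open>On the annulus \<open>8 / R\<close> bounds the reciprocal distances to all tips,
    \<open>\<sigma>\<close> the coefficients \<open>s i\<close>, and \<open>\<mu>\<close> the
    exponents; together they bound the linear equation for \<open>T\<close>.\<close>
  define \<gamma> where "\<gamma> = 8 / R * (\<sigma> + \<mu>)"
  have \<gamma>: "\<gamma> \<ge> 0"
    unfolding \<gamma>_def using R \<sigma>(1) mu_ge by simp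
  \<comment> \<open>The second bound is the smallness condition of the growth estimate; its summand
    \<open>1\<close> keeps the denominator positive when \<open>\<gamma>\<close> is zero.\<close>
  define \<delta> where "\<delta> = min (R / 4) (1 / (2 * (real (CARD('n) * CARD('n)) * \<gamma> + 1)))"
  have \<delta>: "\<delta> > 0" "\<delta> \<le> R / 4"
    using R \<gamma> by (simp_all add: \<delta>_def add_nonneg_pos)
  have small: "real (CARD('n) * CARD('n)) * \<gamma> * x \<le> 1 / 2" if "0 \<le> x" "x \<le> \<delta>" for x
  proof -
    define N where "N = real (CARD('n) * CARD('n)) * \<gamma>"
    have N: "N \<ge> 0"
      unfolding N_def using \<gamma> by simp
    have "x \<le> 1 / (2 * (N + 1))"
      using that by (simp add: \<delta>_def N_def)
    then have "N * x \<le> N * (1 / (2 * (N + 1)))"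
      using N by (rule mult_left_mono)
    also have "\<dots> \<le> 1 / 2"
      using N by (simp add: divide_simps)
    finally show ?thesis
      by (simp add: N_def)
  qed
  \<comment> \<open>An annulus around the circle of radius \<open>R / 2\<close>, with the line
    removed. The circle meets the line in two points, which are reached by limits from the
    annulus.\<close>
  define An where "An = {k. 3 * R / 8 < dist a0 k \<and> dist a0 k < 5 * R / 8} \<inter> off_lines {Re a0}"
  have bound: "norm (T j \<omega> b k $ m $ n - T j \<omega> b0 k $ m $ n) \<le> 2 * \<gamma> * \<tau> * norm (b - b0)"
    if k: "k \<in> An" and b: "b \<in> S \<delta>" for k b m n
  proof -
    have kk: "k \<in> ball a0 R" "Re k \<noteq> Re a0" "3 * R / 8 < dist a0 k" "dist a0 k < 5 * R / 8"
      using k r by (auto simp: An_def off_lines_def)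
    define D where "D b = A b k ** T j \<omega> b k + T j \<omega> b k ** diag_mat (\<chi> i. L k i / (k - (\<kappa> j + b)))" for b
    have "norm (T j \<omega> b k $ m $ n - T j \<omega> b0 k $ m $ n) \<le>
        2 * \<gamma> * (\<Sum>i\<in>UNIV. \<Sum>l\<in>UNIV. norm (T j \<omega> b0 k $ i $ l)) * norm (b - b0)"
    proof (rule field_derivative_growth_bound[where D = D and S = "S \<delta>"])
      show "b0 \<in> S \<delta>"
        using b0(1) \<delta>(1) by (simp add: S_def imag_ray_def)
      fix b assume bS: "b \<in> S \<delta>"
      have ray: "b \<in> imag_ray"
        using S_ray[OF \<delta>(2)] bS by blast
      have bS4: "b \<in> S (R / 4)"
        using bS \<delta>(2) by (simp add: S_def)
      have "mat_deriv (\<lambda>b. T j \<omega> b k) (D b) (at b within imag_ray)"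
        using T_deriv[OF c ray kk(1,2)] by (simp add: D_def L_def)
      then show "mat_deriv (\<lambda>b. T j \<omega> b k) (D b) (at b within S \<delta>)"
        unfolding mat_deriv_def using DERIV_subset[OF _ S_ray[OF \<delta>(2)]] by blast
      have near: "dist (\<kappa> j + b) a0 \<le> R / 4"
        using bS4 by (simp add: S_def b0(2) dist_commute)
      have dist: "1 / norm (k - (\<kappa> i + b)) \<le> 8 / R" if "i \<in> {1..p}" for i
      proof -
        have "1 / norm (k - (\<kappa> i + b)) \<le> 1 / (R / 8)"
          using R by (intro frac_le chart_distance[OF c ray near kk(3,4) that]) simp_all
        then show ?thesis
          by simp
      qed
      show "norm (D b $ m $ n) \<le> \<gamma> * (\<Sum>i\<in>UNIV. \<Sum>l\<in>UNIV. norm (T j \<omega> b k $ i $ l))" for m n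
      proof -
        define \<phi> where "\<phi> = (\<Sum>i\<in>UNIV. \<Sum>l\<in>UNIV. norm (T j \<omega> b k $ i $ l))"
        have entry: "(\<Sum>l\<in>UNIV. norm (T j \<omega> b k $ l $ n)) \<le> \<phi>"
          unfolding \<phi>_def by (intro sum_mono member_le_sum) auto
        have A: "norm (A b k $ m $ l) \<le> 8 / R * \<sigma>" for l
        proof -
          have "norm (A b k $ m $ l) \<le> (\<Sum>i=1..p. norm (1 / (k - (\<kappa> i + b)) * s i b $ m $ l))"
            unfolding A_def by (simp only: sum_component mat_mult_entry) (rule norm_sum)
          also have "\<dots> \<le> (\<Sum>i=1..p. 8 / R * norm (s i b $ m $ l))"
            using dist by (intro sum_mono) (simp only: norm_mult norm_divide norm_one mult_right_mono norm_ge_zero)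
          also have "\<dots> = 8 / R * (\<Sum>i=1..p. norm (s i b $ m $ l))"
            by (simp only: sum_distrib_left)
          also have "\<dots> \<le> 8 / R * \<sigma>"
            using \<sigma>(2) bS4 R by (intro mult_left_mono) simp_all
          finally show ?thesis .
        qed
        have "norm ((A b k ** T j \<omega> b k) $ m $ n) \<le> (\<Sum>l\<in>UNIV. norm (A b k $ m $ l * T j \<omega> b k $ l $ n))"
          unfolding matrix_mult_entry by (rule norm_sum)
        also have "\<dots> \<le> (\<Sum>l\<in>UNIV. 8 / R * \<sigma> * norm (T j \<omega> b k $ l $ n))"
          unfolding norm_mult by (intro sum_mono mult_right_mono A norm_ge_zero)
        also have "\<dots> = 8 / R * \<sigma> * (\<Sum>l\<in>UNIV. norm (T j \<omega> b k $ l $ n))"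
          by (simp only: sum_distrib_left)
        also have "\<dots> \<le> 8 / R * \<sigma> * \<phi>"
          using R \<sigma>(1) by (intro mult_left_mono entry) simp
        finally have 1: "norm ((A b k ** T j \<omega> b k) $ m $ n) \<le> 8 / R * \<sigma> * \<phi>" .
        have "norm (L k n / (k - (\<kappa> j + b))) = norm (L k n) * (1 / norm (k - (\<kappa> j + b)))"
          by (simp add: norm_divide)
        also have "\<dots> \<le> \<mu> * (8 / R)"
          using kk(4) by (intro mult_mono mu dist log_chartD(1)[OF c] mu_ge) simp_all
        finally have Ln: "norm (L k n / (k - (\<kappa> j + b))) \<le> \<mu> * (8 / R)" .
        have "norm (T j \<omega> b k $ m $ n) \<le> (\<Sum>l\<in>UNIV. norm (T j \<omega> b k $ l $ n))"
          by (rule member_le_sum[of m UNIV "\<lambda>l. norm (T j \<omega> b k $ l $ n)"]) auto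
        then have "norm (T j \<omega> b k $ m $ n) \<le> \<phi>"
          using entry by (rule order_trans)
        then have "norm (T j \<omega> b k $ m $ n * (L k n / (k - (\<kappa> j + b)))) \<le> \<phi> * (\<mu> * (8 / R))"
          unfolding norm_mult by (intro mult_mono Ln) (auto simp: \<phi>_def intro!: sum_nonneg)
        then have 2: "norm ((T j \<omega> b k ** diag_mat (\<chi> i. L k i / (k - (\<kappa> j + b)))) $ m $ n) \<le> \<phi> * (\<mu> * (8 / R))"
          by simp
        have "norm (D b $ m $ n) \<le> 8 / R * \<sigma> * \<phi> + \<phi> * (\<mu> * (8 / R))"
          unfolding D_def vector_add_component by (rule order_trans[OF norm_triangle_ineq add_mono[OF 1 2]])
        also have "\<dots> = \<gamma> * \<phi>"
          by (simp add: \<gamma>_def algebra_simps add_divide_distrib)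
        finally show ?thesis
          by (simp only: \<phi>_def)
      qed
      show "real (CARD('n) * CARD('n)) * \<gamma> * norm (b - b0) \<le> 1 / 2"
        using bS by (intro small) (simp_all add: S_def dist_norm norm_minus_commute)
    qed (use S \<gamma> b in simp_all)
    also have "\<dots> \<le> 2 * \<gamma> * \<tau> * norm (b - b0)"
      using \<tau>(2) k \<gamma> by (intro mult_right_mono mult_left_mono) (simp_all add: An_def)
    finally show ?thesis .
  qed
  have main: "norm (T j \<omega> b k $ m $ n - T j \<omega> b0 k $ m $ n) \<le> 2 * \<gamma> * \<tau> * norm (b - b0)"
    if b: "b \<in> S \<delta>" and k: "k \<in> ball a0 (R / 2) \<inter> off_lines {Re a0}" for b k m n
  proof -
    have ray: "b \<in> imag_ray"
      using S_ray[OF \<delta>(2)] b by blast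
    have tip: "\<kappa> j + b \<in> ball a0 R"
      using b \<delta>(2) R by (simp add: S_def b0(2))
    obtain g where g: "g holomorphic_on ball a0 R"
      and gT: "\<forall>k\<in>ball a0 R \<inter> off_lines {Re a0}. g k = T j \<omega> b k $ m $ n"
      and gl: "\<forall>a\<in>ball a0 R. ((\<lambda>k. T j \<omega> b k $ m $ n) \<longlongrightarrow> g a) (at a within off_lines {Re a0})"
      using T_extension[OF c ray tip, of m n] by (elim exE conjE)
    obtain g0 where g0: "g0 holomorphic_on ball a0 R"
      and g0T: "\<forall>k\<in>ball a0 R \<inter> off_lines {Re a0}. g0 k = T j \<omega> b0 k $ m $ n"
      and g0l: "\<forall>a\<in>ball a0 R. ((\<lambda>k. T j \<omega> b0 k $ m $ n) \<longlongrightarrow> g0 a) (at a within off_lines {Re a0})"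
      using T_extension[OF c b0(1) tip0, of m n] by (elim exE conjE)
    have hol: "(\<lambda>k. g k - g0 k) holomorphic_on ball a0 R"
      by (rule holomorphic_on_diff[OF g g0])
    \<comment> \<open>The extensions are holomorphic through both tips, for \<open>b\<close> and for
      \<open>b0\<close>, so their difference obeys the maximum principle on the whole disc.\<close>
    have "norm (g k - g0 k) \<le> 2 * \<gamma> * \<tau> * norm (b - b0)"
    proof (rule maximum_modulus_frontier[of "\<lambda>k. g k - g0 k" "cball a0 (R / 2)"])
      show "(\<lambda>k. g k - g0 k) holomorphic_on interior (cball a0 (R / 2))"
        by (rule holomorphic_on_subset[OF hol]) (use R in auto)
      show "continuous_on (closure (cball a0 (R / 2))) (\<lambda>k. g k - g0 k)"
        by (rule continuous_on_subset[OF holomorphic_on_imp_continuous_on[OF hol]]) (use R in auto)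
      show "k \<in> cball a0 (R / 2)"
        using k by auto
      fix z assume "z \<in> frontier (cball a0 (R / 2))"
      then have z: "dist a0 z = R / 2"
        using R by simp
      have zR: "z \<in> ball a0 R"
        using z R by simp
      have lim: "((\<lambda>k. norm (T j \<omega> b k $ m $ n - T j \<omega> b0 k $ m $ n)) \<longlongrightarrow> norm (g z - g0 z))
          (at z within off_lines {Re a0})"
        by (rule tendsto_norm[OF tendsto_diff[OF bspec[OF gl zR] bspec[OF g0l zR]]])
      have "\<forall>\<^sub>F k in nhds z. k \<in> ball a0 (5 * R / 8) - cball a0 (3 * R / 8)"
        using z R by (intro eventually_nhds_in_open open_Diff) auto
      then have "\<forall>\<^sub>F k in at z within off_lines {Re a0}.
          norm (T j \<omega> b k $ m $ n - T j \<omega> b0 k $ m $ n) \<le> 2 * \<gamma> * \<tau> * norm (b - b0)"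
        unfolding eventually_at_filter
      proof eventually_elim
        case (elim k)
        have "k \<in> An" if "k \<in> off_lines {Re a0}"
          using elim that by (simp add: An_def)
        then show ?case
          using bound[OF _ b] by blast
      qed
      then show "norm (g z - g0 z) \<le> 2 * \<gamma> * \<tau> * norm (b - b0)"
        by (rule tendsto_upperbound[OF lim]) (rule off_lines_dense, simp)
    qed simp
    moreover have "k \<in> ball a0 R \<inter> off_lines {Re a0}"
      using k R by auto
    ultimately show ?thesis
      using bspec[OF gT] bspec[OF g0T] by simp
  qed
  have Lip: "\<forall>b\<in>imag_ray. dist b b0 \<le> \<delta> \<longrightarrow>
    (\<forall>k\<in>ball a0 (R / 2) \<inter> off_lines {Re a0}. \<forall>m n.
      norm (T j \<omega> b k $ m $ n - T j \<omega> b0 k $ m $ n) \<le> 2 * \<gamma> * \<tau> * norm (b - b0))"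
  proof (intro ballI impI allI)
    fix b k m n
    assume b: "b \<in> imag_ray" "dist b b0 \<le> \<delta>" and k: "k \<in> ball a0 (R / 2) \<inter> off_lines {Re a0}"
    have "b \<in> S \<delta>"
      using b by (simp add: S_def imag_ray_def dist_commute)
    then show "norm (T j \<omega> b k $ m $ n - T j \<omega> b0 k $ m $ n) \<le> 2 * \<gamma> * \<tau> * norm (b - b0)"
      by (rule main[OF _ k])
  qed
  show ?thesis
    by (rule exI[of _ "2 * \<gamma> * \<tau>"], rule exI[of _ \<delta>], rule conjI[OF \<delta>(1) Lip])
qed

lemma s_same_eigenvalues_generic:
  assumes j: "j \<in> {1..p}" and b0: "b0 \<in> imag_ray" "\<kappa> j + b0 \<notin> Z"
  shows "same_eigenvalues (s j b0) (F_tilde \<kappa> lf j b0)"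
proof -
  define a0 where "a0 = \<kappa> j + b0"
  define X1 where "X1 = off_lines {Re a0}"
  have dense: "at a0 within X1 \<noteq> bot"
    unfolding X1_def by (rule off_lines_dense) simp
  have a0: "a0 \<in> cut (\<kappa> j)"
    unfolding a0_def by (rule tip_in_cut[OF b0(1)])
  obtain R \<omega> where c: "log_chart j a0 R \<omega>"
    using log_chart_exists[OF j a0] b0(2) unfolding a0_def by blast
  have R: "R > 0"
    by (rule log_chartD(2)[OF c])
  have tip: "\<kappa> j + b0 \<in> ball a0 R"
    using R by (simp add: a0_def)
  obtain K where K: "invertible K" and TK: "(T j \<omega> b0 \<longlongrightarrow> K) (at a0 within X1)"
    using T_tip_limit[OF c b0(1) tip] unfolding X1_def a0_def by (elim exE conjE)
  define L where "L k = diag_mat (\<chi> i. \<omega> k $ i / (2 * of_real pi * \<i>))" for k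
  define D where "D k = A b0 k ** T j \<omega> b0 k +
    T j \<omega> b0 k ** diag_mat (\<chi> i. \<omega> k $ i / (2 * of_real pi * \<i>) / (k - (\<kappa> j + b0)))" for k
  obtain C \<delta> where \<delta>: "\<delta> > 0" and Lip: "\<forall>b\<in>imag_ray. dist b b0 \<le> \<delta> \<longrightarrow>
      (\<forall>k\<in>ball a0 (R / 2) \<inter> off_lines {Re a0}. \<forall>m n.
        norm (T j \<omega> b k $ m $ n - T j \<omega> b0 k $ m $ n) \<le> C * norm (b - b0))"
    using T_Lipschitz[OF c b0(1) a0_def] by (elim exE conjE)
  \<comment> \<open>The derivative in \<open>b\<close> is a limit of difference quotients, and the
    Lipschitz constant is the same for all \<open>k\<close> off the line.\<close>
  have D_bound: "norm (D k $ m $ n) \<le> C" if k: "k \<in> ball a0 (R / 2)" "k \<in> X1" for k m n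
  proof -
    have kR: "k \<in> ball a0 R" "Re k \<noteq> Re a0"
      using k R by (auto simp: X1_def off_lines_def)
    have "((\<lambda>b. T j \<omega> b k $ m $ n) has_field_derivative D k $ m $ n) (at b0 within imag_ray)"
      using T_deriv[OF c b0(1) kR] by (simp add: mat_deriv_def D_def)
    then have lim: "((\<lambda>b. norm ((T j \<omega> b k $ m $ n - T j \<omega> b0 k $ m $ n) / (b - b0))) \<longlongrightarrow> norm (D k $ m $ n))
        (at b0 within imag_ray)"
      unfolding has_field_derivative_iff by (rule tendsto_norm)
    have "\<forall>\<^sub>F b in at b0 within imag_ray. norm ((T j \<omega> b k $ m $ n - T j \<omega> b0 k $ m $ n) / (b - b0)) \<le> C"
      unfolding eventually_at
    proof (intro exI[of _ \<delta>] conjI \<delta> ballI impI)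
      fix b assume b: "b \<in> imag_ray" "b \<noteq> b0 \<and> dist b b0 < \<delta>"
      have "dist b b0 \<le> \<delta>"
        using b(2) by simp
      note Lipb = mp[OF bspec[OF Lip b(1)] this]
      have "k \<in> ball a0 (R / 2) \<inter> off_lines {Re a0}"
        using k by (simp add: X1_def)
      note Lipk = bspec[OF Lipb this]
      have "norm (T j \<omega> b k $ m $ n - T j \<omega> b0 k $ m $ n) \<le> C * norm (b - b0)"
        by (rule spec[OF spec[OF Lipk]])
      then show "norm ((T j \<omega> b k $ m $ n - T j \<omega> b0 k $ m $ n) / (b - b0)) \<le> C"
        using b(2) by (simp add: norm_divide divide_le_eq)
    qed
    then show ?thesis
      using imag_ray_dense[OF finite.emptyI b0(1)] by (intro tendsto_upperbound[OF lim]) simp_all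
  qed
  have ev: "\<forall>\<^sub>F k in at a0 within X1. k \<in> ball a0 (R / 2) \<and> k \<in> X1 \<and> k \<noteq> a0"
  proof -
    have "\<forall>\<^sub>F k in nhds a0. k \<in> ball a0 (R / 2)"
      using R by (intro eventually_nhds_in_open) simp_all
    then show ?thesis
      unfolding eventually_at_filter by eventually_elim simp
  qed
  \<comment> \<open>One limit is evaluated twice: as zero, by boundedness of \<open>D\<close>, and
    further below as the sum of the contributions of its two singular terms.\<close>
  have zero: "((\<lambda>k. mat (k - a0) ** D k) \<longlongrightarrow> 0) (at a0 within X1)"
  proof (rule tendsto_matrixI)
    fix m n
    have "((\<lambda>k. (k - a0) * D k $ m $ n) \<longlongrightarrow> 0) (at a0 within X1)"
    proof (rule Lim_null_comparison)
      show "\<forall>\<^sub>F k in at a0 within X1. norm ((k - a0) * D k $ m $ n) \<le> norm (k - a0) * C"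
        using ev
      proof eventually_elim
        case (elim k)
        then show ?case
          unfolding norm_mult by (intro mult_left_mono D_bound) simp_all
      qed
      have "((\<lambda>k. norm (k - a0) * C) \<longlongrightarrow> norm (a0 - a0) * C) (at a0 within X1)"
        by (intro tendsto_mult tendsto_norm tendsto_diff tendsto_ident_at tendsto_const)
      then show "((\<lambda>k. norm (k - a0) * C) \<longlongrightarrow> 0) (at a0 within X1)"
        by simp
    qed
    then show "((\<lambda>k. (mat (k - a0) ** D k) $ m $ n) \<longlongrightarrow> 0 $ m $ n) (at a0 within X1)"
      by simp
  qed
  have sA: "((\<lambda>k. mat (k - a0) ** A b0 k) \<longlongrightarrow> s j b0) (at a0 within X1)"
  proof (rule tendsto_matrixI)
    fix m n
    have fin: "finite {1..p}"
      by simp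
    have "((\<lambda>k. (k - (\<kappa> j + b0)) * (\<Sum>i=1..p. s i b0 $ m $ n / (k - (\<kappa> i + b0)))) \<longlongrightarrow> s j b0 $ m $ n)
        (at (\<kappa> j + b0) within X1)"
      by (rule tendsto_leading_fraction[OF fin j tips_inj, of "\<lambda>i _. s i b0 $ m $ n"]) (rule tendsto_const)
    then show "((\<lambda>k. (mat (k - a0) ** A b0 k) $ m $ n) \<longlongrightarrow> s j b0 $ m $ n) (at a0 within X1)"
      by (simp add: A_def a0_def)
  qed
  have LL: "(L \<longlongrightarrow> L a0) (at a0 within X1)"
    unfolding L_def
  proof (rule tendsto_diag_mat)
    fix i
    have "isCont (\<lambda>k. \<omega> k $ i) a0"
      using holomorphic_on_imp_continuous_on[OF log_chartD(4)[OF c]] R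
      by (simp add: continuous_on_eq_continuous_at)
    then have "((\<lambda>k. \<omega> k $ i) \<longlongrightarrow> \<omega> a0 $ i) (at a0)"
      by (simp add: isCont_def)
    then have "((\<lambda>k. \<omega> k $ i) \<longlongrightarrow> \<omega> a0 $ i) (at a0 within X1)"
      by (rule Lim_at_imp_Lim_at_within)
    from tendsto_divide[OF this tendsto_const, of "2 * of_real pi * \<i>"]
    show "((\<lambda>k. (\<chi> i. \<omega> k $ i / (2 * of_real pi * \<i>)) $ i) \<longlongrightarrow>
        (\<chi> i. \<omega> a0 $ i / (2 * of_real pi * \<i>)) $ i) (at a0 within X1)"
      by simp
  qed
  have lim: "((\<lambda>k. mat (k - a0) ** A b0 k ** T j \<omega> b0 k + T j \<omega> b0 k ** L k) \<longlongrightarrow>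
      s j b0 ** K + K ** L a0) (at a0 within X1)"
    by (rule tendsto_add[OF tendsto_matrix_mult[OF sA TK] tendsto_matrix_mult[OF TK LL]])
  have "\<forall>\<^sub>F k in at a0 within X1. mat (k - a0) ** A b0 k ** T j \<omega> b0 k + T j \<omega> b0 k ** L k =
      mat (k - a0) ** D k"
    using ev
  proof eventually_elim
    case (elim k)
    then have "k - a0 \<noteq> 0"
      by simp
    define E where "E = diag_mat (\<chi> i. \<omega> k $ i / (2 * of_real pi * \<i>) / (k - (\<kappa> j + b0)))"
    have "L k = E ** mat (k - a0)"
      using \<open>k - a0 \<noteq> 0\<close> by (intro matrix_eqI) (simp add: L_def E_def diag_mat_entry a0_def)
    then have "T j \<omega> b0 k ** L k = mat (k - a0) ** (T j \<omega> b0 k ** E)"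
      by (simp only: trans[OF matrix_mul_assoc mat_commute])
    then show ?case
      unfolding D_def E_def[symmetric] matrix_add_ldistrib by (simp only: matrix_mul_assoc)
  qed
  from tendsto_unique[OF dense Lim_transform_eventually[OF lim this] zero]
  have "s j b0 ** K = - (K ** L a0)"
    by (simp add: eq_neg_iff_add_eq_0)
  also have "\<dots> = K ** (- L a0)"
    by (simp only: matrix_mult_minus_right)
  \<comment> \<open>This is the origin of the minus sign in \<open>F_tilde\<close>; at the tip
    \<open>\<omega>\<close> agrees with \<open>lf\<close>.\<close>
  also have "- L a0 = F_tilde \<kappa> lf j b0"
  proof -
    have "a0 \<in> ball a0 R"
      using R by simp
    then have "\<omega> a0 = lf j a0"
      by (rule conjunct2[OF log_chartD(5)[OF c _ a0]])
    then show ?thesis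
      by (intro matrix_eqI) (simp add: L_def F_tilde_def diag_mat_entry a0_def)
  qed
  finally have "s j b0 ** K ** matrix_inv K = K ** F_tilde \<kappa> lf j b0 ** matrix_inv K"
    by (simp only:)
  then have s: "s j b0 = K ** F_tilde \<kappa> lf j b0 ** matrix_inv K"
    by (simp only: mult_inv_cancel[OF K])
  show ?thesis
    unfolding same_eigenvalues_def
  proof
    fix z
    show "det (mat z - s j b0) = det (mat z - F_tilde \<kappa> lf j b0)"
      unfolding s by (rule similar_det[OF K])
  qed
qed

text \<open>Characteristic polynomials, unlike a diagonalizing matrix, pass to the limit at an
  exceptional \<open>b\<close>: \<open>s j\<close> is holomorphic there and \<open>lf j\<close> is
  continuous along the whole cut.\<close>

lemma s_same_eigenvalues:
  assumes j: "j \<in> {1..p}" and b: "b \<in> imag_ray"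
  shows "same_eigenvalues (s j b) (F_tilde \<kappa> lf j b)"
  unfolding same_eigenvalues_def
proof
  fix z
  show "det (mat z - s j b) = det (mat z - F_tilde \<kappa> lf j b)"
  proof (rule tendsto_unique[OF exceptional_dense[OF b]])
    show "((\<lambda>b. det (mat z - s j b)) \<longlongrightarrow> det (mat z - s j b)) (at b within (imag_ray - exceptional))"
      by (rule tendsto_det[OF tendsto_diff[OF tendsto_const s_tendsto[OF j b]]])
    have lf: "((\<lambda>b. lf j (\<kappa> j + b)) \<longlongrightarrow> lf j (\<kappa> j + b)) (at b within (imag_ray - exceptional))"
    proof -
      have "continuous_on (cut (\<kappa> j)) (lf j)"
        using logb j by (simp add: log_branch_def)
      moreover have "continuous_on imag_ray (\<lambda>b. \<kappa> j + b)"
        by (intro continuous_on_add continuous_on_const continuous_on_id)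
      moreover have "(\<lambda>b. \<kappa> j + b) ` imag_ray \<subseteq> cut (\<kappa> j)"
        using tip_in_cut by blast
      ultimately have "continuous_on imag_ray (\<lambda>b. lf j (\<kappa> j + b))"
        by (rule continuous_on_compose2)
      then have "((\<lambda>b. lf j (\<kappa> j + b)) \<longlongrightarrow> lf j (\<kappa> j + b)) (at b within imag_ray)"
        using b by (simp add: continuous_on_def)
      then show ?thesis
        by (rule tendsto_within_subset) blast
    qed
    have "(F_tilde \<kappa> lf j \<longlongrightarrow> F_tilde \<kappa> lf j b) (at b within (imag_ray - exceptional))"
      unfolding F_tilde_def
    proof (rule tendsto_diag_mat)
      fix i
      from tendsto_mult[OF tendsto_const tendsto_vec_nth[OF lf], of "- (1 / (2 * of_real pi * \<i>))" i]
      show "((\<lambda>b. (\<chi> i. - (1 / (2 * of_real pi * \<i>)) * lf j (\<kappa> j + b) $ i) $ i) \<longlongrightarrow>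
          (\<chi> i. - (1 / (2 * of_real pi * \<i>)) * lf j (\<kappa> j + b) $ i) $ i)
          (at b within (imag_ray - exceptional))"
        by simp
    qed
    then have lim: "((\<lambda>b. det (mat z - F_tilde \<kappa> lf j b)) \<longlongrightarrow> det (mat z - F_tilde \<kappa> lf j b))
        (at b within (imag_ray - exceptional))"
      by (rule tendsto_det[OF tendsto_diff[OF tendsto_const]])
    have eq: "det (mat z - F_tilde \<kappa> lf j b) = det (mat z - s j b)" if "b \<in> imag_ray" "b \<notin> exceptional" for b
    proof -
      have "\<kappa> j + b \<notin> Z"
        using that(2) j by (auto simp: exceptional_def)
      from s_same_eigenvalues_generic[OF j that(1) this] show ?thesis
        by (simp add: same_eigenvalues_def)
    qed
    show "((\<lambda>b. det (mat z - s j b)) \<longlongrightarrow> det (mat z - F_tilde \<kappa> lf j b)) (at b within (imag_ray - exceptional))"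
      by (rule Lim_transform_eventually[OF lim]) (simp add: eventually_at_filter eq)
  qed
qed

end

section \<open>The system for the residues and the choice of the function F\<close>

theorem theorem2:
  fixes G :: "complex \<Rightarrow> complex^'n^'n"
    and p d :: nat
    and \<kappa> \<rho> :: "nat \<Rightarrow> complex"
    and \<epsilon> :: real
    and H s :: "nat \<Rightarrow> complex \<Rightarrow> complex^'n^'n"
    and Z W :: "complex set"
    and P B :: "complex \<Rightarrow> complex^'n^'n"
    and f lf :: "nat \<Rightarrow> complex \<Rightarrow> complex^'n"
    and U :: "complex \<Rightarrow> complex \<Rightarrow> complex^'n^'n"
  assumes "original_data G p \<kappa>"
    and "\<epsilon> > 0"
    and "coefficients G p \<kappa> \<epsilon> H"
    and "commutativity_restriction p \<kappa> \<epsilon> H"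
    and "common_eigenvectors p \<kappa> \<epsilon> H Z W P f"
    and "log_branch p \<kappa> f lf"
    and "RH_family p \<kappa> H Z P lf U"
    and "\<forall>j\<in>{1..p}. mat_holomorphic_on (s j) (half_strip \<epsilon>)"
    and "ODE1 p \<kappa> U s"
    and "matrix_B p \<kappa> \<epsilon> H W P d \<rho> B"
  shows "\<exists>r :: nat \<Rightarrow> complex \<Rightarrow> complex^'n^'n.
         \<exists>\<Phi> :: nat \<Rightarrow> complex \<Rightarrow> complex^'n^'n \<Rightarrow> complex^'n^'n \<Rightarrow> complex^'n^'n.
           (\<forall>j\<in>{1..p}. \<forall>b\<in>imag_ray. F_choice (\<Phi> j b)) \<and>
           (\<forall>l\<in>{1..d}. \<forall>b\<in>imag_ray. (\<forall>j\<in>{1..p}. \<rho> l \<noteq> \<kappa> j + b) \<longrightarrow>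
              (\<forall>m n. ((\<lambda>b. r l b $ m $ n) has_field_derivative
                 (\<Sum>j=1..p. mat (1 / (\<rho> l - (\<kappa> j + b))) ** commutator (s j b) (r l b)) $ m $ n)
                 (at b within imag_ray))) \<and>
           (\<forall>j\<in>{1..p}. \<forall>b\<in>imag_ray. (\<forall>l\<in>{1..d}. \<kappa> j + b \<noteq> \<rho> l) \<longrightarrow>
              (distinct_eigenvalues (B (\<kappa> j + b)) \<longrightarrow>
                 distinct_eigenvalues (R_matrix d \<rho> r b (\<kappa> j + b))) \<and>
              s j b = \<Phi> j b (F_tilde \<kappa> lf j b) (R_matrix d \<rho> r b (\<kappa> j + b)))"
proof -
  interpret rh_setting G p d \<kappa> \<rho> \<epsilon> H s Z W P B f lf U
    by (rule rh_setting.intro[OF assms])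
  obtain r where r: "M_residues r"
    and r_deriv: "\<forall>b\<in>imag_ray. \<forall>l. \<exists>D. mat_deriv (r l) D (at b within imag_ray)"
    using residues_exist by (elim exE conjE)
  obtain \<Phi>0 :: "complex^'n^'n \<Rightarrow> complex^'n^'n \<Rightarrow> complex^'n^'n" where \<Phi>0: "F_choice \<Phi>0"
    using F_choice_exists by (rule exE)
  \<comment> \<open>At a tip that meets a pole of \<open>B\<close> a fraction of
    \<open>R_matrix\<close> divides by zero, and \<open>residue_commute\<close> does not
    apply.\<close>
  define regular where "regular j b \<longleftrightarrow> (\<forall>l\<in>{1..d}. \<kappa> j + b \<noteq> \<rho> l)" for j b
  \<comment> \<open>A choice may be altered at a single pair of arguments. As \<open>\<Phi>\<close>
    depends on \<open>j\<close> and \<open>b\<close>, the alterations for different \<open>j\<close>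
    and \<open>b\<close> do not compete, even if they concern the same pair.\<close>
  define \<Phi> where "\<Phi> j b Y Y' =
    (if regular j b \<and> Y = F_tilde \<kappa> lf j b \<and> Y' = R_matrix d \<rho> r b (\<kappa> j + b) then s j b else \<Phi>0 Y Y')"
    for j b Y Y'
  have deriv: "\<exists>D. \<forall>l. mat_deriv (r l) (D l) (at b within imag_ray)" if "b \<in> imag_ray" for b
    using bspec[OF r_deriv that] by (rule choice)
  have choice: "F_choice (\<Phi> j b)" if j: "j \<in> {1..p}" and b: "b \<in> imag_ray" for j b
    unfolding F_choice_def
  proof (intro allI)
    fix Y Y' :: "complex^'n^'n"
    show "same_eigenvalues (\<Phi> j b Y Y') Y \<and>
        (distinct_eigenvalues Y' \<longrightarrow> (\<forall>v. eigenvector Y' v \<longrightarrow> eigenvector (\<Phi> j b Y Y') v))"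
    proof (cases "regular j b \<and> Y = F_tilde \<kappa> lf j b \<and> Y' = R_matrix d \<rho> r b (\<kappa> j + b)")
      case True
      obtain D where "\<forall>l. mat_deriv (r l) (D l) (at b within imag_ray)"
        using deriv[OF b] by (rule exE)
      then have D: "mat_deriv (r l) (D l) (at b within imag_ray)" for l
        by (rule spec)
      have "\<kappa> j + b \<noteq> \<rho> l" if "l \<in> {1..d}" for l
        using True that by (simp add: regular_def)
      from residue_commute[OF r D b j this] have comm: "s j b ** Y' = Y' ** s j b"
        using True by simp
      show ?thesis
        using True s_same_eigenvalues[OF j b] eigenvector_commuting[OF _ comm]
        by (simp add: \<Phi>_def)
    next
      case False
      then have "\<Phi> j b Y Y' = \<Phi>0 Y Y'"
        by (simp only: \<Phi>_def if_False)
      then show ?thesis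
        using \<Phi>0 by (simp add: F_choice_def)
    qed
  qed
  have ode: "((\<lambda>b. r l b $ m $ n) has_field_derivative
      (\<Sum>j=1..p. mat (1 / (\<rho> l - (\<kappa> j + b))) ** commutator (s j b) (r l b)) $ m $ n) (at b within imag_ray)"
    if l: "l \<in> {1..d}" and b: "b \<in> imag_ray" and off: "\<forall>j\<in>{1..p}. \<rho> l \<noteq> \<kappa> j + b" for l b m n
  proof -
    obtain D where "\<forall>l. mat_deriv (r l) (D l) (at b within imag_ray)"
      using deriv[OF b] by (rule exE)
    then have D: "mat_deriv (r l) (D l) (at b within imag_ray)" for l
      by (rule spec)
    have "D l $ m $ n = (\<Sum>j=1..p. mat (1 / (\<rho> l - (\<kappa> j + b))) ** commutator (s j b) (r l b)) $ m $ n"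
      using residue_ode[OF r D b l bspec[OF off], of m n] by simp
    with spec[OF spec[OF D[of l, unfolded mat_deriv_def]], of m n] show ?thesis
      by (simp only:)
  qed
  \<comment> \<open>The equation for \<open>s j b\<close> holds by construction of
    \<open>\<Phi>\<close>; its content lies in the proof that \<open>\<Phi> j b\<close> is a
    choice.\<close>
  have R: "(distinct_eigenvalues (B (\<kappa> j + b)) \<longrightarrow> distinct_eigenvalues (R_matrix d \<rho> r b (\<kappa> j + b))) \<and>
      s j b = \<Phi> j b (F_tilde \<kappa> lf j b) (R_matrix d \<rho> r b (\<kappa> j + b))"
    if b: "b \<in> imag_ray" and off: "\<forall>l\<in>{1..d}. \<kappa> j + b \<noteq> \<rho> l" for j b
  proof (intro conjI impI)
    assume *: "distinct_eigenvalues (B (\<kappa> j + b))"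
    have det: "det (mat z - B (\<kappa> j + b)) = det (mat z - (mat 1 + R_matrix d \<rho> r b (\<kappa> j + b)))" for z
      by (rule R_matrix_det[OF r b bspec[OF off]])
    show "distinct_eigenvalues (R_matrix d \<rho> r b (\<kappa> j + b))"
      by (rule distinct_eigenvalues_cong[OF det *])
  next
    have "regular j b"
      unfolding regular_def by (rule off)
    then show "s j b = \<Phi> j b (F_tilde \<kappa> lf j b) (R_matrix d \<rho> r b (\<kappa> j + b))"
      by (simp only: \<Phi>_def simp_thms if_True)
  qed
  show ?thesis
    by (rule exI[of _ r], rule exI[of _ \<Phi>], intro conjI ballI impI allI)
      (rule choice ode R[THEN conjunct1, THEN mp] R[THEN conjunct2]; assumption)+
qed

end
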